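(* Let $H$ be a Hopf algebra over a field $k$ and let $\mathcal F\in H\otimes H$ be a $2$-cocycle. If $C=A\cdot B$ is an algebra factorisation in the category of $H$-modules and $V$ is an $(H,B)$-module, then $$\mathrm{Ind}_{B_{\mathcal F}}^{C_{\mathcal F}}(V_{\mathcal F})\cong(\mathrm{Ind}_B^C(V))_{\mathcal F}$$ as $C_{\mathcal F}$-modules, where $B_{\mathcal F}$ and $C_{\mathcal F}$ are the Drinfeld twists of $B$, $C$, and $V_{\mathcal F}$ and $(\mathrm{Ind}_B^C(V))_{\mathcal F}$ are Giaquinto–Zhang twists. The two $C_{\mathcal F}$-module structures on the underlying vector space $A\otimes V$ are intertwined by the map $\mathcal F^{-1}\rhd\colon A\otimes V\to A\otimes V$.
   Context: All tensor products are over $k$ unless indicated; algebras are associative and unital. $H$ has coproduct $\triangle$, counit $\epsilon$, antipode $S$; Sweedler notation $\triangle(h)=h_{(1)}\otimes h_{(2)}$. A $2$-cocycle on $H$ is an invertible $\mathcal F\in H\otimes H$ such that $(\mathcal F\otimes1)\cdot(\triangle\otimes\mathrm{id})(\mathcal F)=(1\otimes\mathcal F)\cdot(\mathrm{id}\otimes\triangle)(\mathcal F)$ and $(\epsilon\otimes\mathrm{id})(\mathcal F)=1=(\mathrm{id}\otimes\epsilon)(\mathcal F)$. For $H$-modules $X,Y$, $\mathcal F^{-1}\rhd$ denotes the action of $\mathcal F^{-1}\in H\otimes H$ on $X\otimes Y$. The Drinfeld twist of an $H$-module algebra $(A,m)$ is the algebra $A_{\mathcal F}$ with the same underlying space and product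 $m\circ(\mathcal F^{-1}\rhd)$. It is a module algebra for $H^{\mathcal F}$, which is $H$ with the same algebra structure and coproduct $\mathcal F\triangle(\cdot)\mathcal F^{-1}$. For an $H$-module algebra $A$, an $(H,A)$-module is a vector space $V$ that is both an $H$-module and an $A$-module (action $\rhd_A$) with $h\rhd(a\rhd_Av)=(h_{(1)}\rhd a)\rhd_A(h_{(2)}\rhd v)$ for all $h\in H,a\in A,v\in V$. Its Giaquinto–Zhang twist $V_{\mathcal F}$ is the $A_{\mathcal F}$-module on the same vector space with action $\rhd_{\mathcal F}=\rhd_A\circ(\mathcal F^{-1}\rhd)\colon A_{\mathcal F}\otimes V_{\mathcal F}\to V_{\mathcal F}$. An algebra factorisation $C=A\cdot B$ is a pair of subalgebras $A,B$ of an algebra $C$ such that multiplication $A\otimes B\to C$ is a $k$-linear isomorphism; it is an algebra factorisation in the category of $H$-modules if $C$ is an $H$-module algebra and $A,B$ are $H$-module subalgebras. In that case $C_{\mathcal F}=A_{\mathcal F}\cdot B_{\mathcal F}$ is an algebra factorisation as well. For a $B$-module $V$, $\mathrm{Ind}_B^C(V)=C\otimes_BV$, identified with $A\otimes V$ as a vector space via the factorisation; similarly $\mathrm{Ind}_{B_{\mathcal F}}^{C_{\mathcal F}}(V_{\mathcal F})=C_{\mathcal F}\otimes_{B_{\mathcal F}}V_{\mathcal F}$ is identified with $A\otimes V$ via $C_{\mathcal F}=A_{\mathcal F}\cdot B_{\mathcal F}$. If $V$ is an $(H,B)$-module, then $\mathrm{Ind}_B^C(V)$ is an $(H,C)$-module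 with $H$ acting on $A\otimes V$ by $h\rhd(a\otimes v)=(h_{(1)}\rhd a)\otimes(h_{(2)}\rhd v)$. *)

theory Defs
  imports "HOL-Algebra.Module" "HOL-Algebra.AbelCoset" "HOL-Algebra.Subrings"
begin

text \<open>
  Vector spaces over a field \<open>K\<close> are HOL-Algebra modules over \<open>K\<close>.  A \<open>K\<close>-algebra is a record of
  type \<open>module\<close> whose \<open>mult\<close> and \<open>one\<close> fields are also used; for mere vector spaces these two fields
  are ignored.  (The library locale \<open>algebra\<close> demands commutativity and is therefore not usable.)
\<close>

section \<open>Linear algebra\<close>

definition linear_maps ::
    "'k ring \<Rightarrow> ('k, 'a) module \<Rightarrow> ('k, 'b) module \<Rightarrow> ('a \<Rightarrow> 'b) set" where
  "linear_maps K X Y = {f \<in> carrier X \<rightarrow> carrier Y.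
     (\<forall>x\<in>carrier X. \<forall>y\<in>carrier X. f (x \<oplus>\<^bsub>X\<^esub> y) = f x \<oplus>\<^bsub>Y\<^esub> f y) \<and>
     (\<forall>c\<in>carrier K. \<forall>x\<in>carrier X. f (c \<odot>\<^bsub>X\<^esub> x) = c \<odot>\<^bsub>Y\<^esub> f x)}"

definition bilinear_map ::
    "'k ring \<Rightarrow> ('k, 'a) module \<Rightarrow> ('k, 'b) module \<Rightarrow> ('k, 'c) module \<Rightarrow> ('a \<Rightarrow> 'b \<Rightarrow> 'c) \<Rightarrow> bool" where
  "bilinear_map K X Y W f \<longleftrightarrow>
     (\<forall>x\<in>carrier X. f x \<in> linear_maps K Y W) \<and>
     (\<forall>y\<in>carrier Y. (\<lambda>x. f x y) \<in> linear_maps K X W)"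

definition submodule_span ::
    "'k ring \<Rightarrow> ('k, 'a) module \<Rightarrow> 'a set \<Rightarrow> 'a set" where
  "submodule_span K X G = (\<lambda>N. submodule N K X) hull G"

definition quotient_module ::
    "'k ring \<Rightarrow> ('k, 'a) module \<Rightarrow> 'a set \<Rightarrow> ('k, 'a set) module" where
  "quotient_module K X N =
     \<lparr>carrier = a_rcosets\<^bsub>X\<^esub> N, mult = undefined, one = undefined,
      zero = N, add = (\<lambda>P Q. P <+>\<^bsub>X\<^esub> Q),
      smult = (\<lambda>c P. \<Union>x\<in>P. N +>\<^bsub>X\<^esub> (c \<odot>\<^bsub>X\<^esub> x))\<rparr>"

definition free_module :: "'k ring \<Rightarrow> 's set \<Rightarrow> ('k, 's \<Rightarrow> 'k) module" where
  "free_module K S =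
     \<lparr>carrier = {f \<in> S \<rightarrow> carrier K. finite {s. f s \<noteq> \<zero>\<^bsub>K\<^esub>} \<and> (\<forall>s. s \<notin> S \<longrightarrow> f s = \<zero>\<^bsub>K\<^esub>)},
      mult = undefined, one = undefined,
      zero = (\<lambda>s. \<zero>\<^bsub>K\<^esub>), add = (\<lambda>f g s. f s \<oplus>\<^bsub>K\<^esub> g s), smult = (\<lambda>c f s. c \<otimes>\<^bsub>K\<^esub> f s)\<rparr>"

definition free_basis :: "'k ring \<Rightarrow> 's \<Rightarrow> 's \<Rightarrow> 'k" where
  "free_basis K s = (\<lambda>t. if t = s then \<one>\<^bsub>K\<^esub> else \<zero>\<^bsub>K\<^esub>)"


section \<open>Tensor products over the ground field\<close>

definition tensor_relations ::
    "'k ring \<Rightarrow> ('k, 'a) module \<Rightarrow> ('k, 'b) module \<Rightarrow> ('a \<times> 'b \<Rightarrow> 'k) set" where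
  "tensor_relations K X Y =
    (let M = free_module K (carrier X \<times> carrier Y); e = (\<lambda>x y. free_basis K (x, y)) in
     submodule_span K M
      ({e (x \<oplus>\<^bsub>X\<^esub> x') y \<ominus>\<^bsub>M\<^esub> (e x y \<oplus>\<^bsub>M\<^esub> e x' y) | x x' y.
          x \<in> carrier X \<and> x' \<in> carrier X \<and> y \<in> carrier Y} \<union>
       {e x (y \<oplus>\<^bsub>Y\<^esub> y') \<ominus>\<^bsub>M\<^esub> (e x y \<oplus>\<^bsub>M\<^esub> e x y') | x y y'.
          x \<in> carrier X \<and> y \<in> carrier Y \<and> y' \<in> carrier Y} \<union>
       {e (c \<odot>\<^bsub>X\<^esub> x) y \<ominus>\<^bsub>M\<^esub> c \<odot>\<^bsub>M\<^esub> e x y | c x y.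
          c \<in> carrier K \<and> x \<in> carrier X \<and> y \<in> carrier Y} \<union>
       {e x (c \<odot>\<^bsub>Y\<^esub> y) \<ominus>\<^bsub>M\<^esub> c \<odot>\<^bsub>M\<^esub> e x y | c x y.
          c \<in> carrier K \<and> x \<in> carrier X \<and> y \<in> carrier Y}))"

definition tensor ::
    "'k ring \<Rightarrow> ('k, 'a) module \<Rightarrow> ('k, 'b) module \<Rightarrow> ('k, ('a \<times> 'b \<Rightarrow> 'k) set) module" where
  "tensor K X Y =
     quotient_module K (free_module K (carrier X \<times> carrier Y)) (tensor_relations K X Y)"

definition pure_tensor ::
    "'k ring \<Rightarrow> ('k, 'a) module \<Rightarrow> ('k, 'b) module \<Rightarrow> 'a \<Rightarrow> 'b \<Rightarrow> ('a \<times> 'b \<Rightarrow> 'k) set" where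
  "pure_tensor K X Y x y =
     tensor_relations K X Y +>\<^bsub>free_module K (carrier X \<times> carrier Y)\<^esub> free_basis K (x, y)"

text \<open>
  The linear map \<open>X \<otimes> Y \<rightarrow> W\<close> with \<open>x \<otimes> y \<mapsto> f x y\<close>.  For bilinear \<open>f\<close> it exists and is unique on
  the carrier of \<open>X \<otimes> Y\<close>; nothing is known about it for other \<open>f\<close>.
  Thus \<open>tensor_lift K H H W f (\<Delta> h)\<close> is the Sweedler expression \<open>f h\<^sub>1 h\<^sub>2\<close>.
\<close>

definition tensor_lift ::
    "'k ring \<Rightarrow> ('k, 'a) module \<Rightarrow> ('k, 'b) module \<Rightarrow> ('k, 'w) module \<Rightarrow> ('a \<Rightarrow> 'b \<Rightarrow> 'w)
      \<Rightarrow> ('a \<times> 'b \<Rightarrow> 'k) set \<Rightarrow> 'w" where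
  "tensor_lift K X Y W f =
     (SOME g. g \<in> linear_maps K (tensor K X Y) W \<and>
        (\<forall>x\<in>carrier X. \<forall>y\<in>carrier Y. g (pure_tensor K X Y x y) = f x y))"

definition tensor_map ::
    "'k ring \<Rightarrow> ('k, 'a) module \<Rightarrow> ('k, 'b) module \<Rightarrow> ('k, 'c) module \<Rightarrow> ('k, 'd) module
      \<Rightarrow> ('a \<Rightarrow> 'c) \<Rightarrow> ('b \<Rightarrow> 'd) \<Rightarrow> ('a \<times> 'b \<Rightarrow> 'k) set \<Rightarrow> ('c \<times> 'd \<Rightarrow> 'k) set" where
  "tensor_map K X Y X' Y' f g =
     tensor_lift K X Y (tensor K X' Y') (\<lambda>x y. pure_tensor K X' Y' (f x) (g y))"

definition tensor_assoc ::
    "'k ring \<Rightarrow> ('k, 'a) module \<Rightarrow> ('k, 'b) module \<Rightarrow> ('k, 'c) module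
      \<Rightarrow> ('a \<times> ('b \<times> 'c \<Rightarrow> 'k) set \<Rightarrow> 'k) set \<Rightarrow> (('a \<times> 'b \<Rightarrow> 'k) set \<times> 'c \<Rightarrow> 'k) set"
    \<comment> \<open>the associator \<open>X \<otimes> (Y \<otimes> Z) \<rightarrow> (X \<otimes> Y) \<otimes> Z\<close>\<close> where
  "tensor_assoc K X Y Z =
     (let W = tensor K (tensor K X Y) Z in
      tensor_lift K X (tensor K Y Z) W
        (\<lambda>x. tensor_lift K Y Z W
               (\<lambda>y z. pure_tensor K (tensor K X Y) Z (pure_tensor K X Y x y) z)))"

text \<open>The algebra \<open>X \<otimes> Y\<close>, with product \<open>(x \<otimes> y)(x' \<otimes> y') = xx' \<otimes> yy'\<close>.\<close>

definition tensor_algebra ::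
    "'k ring \<Rightarrow> ('k, 'a) module \<Rightarrow> ('k, 'b) module \<Rightarrow> ('k, ('a \<times> 'b \<Rightarrow> 'k) set) module" where
  "tensor_algebra K X Y = (tensor K X Y)
     \<lparr>mult := (\<lambda>s t. tensor_lift K X Y (tensor K X Y)
                 (\<lambda>x y. tensor_map K X Y X Y (\<lambda>x'. x \<otimes>\<^bsub>X\<^esub> x') (\<lambda>y'. y \<otimes>\<^bsub>Y\<^esub> y') t) s),
      one := pure_tensor K X Y \<one>\<^bsub>X\<^esub> \<one>\<^bsub>Y\<^esub>\<rparr>"


section \<open>Algebras and modules over them\<close>

locale assoc_algebra = field K + module K A + ring A
  for K :: "'k ring" and A :: "('k, 'a) module" +
  assumes smult_mult_left: "\<lbrakk>c \<in> carrier K; x \<in> carrier A; y \<in> carrier A\<rbrakk> \<Longrightarrow>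
            (c \<odot>\<^bsub>A\<^esub> x) \<otimes>\<^bsub>A\<^esub> y = c \<odot>\<^bsub>A\<^esub> (x \<otimes>\<^bsub>A\<^esub> y)"
    and smult_mult_right: "\<lbrakk>c \<in> carrier K; x \<in> carrier A; y \<in> carrier A\<rbrakk> \<Longrightarrow>
            x \<otimes>\<^bsub>A\<^esub> (c \<odot>\<^bsub>A\<^esub> y) = c \<odot>\<^bsub>A\<^esub> (x \<otimes>\<^bsub>A\<^esub> y)"

definition subalgebra_of :: "'k ring \<Rightarrow> ('k, 'a) module \<Rightarrow> 'a set \<Rightarrow> bool" where
  "subalgebra_of K C A \<longleftrightarrow> subring A C \<and> submodule A K C"

locale left_module = assoc_algebra K R + V: module K V
  for K :: "'k ring" and R :: "('k, 'r) module" and V :: "('k, 'v) module"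
    and act :: "'r \<Rightarrow> 'v \<Rightarrow> 'v" +
  assumes act_bilinear: "bilinear_map K R V V act"
    and act_one: "v \<in> carrier V \<Longrightarrow> act \<one>\<^bsub>R\<^esub> v = v"
    and act_mult: "\<lbrakk>r \<in> carrier R; s \<in> carrier R; v \<in> carrier V\<rbrakk> \<Longrightarrow>
            act (r \<otimes>\<^bsub>R\<^esub> s) v = act r (act s v)"

definition left_module_iso ::
    "'k ring \<Rightarrow> ('k, 'r) module \<Rightarrow> ('k, 'v) module \<Rightarrow> ('r \<Rightarrow> 'v \<Rightarrow> 'v)
      \<Rightarrow> ('k, 'w) module \<Rightarrow> ('r \<Rightarrow> 'w \<Rightarrow> 'w) \<Rightarrow> ('v \<Rightarrow> 'w) \<Rightarrow> bool" where
  "left_module_iso K R V actV W actW f \<longleftrightarrow>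
     left_module K R V actV \<and> left_module K R W actW \<and>
     f \<in> linear_maps K V W \<and> bij_betw f (carrier V) (carrier W) \<and>
     (\<forall>r\<in>carrier R. \<forall>v\<in>carrier V. f (actV r v) = actW r (f v))"


section \<open>Hopf algebras, 2-cocycles, module algebras\<close>

locale hopf_algebra = assoc_algebra K H
  for K :: "'k ring" and H :: "('k, 'h) module"
    and \<Delta> :: "'h \<Rightarrow> ('h \<times> 'h \<Rightarrow> 'k) set" and \<epsilon> :: "'h \<Rightarrow> 'k" and S :: "'h \<Rightarrow> 'h" +
  assumes comult_linear: "\<Delta> \<in> linear_maps K H (tensor K H H)"
    and comult_hom: "\<Delta> \<in> ring_hom H (tensor_algebra K H H)"
    and counit_linear: "\<lbrakk>c \<in> carrier K; h \<in> carrier H\<rbrakk> \<Longrightarrow> \<epsilon> (c \<odot>\<^bsub>H\<^esub> h) = c \<otimes>\<^bsub>K\<^esub> \<epsilon> h"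
    and counit_hom: "\<epsilon> \<in> ring_hom H K"
    and antipode_linear: "S \<in> linear_maps K H H"
    and coassoc: "h \<in> carrier H \<Longrightarrow>
          tensor_map K H H (tensor K H H) H \<Delta> (\<lambda>x. x) (\<Delta> h) =
          tensor_assoc K H H H (tensor_map K H H H (tensor K H H) (\<lambda>x. x) \<Delta> (\<Delta> h))"
    and counit_left: "h \<in> carrier H \<Longrightarrow> tensor_lift K H H H (\<lambda>x y. \<epsilon> x \<odot>\<^bsub>H\<^esub> y) (\<Delta> h) = h"
    and counit_right: "h \<in> carrier H \<Longrightarrow> tensor_lift K H H H (\<lambda>x y. \<epsilon> y \<odot>\<^bsub>H\<^esub> x) (\<Delta> h) = h"
    and antipode_left: "h \<in> carrier H \<Longrightarrow>
          tensor_lift K H H H (\<lambda>x y. S x \<otimes>\<^bsub>H\<^esub> y) (\<Delta> h) = \<epsilon> h \<odot>\<^bsub>H\<^esub> \<one>\<^bsub>H\<^esub>"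
    and antipode_right: "h \<in> carrier H \<Longrightarrow>
          tensor_lift K H H H (\<lambda>x y. x \<otimes>\<^bsub>H\<^esub> S y) (\<Delta> h) = \<epsilon> h \<odot>\<^bsub>H\<^esub> \<one>\<^bsub>H\<^esub>"

text \<open>The cocycle identity is stated in \<open>(H \<otimes> H) \<otimes> H\<close>.\<close>

definition two_cocycle ::
    "'k ring \<Rightarrow> ('k, 'h) module \<Rightarrow> ('h \<Rightarrow> ('h \<times> 'h \<Rightarrow> 'k) set) \<Rightarrow> ('h \<Rightarrow> 'k)
      \<Rightarrow> ('h \<times> 'h \<Rightarrow> 'k) set \<Rightarrow> bool" where
  "two_cocycle K H \<Delta> \<epsilon> F \<longleftrightarrow>
    (let HH = tensor_algebra K H H; HHH = tensor_algebra K HH H in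
     F \<in> Units HH \<and>
     pure_tensor K HH H F \<one>\<^bsub>H\<^esub> \<otimes>\<^bsub>HHH\<^esub> tensor_map K H H HH H \<Delta> (\<lambda>x. x) F =
     tensor_assoc K H H H (pure_tensor K H HH \<one>\<^bsub>H\<^esub> F) \<otimes>\<^bsub>HHH\<^esub>
       tensor_assoc K H H H (tensor_map K H H H HH (\<lambda>x. x) \<Delta> F) \<and>
     tensor_lift K H H H (\<lambda>x y. \<epsilon> x \<odot>\<^bsub>H\<^esub> y) F = \<one>\<^bsub>H\<^esub> \<and>
     tensor_lift K H H H (\<lambda>x y. \<epsilon> y \<odot>\<^bsub>H\<^esub> x) F = \<one>\<^bsub>H\<^esub>)"

text \<open>The action of \<open>t \<in> H \<otimes> H\<close> on \<open>X \<otimes> Y\<close>, for \<open>H\<close>-modules \<open>X\<close> and \<open>Y\<close>.\<close>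

definition tensor_act ::
    "'k ring \<Rightarrow> ('k, 'h) module \<Rightarrow> ('k, 'a) module \<Rightarrow> ('h \<Rightarrow> 'a \<Rightarrow> 'a)
      \<Rightarrow> ('k, 'b) module \<Rightarrow> ('h \<Rightarrow> 'b \<Rightarrow> 'b)
      \<Rightarrow> ('h \<times> 'h \<Rightarrow> 'k) set \<Rightarrow> ('a \<times> 'b \<Rightarrow> 'k) set \<Rightarrow> ('a \<times> 'b \<Rightarrow> 'k) set" where
  "tensor_act K H X actX Y actY t =
     tensor_lift K X Y (tensor K X Y)
       (\<lambda>x y. tensor_lift K H H (tensor K X Y)
                (\<lambda>h h'. pure_tensor K X Y (actX h x) (actY h' y)) t)"

locale module_algebra = left_module K H A act + A: assoc_algebra K A
  for K :: "'k ring" and H :: "('k, 'h) module"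
    and \<Delta> :: "'h \<Rightarrow> ('h \<times> 'h \<Rightarrow> 'k) set" and \<epsilon> :: "'h \<Rightarrow> 'k"
    and A :: "('k, 'a) module" and act :: "'h \<Rightarrow> 'a \<Rightarrow> 'a" +
  assumes act_product: "\<lbrakk>h \<in> carrier H; a \<in> carrier A; b \<in> carrier A\<rbrakk> \<Longrightarrow>
            act h (a \<otimes>\<^bsub>A\<^esub> b) = tensor_lift K H H A (\<lambda>x y. act x a \<otimes>\<^bsub>A\<^esub> act y b) (\<Delta> h)"
    and act_unit: "h \<in> carrier H \<Longrightarrow> act h \<one>\<^bsub>A\<^esub> = \<epsilon> h \<odot>\<^bsub>A\<^esub> \<one>\<^bsub>A\<^esub>"

text \<open>\<open>(H, A)\<close>-modules \<open>V\<close>; \<open>actA\<close>, \<open>hV\<close>, \<open>aV\<close> are the actions of \<open>H\<close> on \<open>A\<close>, of \<open>H\<close> on \<open>V\<close> and of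
  \<open>A\<close> on \<open>V\<close>.\<close>

locale equivariant_module =
  module_algebra K H \<Delta> \<epsilon> A hA + HV: left_module K H V hV + AV: left_module K A V aV
  for K :: "'k ring" and H :: "('k, 'h) module"
    and \<Delta> :: "'h \<Rightarrow> ('h \<times> 'h \<Rightarrow> 'k) set" and \<epsilon> :: "'h \<Rightarrow> 'k"
    and A :: "('k, 'a) module" and hA :: "'h \<Rightarrow> 'a \<Rightarrow> 'a"
    and V :: "('k, 'v) module" and hV :: "'h \<Rightarrow> 'v \<Rightarrow> 'v" and aV :: "'a \<Rightarrow> 'v \<Rightarrow> 'v" +
  assumes equivariance: "\<lbrakk>h \<in> carrier H; a \<in> carrier A; v \<in> carrier V\<rbrakk> \<Longrightarrow>
            hV h (aV a v) = tensor_lift K H H V (\<lambda>x y. aV (hA x a) (hV y v)) (\<Delta> h)"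

definition algebra_factorisation ::
    "'k ring \<Rightarrow> ('k, 'c) module \<Rightarrow> 'c set \<Rightarrow> 'c set \<Rightarrow> bool" where
  "algebra_factorisation K C A B \<longleftrightarrow>
     assoc_algebra K C \<and> subalgebra_of K C A \<and> subalgebra_of K C B \<and>
     (let A' = C\<lparr>carrier := A\<rparr>; B' = C\<lparr>carrier := B\<rparr> in
      bij_betw (tensor_lift K A' B' C (mult C)) (carrier (tensor K A' B')) (carrier C))"

definition equivariant_algebra_factorisation ::
    "'k ring \<Rightarrow> ('k, 'h) module \<Rightarrow> ('h \<Rightarrow> ('h \<times> 'h \<Rightarrow> 'k) set) \<Rightarrow> ('h \<Rightarrow> 'k)
      \<Rightarrow> ('k, 'c) module \<Rightarrow> ('h \<Rightarrow> 'c \<Rightarrow> 'c) \<Rightarrow> 'c set \<Rightarrow> 'c set \<Rightarrow> bool" where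
  "equivariant_algebra_factorisation K H \<Delta> \<epsilon> C hC A B \<longleftrightarrow>
     algebra_factorisation K C A B \<and> module_algebra K H \<Delta> \<epsilon> C hC \<and>
     (\<forall>h\<in>carrier H. hC h ` A \<subseteq> A \<and> hC h ` B \<subseteq> B)"


section \<open>Twists\<close>

text \<open>In both definitions the argument \<open>G\<close> stands for the inverse of the cocycle.\<close>

definition drinfeld_twist ::
    "'k ring \<Rightarrow> ('k, 'h) module \<Rightarrow> ('h \<times> 'h \<Rightarrow> 'k) set
      \<Rightarrow> ('k, 'a) module \<Rightarrow> ('h \<Rightarrow> 'a \<Rightarrow> 'a) \<Rightarrow> ('k, 'a) module" where
  "drinfeld_twist K H G A hA = A
     \<lparr>mult := (\<lambda>a b. tensor_lift K A A A (mult A)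
                       (tensor_act K H A hA A hA G (pure_tensor K A A a b)))\<rparr>"

definition giaquinto_zhang_twist ::
    "'k ring \<Rightarrow> ('k, 'h) module \<Rightarrow> ('h \<times> 'h \<Rightarrow> 'k) set
      \<Rightarrow> ('k, 'a) module \<Rightarrow> ('h \<Rightarrow> 'a \<Rightarrow> 'a)
      \<Rightarrow> ('k, 'v) module \<Rightarrow> ('h \<Rightarrow> 'v \<Rightarrow> 'v) \<Rightarrow> ('a \<Rightarrow> 'v \<Rightarrow> 'v) \<Rightarrow> 'a \<Rightarrow> 'v \<Rightarrow> 'v" where
  "giaquinto_zhang_twist K H G A hA V hV aV = (\<lambda>a v.
     tensor_lift K A V V aV (tensor_act K H A hA V hV G (pure_tensor K A V a v)))"


section \<open>Induced modules\<close>

text \<open>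
  \<open>C \<otimes>\<^bsub>B\<^esub> V\<close> as the quotient of \<open>C \<otimes> V\<close> by the span of all \<open>cb \<otimes> v - c \<otimes> bv\<close>, where \<open>bV\<close> is the
  action of \<open>B\<close> on \<open>V\<close>.
\<close>

definition balancing_relations ::
    "'k ring \<Rightarrow> ('k, 'c) module \<Rightarrow> ('k, 'c) module \<Rightarrow> ('k, 'v) module \<Rightarrow> ('c \<Rightarrow> 'v \<Rightarrow> 'v)
      \<Rightarrow> ('c \<times> 'v \<Rightarrow> 'k) set set" where
  "balancing_relations K C B V bV = submodule_span K (tensor K C V)
     {pure_tensor K C V (c \<otimes>\<^bsub>C\<^esub> b) v \<ominus>\<^bsub>tensor K C V\<^esub> pure_tensor K C V c (bV b v) | c b v.
        c \<in> carrier C \<and> b \<in> carrier B \<and> v \<in> carrier V}"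

definition Ind ::
    "'k ring \<Rightarrow> ('k, 'c) module \<Rightarrow> ('k, 'c) module \<Rightarrow> ('k, 'v) module \<Rightarrow> ('c \<Rightarrow> 'v \<Rightarrow> 'v)
      \<Rightarrow> ('k, ('c \<times> 'v \<Rightarrow> 'k) set set) module" where
  "Ind K C B V bV = quotient_module K (tensor K C V) (balancing_relations K C B V bV)"

definition Ind_tensor ::
    "'k ring \<Rightarrow> ('k, 'c) module \<Rightarrow> ('k, 'c) module \<Rightarrow> ('k, 'v) module \<Rightarrow> ('c \<Rightarrow> 'v \<Rightarrow> 'v)
      \<Rightarrow> 'c \<Rightarrow> 'v \<Rightarrow> ('c \<times> 'v \<Rightarrow> 'k) set set" where
  "Ind_tensor K C B V bV c v =
     balancing_relations K C B V bV +>\<^bsub>tensor K C V\<^esub> pure_tensor K C V c v"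

text \<open>The action of \<open>c \<in> C\<close> is the linear map with \<open>c' \<otimes>\<^bsub>B\<^esub> v \<mapsto> cc' \<otimes>\<^bsub>B\<^esub> v\<close>; it is unique on the
  carrier.\<close>

definition Ind_act ::
    "'k ring \<Rightarrow> ('k, 'c) module \<Rightarrow> ('k, 'c) module \<Rightarrow> ('k, 'v) module \<Rightarrow> ('c \<Rightarrow> 'v \<Rightarrow> 'v)
      \<Rightarrow> 'c \<Rightarrow> ('c \<times> 'v \<Rightarrow> 'k) set set \<Rightarrow> ('c \<times> 'v \<Rightarrow> 'k) set set" where
  "Ind_act K C B V bV c =
     (SOME g. g \<in> linear_maps K (Ind K C B V bV) (Ind K C B V bV) \<and>
        (\<forall>c'\<in>carrier C. \<forall>v\<in>carrier V.
           g (Ind_tensor K C B V bV c' v) = Ind_tensor K C B V bV (c \<otimes>\<^bsub>C\<^esub> c') v))"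

text \<open>For a factorisation \<open>C = A \<cdot> B\<close>, the identification \<open>A \<otimes> V \<rightarrow> C \<otimes>\<^bsub>B\<^esub> V\<close>,
  \<open>a \<otimes> v \<mapsto> a \<otimes>\<^bsub>B\<^esub> v\<close>, and the resulting action of \<open>C\<close> on \<open>A \<otimes> V\<close>.\<close>

definition Ind_ident ::
    "'k ring \<Rightarrow> ('k, 'c) module \<Rightarrow> ('k, 'c) module \<Rightarrow> ('k, 'c) module \<Rightarrow> ('k, 'v) module
      \<Rightarrow> ('c \<Rightarrow> 'v \<Rightarrow> 'v) \<Rightarrow> ('c \<times> 'v \<Rightarrow> 'k) set \<Rightarrow> ('c \<times> 'v \<Rightarrow> 'k) set set" where
  "Ind_ident K C A B V bV = tensor_lift K A V (Ind K C B V bV) (Ind_tensor K C B V bV)"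

definition Ind_act_factored ::
    "'k ring \<Rightarrow> ('k, 'c) module \<Rightarrow> ('k, 'c) module \<Rightarrow> ('k, 'c) module \<Rightarrow> ('k, 'v) module
      \<Rightarrow> ('c \<Rightarrow> 'v \<Rightarrow> 'v) \<Rightarrow> 'c \<Rightarrow> ('c \<times> 'v \<Rightarrow> 'k) set \<Rightarrow> ('c \<times> 'v \<Rightarrow> 'k) set" where
  "Ind_act_factored K C A B V bV c t =
     inv_into (carrier (tensor K A V)) (Ind_ident K C A B V bV)
       (Ind_act K C B V bV c (Ind_ident K C A B V bV t))"

text \<open>The diagonal action of \<open>H\<close> on \<open>A \<otimes> V\<close>, and the action of \<open>H\<close> on \<open>C \<otimes>\<^bsub>B\<^esub> V\<close> obtained from it
  through the identification.\<close>

definition diagonal_act ::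
    "'k ring \<Rightarrow> ('k, 'h) module \<Rightarrow> ('h \<Rightarrow> ('h \<times> 'h \<Rightarrow> 'k) set)
      \<Rightarrow> ('k, 'a) module \<Rightarrow> ('h \<Rightarrow> 'a \<Rightarrow> 'a) \<Rightarrow> ('k, 'v) module \<Rightarrow> ('h \<Rightarrow> 'v \<Rightarrow> 'v)
      \<Rightarrow> 'h \<Rightarrow> ('a \<times> 'v \<Rightarrow> 'k) set \<Rightarrow> ('a \<times> 'v \<Rightarrow> 'k) set" where
  "diagonal_act K H \<Delta> A hA V hV h = tensor_act K H A hA V hV (\<Delta> h)"

definition Ind_hopf_act ::
    "'k ring \<Rightarrow> ('k, 'h) module \<Rightarrow> ('h \<Rightarrow> ('h \<times> 'h \<Rightarrow> 'k) set)
      \<Rightarrow> ('k, 'c) module \<Rightarrow> ('h \<Rightarrow> 'c \<Rightarrow> 'c) \<Rightarrow> ('k, 'c) module \<Rightarrow> ('k, 'c) module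
      \<Rightarrow> ('k, 'v) module \<Rightarrow> ('h \<Rightarrow> 'v \<Rightarrow> 'v) \<Rightarrow> ('c \<Rightarrow> 'v \<Rightarrow> 'v)
      \<Rightarrow> 'h \<Rightarrow> ('c \<times> 'v \<Rightarrow> 'k) set set \<Rightarrow> ('c \<times> 'v \<Rightarrow> 'k) set set" where
  "Ind_hopf_act K H \<Delta> C hC A B V hV bV h z =
     Ind_ident K C A B V bV (diagonal_act K H \<Delta> A hC V hV h
       (inv_into (carrier (tensor K A V)) (Ind_ident K C A B V bV) z))"

end

theory Submission
  imports Defs
begin

text \<open>
  Every object that is twisted here is twisted in the same way.  A tensor \<open>t = \<Sum> h\<^sub>i \<otimes> h'\<^sub>i\<close> in
  \<open>H \<otimes> H\<close> acts on a bilinear map \<open>m : X \<times> Y \<rightarrow> W\<close>, where \<open>X\<close> and \<open>Y\<close> are \<open>H\<close>-modules, by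
  \<open>(x, y) \<mapsto> \<Sum> m (h\<^sub>i x) (h'\<^sub>i y)\<close> (\<open>twist_map\<close>).  For \<open>t = G = F\<^sup>-\<^sup>1\<close> the product of a module algebra
  becomes its Drinfeld twist and the action on an equivariant module its Giaquinto-Zhang twist.

  The heart of the proof is \<open>twisted_associativity\<close>: an identity \<open>m2 (m1 x y) z = m4 x (m3 y z)\<close>, with
  \<open>m1\<close> and \<open>m3\<close> equivariant, survives if all four maps are twisted by \<open>G\<close>.  Moving elements of \<open>H\<close>
  through \<open>m1\<close> and \<open>m3\<close> by means of \<open>\<Delta>\<close> turns the two sides into the values of one linear map on
  \<open>H \<otimes> H \<otimes> H\<close> at \<open>(\<Delta> \<otimes> id)(G) (G \<otimes> 1)\<close> and at \<open>(id \<otimes> \<Delta>)(G) (1 \<otimes> G)\<close>, and these agree because they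
  are the inverses of the two sides of the cocycle identity.  Applied to products and actions, this
  yields the associativity of \<open>C\<^sub>F\<close> and the module axiom for \<open>V\<^sub>F\<close> and for the twist of the induced
  module.  With \<open>(\<Delta> h, 1)\<close> in place of \<open>(G, G)\<close> the required identity is coassociativity, and the same
  lemma shows that the diagonal action on \<open>A \<otimes> V\<close> makes \<open>C \<otimes>\<^sub>B V\<close> an \<open>(H, C)\<close>-module.

  The isomorphism sends \<open>c \<otimes> v\<close>, a tensor over \<open>B\<^sub>F\<close>, to the sum of all \<open>g c \<otimes>\<^sub>B g' v\<close>, where
  \<open>G = \<Sum> g \<otimes> g'\<close>; this is the canonical map \<open>C \<times> V \<rightarrow> C \<otimes>\<^sub>B V\<close> twisted by \<open>G\<close>.  It is well defined
  and \<open>C\<^sub>F\<close>-linear by \<open>twisted_associativity\<close>, applied to \<open>C \<times> B \<times> V\<close> and to \<open>C \<times> C \<times> V\<close>.  Under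
  the identifications of both induced modules with \<open>A \<otimes> V\<close> it becomes the action of \<open>G\<close>, which is
  bijective because \<open>G\<close> is invertible; this gives both claims.  The identification is bijective for
  every factorisation, with inverse \<open>ab \<otimes> v \<mapsto> a \<otimes> bv\<close> (\<open>Ind_ident_bij\<close>), and \<open>C\<^sub>F = A\<^sub>F \<cdot> B\<^sub>F\<close> is a
  factorisation because its multiplication map is the one of \<open>C = A \<cdot> B\<close> preceded by the action of \<open>G\<close>
  on \<open>A \<otimes> B\<close>.

  Tensor products and induced modules enter only through their universal properties: linear maps out
  of them are determined by their values on pure tensors, and any bilinear (and balanced) assignment
  of such values extends.
\<close>

section \<open>Linear and bilinear maps\<close>

lemma linear_mapsI:
  assumes "\<And>x. x \<in> carrier X \<Longrightarrow> f x \<in> carrier Y"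
    and "\<And>x y. x \<in> carrier X \<Longrightarrow> y \<in> carrier X \<Longrightarrow> f (x \<oplus>\<^bsub>X\<^esub> y) = f x \<oplus>\<^bsub>Y\<^esub> f y"
    and "\<And>c x. c \<in> carrier K \<Longrightarrow> x \<in> carrier X \<Longrightarrow> f (c \<odot>\<^bsub>X\<^esub> x) = c \<odot>\<^bsub>Y\<^esub> f x"
  shows "f \<in> linear_maps K X Y"
  using assms unfolding linear_maps_def by auto

lemma linear_maps_closed: "f \<in> linear_maps K X Y \<Longrightarrow> x \<in> carrier X \<Longrightarrow> f x \<in> carrier Y"
  and linear_maps_add: "f \<in> linear_maps K X Y \<Longrightarrow> x \<in> carrier X \<Longrightarrow> y \<in> carrier X \<Longrightarrow>
    f (x \<oplus>\<^bsub>X\<^esub> y) = f x \<oplus>\<^bsub>Y\<^esub> f y"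
  and linear_maps_smult: "f \<in> linear_maps K X Y \<Longrightarrow> c \<in> carrier K \<Longrightarrow> x \<in> carrier X \<Longrightarrow>
    f (c \<odot>\<^bsub>X\<^esub> x) = c \<odot>\<^bsub>Y\<^esub> f x"
  unfolding linear_maps_def by auto

lemmas linear_maps_rules = linear_maps_closed linear_maps_add linear_maps_smult

lemma linear_maps_zero:
  assumes "f \<in> linear_maps K X Y" "module K X" "module K Y"
  shows "f \<zero>\<^bsub>X\<^esub> = \<zero>\<^bsub>Y\<^esub>"
proof -
  interpret X: module K X by fact
  interpret Y: module K Y by fact
  have "f (\<zero>\<^bsub>K\<^esub> \<odot>\<^bsub>X\<^esub> \<zero>\<^bsub>X\<^esub>) = \<zero>\<^bsub>K\<^esub> \<odot>\<^bsub>Y\<^esub> f \<zero>\<^bsub>X\<^esub>"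
    by (intro linear_maps_smult[OF assms(1)]) auto
  moreover have "f \<zero>\<^bsub>X\<^esub> \<in> carrier Y"
    by (intro linear_maps_closed[OF assms(1)]) auto
  ultimately show ?thesis by simp
qed

lemma module_minus_eq:
  assumes "module K X" "x \<in> carrier X"
  shows "\<ominus>\<^bsub>X\<^esub> x = (\<ominus>\<^bsub>K\<^esub> \<one>\<^bsub>K\<^esub>) \<odot>\<^bsub>X\<^esub> x"
proof -
  interpret X: module K X by fact
  show ?thesis using assms(2) by (simp add: X.smult_l_minus)
qed

lemma linear_maps_minus:
  assumes "f \<in> linear_maps K X Y" "module K X" "module K Y" "x \<in> carrier X" "y \<in> carrier X"
  shows "f (x \<ominus>\<^bsub>X\<^esub> y) = f x \<ominus>\<^bsub>Y\<^esub> f y"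
proof -
  interpret X: module K X by fact
  interpret Y: module K Y by fact
  show ?thesis
    using assms(4,5)
    by (simp add: a_minus_def module_minus_eq[OF assms(2)] module_minus_eq[OF assms(3)]
        linear_maps_rules[OF assms(1)])
qed

lemma module_eqI_minus:
  assumes "module K X" "x \<in> carrier X" "y \<in> carrier X" "x \<ominus>\<^bsub>X\<^esub> y = \<zero>\<^bsub>X\<^esub>"
  shows "x = y"
proof -
  interpret X: module K X by fact
  have "x = (x \<ominus>\<^bsub>X\<^esub> y) \<oplus>\<^bsub>X\<^esub> y"
    using assms(2,3) by (simp add: a_minus_def X.M.a_assoc X.M.l_neg)
  then show ?thesis using assms(3,4) by simp
qed

lemma linear_maps_comp:
  assumes "f \<in> linear_maps K X Y" "g \<in> linear_maps K Y Z"
  shows "(\<lambda>x. g (f x)) \<in> linear_maps K X Z"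
  by (rule linear_mapsI) (simp_all add: linear_maps_rules[OF assms(1)] linear_maps_rules[OF assms(2)])

lemma linear_maps_id: "(\<lambda>x. x) \<in> linear_maps K X X"
  by (rule linear_mapsI) simp_all

lemma linear_maps_pointwise_add:
  assumes "f \<in> linear_maps K X Y" "g \<in> linear_maps K X Y" "module K Y"
  shows "(\<lambda>x. f x \<oplus>\<^bsub>Y\<^esub> g x) \<in> linear_maps K X Y"
proof -
  interpret Y: module K Y by fact
  show ?thesis
    by (rule linear_mapsI)
      (simp_all add: linear_maps_rules[OF assms(1)] linear_maps_rules[OF assms(2)]
        Y.M.a_ac Y.smult_r_distr)
qed

lemma linear_maps_pointwise_smult:
  assumes "f \<in> linear_maps K X Y" "c \<in> carrier K" "module K Y"
  shows "(\<lambda>x. c \<odot>\<^bsub>Y\<^esub> f x) \<in> linear_maps K X Y"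
proof -
  interpret Y: module K Y by fact
  show ?thesis
    using assms(2)
    by (intro linear_mapsI)
      (simp_all add: linear_maps_rules[OF assms(1)] Y.smult_r_distr Y.smult_assoc1[symmetric] Y.R.m_comm)
qed

text \<open>
  The identifications that transport module structures are inverted by \<open>inv_into\<close>, whence this form
  of the fact that the inverse of a linear bijection is linear.
\<close>

lemma linear_maps_inv_into:
  assumes "f \<in> linear_maps K X Y" "bij_betw f (carrier X) (carrier Y)" "module K X"
  shows "inv_into (carrier X) f \<in> linear_maps K Y X"
proof -
  interpret X: module K X by fact
  let ?g = "inv_into (carrier X) f"
  have g: "?g y \<in> carrier X" "f (?g y) = y" if "y \<in> carrier Y" for y
    using assms(2) that by (simp_all add: bij_betw_def inv_into_into f_inv_into_f)
  have gf: "?g (f x) = x" if "x \<in> carrier X" for x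
    using assms(2) that by (simp add: bij_betw_inv_into_left)
  show ?thesis
  proof (rule linear_mapsI)
    fix x y assume xy: "x \<in> carrier Y" "y \<in> carrier Y"
    have "x \<oplus>\<^bsub>Y\<^esub> y = f (?g x \<oplus>\<^bsub>X\<^esub> ?g y)"
      by (simp add: linear_maps_add[OF assms(1)] g xy)
    then show "?g (x \<oplus>\<^bsub>Y\<^esub> y) = ?g x \<oplus>\<^bsub>X\<^esub> ?g y" by (simp add: gf g xy)
  next
    fix c y assume cy: "c \<in> carrier K" "y \<in> carrier Y"
    have "c \<odot>\<^bsub>Y\<^esub> y = f (c \<odot>\<^bsub>X\<^esub> ?g y)"
      by (simp add: linear_maps_smult[OF assms(1)] g cy)
    then show "?g (c \<odot>\<^bsub>Y\<^esub> y) = c \<odot>\<^bsub>X\<^esub> ?g y" by (simp add: gf g cy)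
  qed (rule g)
qed

lemma bilinear_mapI:
  assumes "\<And>x. x \<in> carrier X \<Longrightarrow> f x \<in> linear_maps K Y W"
    and "\<And>y. y \<in> carrier Y \<Longrightarrow> (\<lambda>x. f x y) \<in> linear_maps K X W"
  shows "bilinear_map K X Y W f"
  using assms unfolding bilinear_map_def by auto

lemma bilinear_map_linear_right: "bilinear_map K X Y W f \<Longrightarrow> x \<in> carrier X \<Longrightarrow> f x \<in> linear_maps K Y W"
  and bilinear_map_linear_left:
    "bilinear_map K X Y W f \<Longrightarrow> y \<in> carrier Y \<Longrightarrow> (\<lambda>x. f x y) \<in> linear_maps K X W"
  unfolding bilinear_map_def by auto

lemma bilinear_map_closed: "bilinear_map K X Y W f \<Longrightarrow> x \<in> carrier X \<Longrightarrow> y \<in> carrier Y \<Longrightarrow>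
    f x y \<in> carrier W"
  and bilinear_map_add_left: "bilinear_map K X Y W f \<Longrightarrow> x \<in> carrier X \<Longrightarrow> x' \<in> carrier X \<Longrightarrow>
    y \<in> carrier Y \<Longrightarrow> f (x \<oplus>\<^bsub>X\<^esub> x') y = f x y \<oplus>\<^bsub>W\<^esub> f x' y"
  and bilinear_map_add_right: "bilinear_map K X Y W f \<Longrightarrow> x \<in> carrier X \<Longrightarrow> y \<in> carrier Y \<Longrightarrow>
    y' \<in> carrier Y \<Longrightarrow> f x (y \<oplus>\<^bsub>Y\<^esub> y') = f x y \<oplus>\<^bsub>W\<^esub> f x y'"
  and bilinear_map_smult_left: "bilinear_map K X Y W f \<Longrightarrow> c \<in> carrier K \<Longrightarrow> x \<in> carrier X \<Longrightarrow>
    y \<in> carrier Y \<Longrightarrow> f (c \<odot>\<^bsub>X\<^esub> x) y = c \<odot>\<^bsub>W\<^esub> f x y"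
  and bilinear_map_smult_right: "bilinear_map K X Y W f \<Longrightarrow> c \<in> carrier K \<Longrightarrow> x \<in> carrier X \<Longrightarrow>
    y \<in> carrier Y \<Longrightarrow> f x (c \<odot>\<^bsub>Y\<^esub> y) = c \<odot>\<^bsub>W\<^esub> f x y"
  unfolding bilinear_map_def linear_maps_def by auto

lemmas bilinear_map_rules = bilinear_map_closed bilinear_map_add_left bilinear_map_add_right
  bilinear_map_smult_left bilinear_map_smult_right

lemma bilinear_map_comp:
  assumes "bilinear_map K X Y W f" "g \<in> linear_maps K W Z"
  shows "bilinear_map K X Y Z (\<lambda>x y. g (f x y))"
  by (intro bilinear_mapI linear_mapsI)
    (simp_all add: bilinear_map_rules[OF assms(1)] linear_maps_rules[OF assms(2)])

lemma bilinear_map_precomp: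
  assumes "bilinear_map K X Y W f" "p \<in> linear_maps K X' X" "q \<in> linear_maps K Y' Y"
  shows "bilinear_map K X' Y' W (\<lambda>x y. f (p x) (q y))"
  by (intro bilinear_mapI linear_mapsI)
    (simp_all add: bilinear_map_rules[OF assms(1)] linear_maps_rules[OF assms(2)]
      linear_maps_rules[OF assms(3)])

lemma bilinear_map_cong:
  assumes "bilinear_map K X Y W f" "module K X" "module K Y"
    and "\<And>x y. x \<in> carrier X \<Longrightarrow> y \<in> carrier Y \<Longrightarrow> g x y = f x y"
  shows "bilinear_map K X Y W g"
proof -
  interpret X: module K X by fact
  interpret Y: module K Y by fact
  show ?thesis
    by (intro bilinear_mapI linear_mapsI) (simp_all add: bilinear_map_rules[OF assms(1)] assms(4))
qed

text \<open>
  The module axioms are equations, so they pass to any surjective image that respects the operations.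
  With the identity map in place of \<open>q\<close> this also shows that they depend on the linear fields only.
\<close>

lemma module_surj_image:
  assumes "module K X" and carrier: "carrier Q = q ` carrier X"
    and add: "\<And>x y. x \<in> carrier X \<Longrightarrow> y \<in> carrier X \<Longrightarrow> q x \<oplus>\<^bsub>Q\<^esub> q y = q (x \<oplus>\<^bsub>X\<^esub> y)"
    and smult: "\<And>c x. c \<in> carrier K \<Longrightarrow> x \<in> carrier X \<Longrightarrow> c \<odot>\<^bsub>Q\<^esub> q x = q (c \<odot>\<^bsub>X\<^esub> x)"
    and zero: "\<zero>\<^bsub>Q\<^esub> = q \<zero>\<^bsub>X\<^esub>"
  shows "module K Q"
proof -
  interpret X: module K X by fact
  have "abelian_group Q"
  proof (rule abelian_groupI)
    fix x assume "x \<in> carrier Q"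
    then obtain u where u: "u \<in> carrier X" "x = q u" using carrier by auto
    have "q (\<ominus>\<^bsub>X\<^esub> u) \<in> carrier Q" using u carrier by auto
    moreover have "q (\<ominus>\<^bsub>X\<^esub> u) \<oplus>\<^bsub>Q\<^esub> x = \<zero>\<^bsub>Q\<^esub>" using u by (simp add: add zero X.M.l_neg)
    ultimately show "\<exists>y\<in>carrier Q. y \<oplus>\<^bsub>Q\<^esub> x = \<zero>\<^bsub>Q\<^esub>" by auto
  qed (auto simp: carrier add zero X.M.a_ac)
  then show ?thesis
    by (intro moduleI) (auto simp: carrier add smult X.smult_l_distr X.smult_r_distr X.smult_assoc1 X.R.is_cring)
qed


section \<open>Spans and quotients\<close>

lemma submodule_span:
  assumes "module K X" "G \<subseteq> carrier X"
  shows "submodule (submodule_span K X G) K X"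
proof -
  interpret X: module K X by fact
  let ?S = "{N. submodule N K X \<and> G \<subseteq> N}"
  have car: "carrier X \<in> ?S" using X.carrier_is_submodule assms(2) by auto
  have eq: "submodule_span K X G = \<Inter>?S" by (simp add: submodule_span_def hull_def)
  show ?thesis
    unfolding eq
  proof (rule X.submoduleI)
    show "\<Inter>?S \<subseteq> carrier X" using car by auto
    show "\<zero>\<^bsub>X\<^esub> \<in> \<Inter>?S"
      by (auto dest!: submodule.axioms(1) subgroup.one_closed)
  qed (auto intro: X.submoduleE(3) X.submoduleE(5) X.submoduleE(4))
qed

lemma submodule_span_inc: "x \<in> G \<Longrightarrow> x \<in> submodule_span K X G"
  unfolding submodule_span_def by (rule hull_inc)

text \<open>
  The kernel of a linear map is a submodule, so it contains the span of every set that it contains.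
\<close>

lemma linear_maps_zero_on_span:
  assumes "module K X" "module K Y" "f \<in> linear_maps K X Y" "G \<subseteq> carrier X"
    and "\<And>x. x \<in> G \<Longrightarrow> f x = \<zero>\<^bsub>Y\<^esub>" and "x \<in> submodule_span K X G"
  shows "f x = \<zero>\<^bsub>Y\<^esub>"
proof -
  interpret X: module K X by fact
  interpret Y: module K Y by fact
  let ?N = "{x \<in> carrier X. f x = \<zero>\<^bsub>Y\<^esub>}"
  have "submodule ?N K X"
    by (rule X.submoduleI)
      (auto simp: module_minus_eq[OF assms(1)] linear_maps_rules[OF assms(3)]
        linear_maps_zero[OF assms(3,1,2)])
  moreover have "G \<subseteq> ?N" using assms(4,5) by auto
  ultimately have "submodule_span K X G \<subseteq> ?N"
    unfolding submodule_span_def by (intro hull_minimal)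
  with assms(6) show ?thesis by auto
qed

context
  fixes K :: "'k ring" and X :: "('k, 'a) module" and N :: "'a set"
  assumes X: "module K X" and N: "submodule N K X"
begin

interpretation X: module K X by (rule X)

interpretation N: abelian_subgroup N X
  by (intro abelian_subgroupI3 additive_subgroup.intro submodule.axioms(1)[OF N] X.M.abelian_group_axioms)

lemma coset_eq_iff:
  assumes "x \<in> carrier X" "y \<in> carrier X"
  shows "N +>\<^bsub>X\<^esub> x = N +>\<^bsub>X\<^esub> y \<longleftrightarrow> x \<ominus>\<^bsub>X\<^esub> y \<in> N"
proof
  assume "N +>\<^bsub>X\<^esub> x = N +>\<^bsub>X\<^esub> y"
  then have "x \<in> N +>\<^bsub>X\<^esub> y" using N.a_rcos_self[OF assms(1)] by simp
  then show "x \<ominus>\<^bsub>X\<^esub> y \<in> N" using N.a_rcos_module[OF assms(2,1)] by (simp add: a_minus_def)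
next
  assume "x \<ominus>\<^bsub>X\<^esub> y \<in> N"
  then have "x \<in> N +>\<^bsub>X\<^esub> y" using N.a_rcos_module[OF assms(2,1)] by (simp add: a_minus_def)
  then show "N +>\<^bsub>X\<^esub> x = N +>\<^bsub>X\<^esub> y"
    using N.a_repr_independence'[of x y] assms(2) by simp
qed

lemma quotient_module_carrier: "carrier (quotient_module K X N) = (\<lambda>x. N +>\<^bsub>X\<^esub> x) ` carrier X"
  by (auto simp: quotient_module_def A_RCOSETS_def')

lemma quotient_module_add:
  "x \<in> carrier X \<Longrightarrow> y \<in> carrier X \<Longrightarrow>
    (N +>\<^bsub>X\<^esub> x) \<oplus>\<^bsub>quotient_module K X N\<^esub> (N +>\<^bsub>X\<^esub> y) = N +>\<^bsub>X\<^esub> (x \<oplus>\<^bsub>X\<^esub> y)"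
  by (simp add: quotient_module_def N.a_rcos_sum)

lemma quotient_module_smult:
  assumes c: "c \<in> carrier K" and x: "x \<in> carrier X"
  shows "c \<odot>\<^bsub>quotient_module K X N\<^esub> (N +>\<^bsub>X\<^esub> x) = N +>\<^bsub>X\<^esub> (c \<odot>\<^bsub>X\<^esub> x)"
proof -
  \<comment> \<open>All cosets in the union that defines the scalar multiple coincide.\<close>
  have "N +>\<^bsub>X\<^esub> (c \<odot>\<^bsub>X\<^esub> y) = N +>\<^bsub>X\<^esub> (c \<odot>\<^bsub>X\<^esub> x)" if y: "y \<in> N +>\<^bsub>X\<^esub> x" for y
  proof -
    have yc: "y \<in> carrier X" using y N.a_elemrcos_carrier[OF x] by blast
    have "c \<odot>\<^bsub>X\<^esub> (y \<ominus>\<^bsub>X\<^esub> x) \<in> N"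
      using N.a_rcos_module[OF x yc] y c submodule.smult_closed[OF N] by (simp add: a_minus_def)
    then have "c \<odot>\<^bsub>X\<^esub> y \<ominus>\<^bsub>X\<^esub> c \<odot>\<^bsub>X\<^esub> x \<in> N"
      using c x yc by (simp add: a_minus_def X.smult_r_distr X.smult_r_minus)
    then show ?thesis using coset_eq_iff c x yc by simp
  qed
  then have "(\<Union>y\<in>N +>\<^bsub>X\<^esub> x. N +>\<^bsub>X\<^esub> (c \<odot>\<^bsub>X\<^esub> y)) = (\<Union>y\<in>N +>\<^bsub>X\<^esub> x. N +>\<^bsub>X\<^esub> (c \<odot>\<^bsub>X\<^esub> x))"
    by (rule SUP_cong[OF refl])
  moreover have "N +>\<^bsub>X\<^esub> x \<noteq> {}"
    using N.a_rcos_self[OF x] by blast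
  ultimately show ?thesis
    by (simp add: quotient_module_def)
qed

lemma quotient_module_zero: "\<zero>\<^bsub>quotient_module K X N\<^esub> = N +>\<^bsub>X\<^esub> \<zero>\<^bsub>X\<^esub>"
  using X.a_coset_add_zero[OF N.a_subset] by (simp add: quotient_module_def)

lemma quotient_module_is_module: "module K (quotient_module K X N)"
  by (rule module_surj_image[where q = "\<lambda>x. N +>\<^bsub>X\<^esub> x", OF X quotient_module_carrier])
    (simp_all add: quotient_module_add quotient_module_smult quotient_module_zero)

lemma quotient_map_linear: "(\<lambda>x. N +>\<^bsub>X\<^esub> x) \<in> linear_maps K X (quotient_module K X N)"
  by (rule linear_mapsI) (auto simp: quotient_module_carrier quotient_module_add quotient_module_smult)

text \<open>
  The value at a coset may be computed at any representative, since \<open>f\<close> vanishes on differences of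
  representatives.
\<close>

lemma quotient_lift_ex:
  assumes f: "f \<in> linear_maps K X W" and W: "module K W" and ker: "\<And>n. n \<in> N \<Longrightarrow> f n = \<zero>\<^bsub>W\<^esub>"
  shows "\<exists>g\<in>linear_maps K (quotient_module K X N) W. \<forall>x\<in>carrier X. g (N +>\<^bsub>X\<^esub> x) = f x"
proof -
  interpret W: module K W by (rule W)
  let ?q = "\<lambda>x. N +>\<^bsub>X\<^esub> x"
  define g where "g P = f (SOME x. x \<in> carrier X \<and> ?q x = P)" for P
  have g: "g (?q x) = f x" if x: "x \<in> carrier X" for x
  proof -
    let ?y = "SOME y. y \<in> carrier X \<and> ?q y = ?q x"
    have y: "?y \<in> carrier X \<and> ?q ?y = ?q x" by (rule someI[where x = x]) (simp add: x)
    then have "?y \<ominus>\<^bsub>X\<^esub> x \<in> N" using coset_eq_iff x by blast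
    then have "f ?y \<ominus>\<^bsub>W\<^esub> f x = \<zero>\<^bsub>W\<^esub>" using ker linear_maps_minus[OF f X W] x y by metis
    then show ?thesis
      unfolding g_def using module_eqI_minus[OF W] linear_maps_closed[OF f] x y by blast
  qed
  have "g \<in> linear_maps K (quotient_module K X N) W"
    by (rule linear_mapsI)
      (auto simp: quotient_module_carrier quotient_module_add quotient_module_smult g linear_maps_rules[OF f])
  with g show ?thesis by blast
qed

end


section \<open>Free modules\<close>

context
  fixes K :: "'k ring" and S :: "'s set"
  assumes K: "cring K"
begin

interpretation K: cring K by (rule K)

lemma free_module_is_module: "module K (free_module K S)"
proof -
  have fin_add: "finite {s. f s \<oplus>\<^bsub>K\<^esub> g s \<noteq> \<zero>\<^bsub>K\<^esub>}"
    if "finite {s. f s \<noteq> \<zero>\<^bsub>K\<^esub>}" "finite {s. g s \<noteq> \<zero>\<^bsub>K\<^esub>}" for f g :: "'s \<Rightarrow> 'k"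
    by (rule finite_subset[OF _ finite_UnI[OF that]]) auto
  have fin_smult: "finite {s. c \<otimes>\<^bsub>K\<^esub> f s \<noteq> \<zero>\<^bsub>K\<^esub>}"
    if "finite {s. f s \<noteq> \<zero>\<^bsub>K\<^esub>}" "c \<in> carrier K" for f :: "'s \<Rightarrow> 'k" and c
    by (rule finite_subset[OF _ that(1)]) (use that in auto)
  have val: "f s \<in> carrier K" if "f \<in> carrier (free_module K S)" for f s
    using that K.zero_closed by (cases "s \<in> S") (auto simp: free_module_def Pi_iff simp del: K.zero_closed)
  have "abelian_group (free_module K S)"
  proof (rule abelian_groupI)
    fix f assume f: "f \<in> carrier (free_module K S)"
    have "(\<lambda>s. (\<ominus>\<^bsub>K\<^esub> \<one>\<^bsub>K\<^esub>) \<otimes>\<^bsub>K\<^esub> f s) \<in> carrier (free_module K S)"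
      using f fin_smult[of f "\<ominus>\<^bsub>K\<^esub> \<one>\<^bsub>K\<^esub>"] by (auto simp: free_module_def)
    moreover have "(\<lambda>s. (\<ominus>\<^bsub>K\<^esub> \<one>\<^bsub>K\<^esub>) \<otimes>\<^bsub>K\<^esub> f s) \<oplus>\<^bsub>free_module K S\<^esub> f = \<zero>\<^bsub>free_module K S\<^esub>"
      using val[OF f] by (simp add: free_module_def K.l_minus K.l_neg)
    ultimately show "\<exists>g\<in>carrier (free_module K S). g \<oplus>\<^bsub>free_module K S\<^esub> f = \<zero>\<^bsub>free_module K S\<^esub>"
      by blast
  next
    fix f g h assume "f \<in> carrier (free_module K S)" "g \<in> carrier (free_module K S)"
      "h \<in> carrier (free_module K S)"
    note v = this[THEN val]
    show "f \<oplus>\<^bsub>free_module K S\<^esub> g \<oplus>\<^bsub>free_module K S\<^esub> h =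
        f \<oplus>\<^bsub>free_module K S\<^esub> (g \<oplus>\<^bsub>free_module K S\<^esub> h)"
      using v by (simp add: free_module_def K.a_assoc)
  next
    fix f g assume "f \<in> carrier (free_module K S)" "g \<in> carrier (free_module K S)"
    note v = this[THEN val]
    show "f \<oplus>\<^bsub>free_module K S\<^esub> g = g \<oplus>\<^bsub>free_module K S\<^esub> f"
      using v by (simp add: free_module_def K.a_comm)
  next
    fix f assume "f \<in> carrier (free_module K S)"
    note v = this[THEN val]
    show "\<zero>\<^bsub>free_module K S\<^esub> \<oplus>\<^bsub>free_module K S\<^esub> f = f"
      using v by (simp add: free_module_def)
  qed (auto simp: free_module_def fin_add)
  then show ?thesis
  proof (intro moduleI)
    fix c f assume "c \<in> carrier K" "f \<in> carrier (free_module K S)"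
    then show "c \<odot>\<^bsub>free_module K S\<^esub> f \<in> carrier (free_module K S)"
      by (auto simp: free_module_def fin_smult)
  next
    fix c d f assume "c \<in> carrier K" "d \<in> carrier K" and "f \<in> carrier (free_module K S)"
    note v = this(1,2) this(3)[THEN val]
    show "(c \<oplus>\<^bsub>K\<^esub> d) \<odot>\<^bsub>free_module K S\<^esub> f =
        c \<odot>\<^bsub>free_module K S\<^esub> f \<oplus>\<^bsub>free_module K S\<^esub> d \<odot>\<^bsub>free_module K S\<^esub> f"
      using v by (simp add: free_module_def K.l_distr)
    show "(c \<otimes>\<^bsub>K\<^esub> d) \<odot>\<^bsub>free_module K S\<^esub> f = c \<odot>\<^bsub>free_module K S\<^esub> (d \<odot>\<^bsub>free_module K S\<^esub> f)"
      using v by (simp add: free_module_def K.m_assoc)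
  next
    fix c f g assume "c \<in> carrier K" and "f \<in> carrier (free_module K S)" "g \<in> carrier (free_module K S)"
    note v = this(1) this(2,3)[THEN val]
    show "c \<odot>\<^bsub>free_module K S\<^esub> (f \<oplus>\<^bsub>free_module K S\<^esub> g) =
        c \<odot>\<^bsub>free_module K S\<^esub> f \<oplus>\<^bsub>free_module K S\<^esub> c \<odot>\<^bsub>free_module K S\<^esub> g"
      using v by (simp add: free_module_def K.r_distr)
  next
    fix f assume "f \<in> carrier (free_module K S)"
    note v = this[THEN val]
    show "\<one>\<^bsub>K\<^esub> \<odot>\<^bsub>free_module K S\<^esub> f = f" using v by (simp add: free_module_def)
  qed (rule K.is_cring)
qed

lemma free_basis_closed: "s \<in> S \<Longrightarrow> free_basis K s \<in> carrier (free_module K S)"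
  by (auto simp: free_module_def free_basis_def intro: finite_subset[of _ "{s}"])

lemma free_module_lift_ex:
  assumes W: "module K W" and F: "\<And>s. s \<in> S \<Longrightarrow> F s \<in> carrier W"
  shows "\<exists>g\<in>linear_maps K (free_module K S) W. \<forall>s\<in>S. g (free_basis K s) = F s"
proof -
  interpret W: module K W by (rule W)
  define supp where "supp f = {s. f s \<noteq> \<zero>\<^bsub>K\<^esub>}" for f :: "'s \<Rightarrow> 'k"
  define g where "g f = (\<Oplus>\<^bsub>W\<^esub>s\<in>supp f. f s \<odot>\<^bsub>W\<^esub> F s)" for f
  have supp: "finite (supp f)" "supp f \<subseteq> S" "\<And>s. s \<in> S \<Longrightarrow> f s \<in> carrier K"
    if "f \<in> carrier (free_module K S)" for f
    using that by (auto simp: free_module_def supp_def)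
  \<comment> \<open>Sums over different supports can be added only after they are extended to a common finite set.\<close>
  have g_eq: "g f = (\<Oplus>\<^bsub>W\<^esub>s\<in>T. f s \<odot>\<^bsub>W\<^esub> F s)"
    if f: "f \<in> carrier (free_module K S)" and T: "finite T" "supp f \<subseteq> T" "T \<subseteq> S" for f T
    unfolding g_def
    by (rule W.add.finprod_mono_neutral_cong_left)
      (use T supp[OF f] F in \<open>auto simp: supp_def subset_iff\<close>)
  interpret M: module K "free_module K S" by (rule free_module_is_module)
  have "g \<in> linear_maps K (free_module K S) W"
  proof (rule linear_mapsI)
    fix f assume "f \<in> carrier (free_module K S)"
    then show "g f \<in> carrier W" unfolding g_def
      by (intro W.M.finsum_closed) (use supp[of f] F in \<open>auto simp: subset_iff\<close>)
  next
    fix f h assume f: "f \<in> carrier (free_module K S)" and h: "h \<in> carrier (free_module K S)"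
    let ?T = "supp f \<union> supp h"
    have T: "finite ?T" "?T \<subseteq> S" using supp[OF f] supp[OF h] by auto
    have fh: "supp (f \<oplus>\<^bsub>free_module K S\<^esub> h) \<subseteq> ?T"
      by (auto simp: supp_def free_module_def)
    have "g (f \<oplus>\<^bsub>free_module K S\<^esub> h) = (\<Oplus>\<^bsub>W\<^esub>s\<in>?T. (f \<oplus>\<^bsub>free_module K S\<^esub> h) s \<odot>\<^bsub>W\<^esub> F s)"
      using f h T fh by (intro g_eq) auto
    also have "\<dots> = (\<Oplus>\<^bsub>W\<^esub>s\<in>?T. f s \<odot>\<^bsub>W\<^esub> F s \<oplus>\<^bsub>W\<^esub> h s \<odot>\<^bsub>W\<^esub> F s)"
      by (rule W.M.finsum_cong')
        (use T supp[OF f] supp[OF h] F in \<open>auto simp: free_module_def subset_iff W.smult_l_distr\<close>)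
    also have "\<dots> = (\<Oplus>\<^bsub>W\<^esub>s\<in>?T. f s \<odot>\<^bsub>W\<^esub> F s) \<oplus>\<^bsub>W\<^esub> (\<Oplus>\<^bsub>W\<^esub>s\<in>?T. h s \<odot>\<^bsub>W\<^esub> F s)"
      by (rule W.M.finsum_addf) (use T supp[OF f] supp[OF h] F in \<open>auto simp: subset_iff\<close>)
    also have "\<dots> = g f \<oplus>\<^bsub>W\<^esub> g h" using g_eq[OF f T(1) _ T(2)] g_eq[OF h T(1) _ T(2)] by simp
    finally show "g (f \<oplus>\<^bsub>free_module K S\<^esub> h) = g f \<oplus>\<^bsub>W\<^esub> g h" .
  next
    fix c f assume c: "c \<in> carrier K" and f: "f \<in> carrier (free_module K S)"
    have cf: "supp (c \<odot>\<^bsub>free_module K S\<^esub> f) \<subseteq> supp f"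
      using c by (auto simp: supp_def free_module_def)
    have "g (c \<odot>\<^bsub>free_module K S\<^esub> f) = (\<Oplus>\<^bsub>W\<^esub>s\<in>supp f. (c \<odot>\<^bsub>free_module K S\<^esub> f) s \<odot>\<^bsub>W\<^esub> F s)"
      using c f supp[OF f] cf by (intro g_eq) auto
    also have "\<dots> = (\<Oplus>\<^bsub>W\<^esub>s\<in>supp f. c \<odot>\<^bsub>W\<^esub> (f s \<odot>\<^bsub>W\<^esub> F s))"
      by (rule W.M.finsum_cong')
        (use c supp[OF f] F in \<open>auto simp: free_module_def subset_iff W.smult_assoc1\<close>)
    also have "\<dots> = c \<odot>\<^bsub>W\<^esub> g f" unfolding g_def
      by (rule W.finsum_smult_ldistr[symmetric]) (use c supp[OF f] F in \<open>auto simp: subset_iff\<close>)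
    finally show "g (c \<odot>\<^bsub>free_module K S\<^esub> f) = c \<odot>\<^bsub>W\<^esub> g f" .
  qed
  moreover have "g (free_basis K s) = F s" if s: "s \<in> S" for s
  proof -
    have "g (free_basis K s) = (\<Oplus>\<^bsub>W\<^esub>t\<in>{s}. free_basis K s t \<odot>\<^bsub>W\<^esub> F t)"
      by (rule g_eq[OF free_basis_closed[OF s]]) (use s in \<open>auto simp: supp_def free_basis_def split: if_splits\<close>)
    then show ?thesis using s F by (simp add: free_basis_def)
  qed
  ultimately show ?thesis by blast
qed

text \<open>
  Induction on a finite set that contains the support: split off one basis vector at a time.
\<close>

lemma free_module_eqI:
  assumes f: "f \<in> linear_maps K (free_module K S) W" and g: "g \<in> linear_maps K (free_module K S) W"
    and W: "module K W"
    and eq: "\<And>s. s \<in> S \<Longrightarrow> f (free_basis K s) = g (free_basis K s)"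
    and u: "u \<in> carrier (free_module K S)"
  shows "f u = g u"
proof -
  interpret M: module K "free_module K S" by (rule free_module_is_module)
  have "f u = g u" if "finite T" "{s. u s \<noteq> \<zero>\<^bsub>K\<^esub>} \<subseteq> T" "u \<in> carrier (free_module K S)" for T u
    using that
  proof (induction T arbitrary: u)
    case empty
    then have "u = \<zero>\<^bsub>free_module K S\<^esub>" by (auto simp: free_module_def)
    then show ?case using linear_maps_zero f g W M.module_axioms by metis
  next
    case (insert s T)
    show ?case
    proof (cases "s \<in> S")
      case False
      then have "u s = \<zero>\<^bsub>K\<^esub>" using insert.prems by (auto simp: free_module_def)
      then show ?thesis using insert by blast
    next
      case s: True
      let ?v = "u(s := \<zero>\<^bsub>K\<^esub>)"
      have us: "u s \<in> carrier K" using s insert.prems by (auto simp: free_module_def)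
      have v: "?v \<in> carrier (free_module K S)"
        using insert.prems by (auto simp: free_module_def intro: rev_finite_subset)
      have "u t \<in> carrier K" for t
        using insert.prems K.zero_closed by (cases "t \<in> S") (auto simp: free_module_def simp del: K.zero_closed)
      then have u: "u = u s \<odot>\<^bsub>free_module K S\<^esub> free_basis K s \<oplus>\<^bsub>free_module K S\<^esub> ?v"
        by (auto simp: free_module_def free_basis_def)
      have fgv: "f ?v = g ?v" by (rule insert.IH[OF _ v]) (use insert.prems in auto)
      have bs: "free_basis K s \<in> carrier (free_module K S)" using s by (rule free_basis_closed)
      have "f (u s \<odot>\<^bsub>free_module K S\<^esub> free_basis K s \<oplus>\<^bsub>free_module K S\<^esub> ?v) =
          g (u s \<odot>\<^bsub>free_module K S\<^esub> free_basis K s \<oplus>\<^bsub>free_module K S\<^esub> ?v)"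
        using us v bs eq[OF s] fgv
        by (simp add: linear_maps_rules[OF f] linear_maps_rules[OF g])
      with u show ?thesis by simp
    qed
  qed
  then show ?thesis using u by (auto simp: free_module_def)
qed

end


section \<open>Tensor products\<close>

context
  fixes K :: "'k ring" and X :: "('k, 'a) module" and Y :: "('k, 'b) module"
  assumes X: "module K X" and Y: "module K Y"
begin

interpretation X: module K X by (rule X)
interpretation Y: module K Y by (rule Y)

private abbreviation (input) "M \<equiv> free_module K (carrier X \<times> carrier Y)"

interpretation M: module K M by (rule free_module_is_module[OF X.R.is_cring])

private abbreviation (input) "e \<equiv> \<lambda>x y. free_basis K (x, y)"

text \<open>The generators of the submodule by which the free module is divided.\<close>

private definition "rels = 
      {e (x \<oplus>\<^bsub>X\<^esub> x') y \<ominus>\<^bsub>M\<^esub> (e x y \<oplus>\<^bsub>M\<^esub> e x' y) | x x' y.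
          x \<in> carrier X \<and> x' \<in> carrier X \<and> y \<in> carrier Y} \<union>
       {e x (y \<oplus>\<^bsub>Y\<^esub> y') \<ominus>\<^bsub>M\<^esub> (e x y \<oplus>\<^bsub>M\<^esub> e x y') | x y y'.
          x \<in> carrier X \<and> y \<in> carrier Y \<and> y' \<in> carrier Y} \<union>
       {e (c \<odot>\<^bsub>X\<^esub> x) y \<ominus>\<^bsub>M\<^esub> c \<odot>\<^bsub>M\<^esub> e x y | c x y.
          c \<in> carrier K \<and> x \<in> carrier X \<and> y \<in> carrier Y} \<union>
       {e x (c \<odot>\<^bsub>Y\<^esub> y) \<ominus>\<^bsub>M\<^esub> c \<odot>\<^bsub>M\<^esub> e x y | c x y.
          c \<in> carrier K \<and> x \<in> carrier X \<and> y \<in> carrier Y}"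

private lemma e_closed: "x \<in> carrier X \<Longrightarrow> y \<in> carrier Y \<Longrightarrow> e x y \<in> carrier M"
  by (rule free_basis_closed[OF X.R.is_cring]) simp

private lemma rels_closed: "rels \<subseteq> carrier M"
  unfolding rels_def by (auto simp: e_closed)

private lemma relsI:
  "x \<in> carrier X \<Longrightarrow> x' \<in> carrier X \<Longrightarrow> y \<in> carrier Y \<Longrightarrow>
    e (x \<oplus>\<^bsub>X\<^esub> x') y \<ominus>\<^bsub>M\<^esub> (e x y \<oplus>\<^bsub>M\<^esub> e x' y) \<in> rels"
  "x \<in> carrier X \<Longrightarrow> y \<in> carrier Y \<Longrightarrow> y' \<in> carrier Y \<Longrightarrow>
    e x (y \<oplus>\<^bsub>Y\<^esub> y') \<ominus>\<^bsub>M\<^esub> (e x y \<oplus>\<^bsub>M\<^esub> e x y') \<in> rels"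
  "c \<in> carrier K \<Longrightarrow> x \<in> carrier X \<Longrightarrow> y \<in> carrier Y \<Longrightarrow>
    e (c \<odot>\<^bsub>X\<^esub> x) y \<ominus>\<^bsub>M\<^esub> c \<odot>\<^bsub>M\<^esub> e x y \<in> rels"
  "c \<in> carrier K \<Longrightarrow> x \<in> carrier X \<Longrightarrow> y \<in> carrier Y \<Longrightarrow>
    e x (c \<odot>\<^bsub>Y\<^esub> y) \<ominus>\<^bsub>M\<^esub> c \<odot>\<^bsub>M\<^esub> e x y \<in> rels"
  unfolding rels_def by blast+

private lemma relations_eq: "tensor_relations K X Y = submodule_span K M rels"
  by (simp add: tensor_relations_def rels_def Let_def)

private lemma relations_submodule: "submodule (tensor_relations K X Y) K M"
  unfolding relations_eq by (rule submodule_span[OF M.module_axioms rels_closed])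

private lemma relations_inc: "r \<in> rels \<Longrightarrow> r \<in> tensor_relations K X Y"
  unfolding relations_eq by (rule submodule_span_inc)

lemma tensor_is_module: "module K (tensor K X Y)"
  unfolding tensor_def by (rule quotient_module_is_module[OF M.module_axioms relations_submodule])

lemma pure_tensor_bilinear: "bilinear_map K X Y (tensor K X Y) (pure_tensor K X Y)"
proof -
  note eqI = coset_eq_iff[OF M.module_axioms relations_submodule, THEN iffD2]
  note q = quotient_map_linear[OF M.module_axioms relations_submodule, folded tensor_def]
  have closed: "pure_tensor K X Y x y \<in> carrier (tensor K X Y)"
    if "x \<in> carrier X" "y \<in> carrier Y" for x y
    unfolding pure_tensor_def using linear_maps_closed[OF q e_closed[OF that]] .
  have "pure_tensor K X Y (x \<oplus>\<^bsub>X\<^esub> x') y = pure_tensor K X Y x y \<oplus>\<^bsub>tensor K X Y\<^esub> pure_tensor K X Y x' y"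
    if "x \<in> carrier X" "x' \<in> carrier X" "y \<in> carrier Y" for x x' y
    unfolding pure_tensor_def linear_maps_add[OF q e_closed[OF that(1,3)] e_closed[OF that(2,3)], symmetric]
    by (intro eqI relations_inc relsI that) (use that in \<open>simp_all add: e_closed\<close>)
  moreover have "pure_tensor K X Y x (y \<oplus>\<^bsub>Y\<^esub> y') = pure_tensor K X Y x y \<oplus>\<^bsub>tensor K X Y\<^esub> pure_tensor K X Y x y'"
    if "x \<in> carrier X" "y \<in> carrier Y" "y' \<in> carrier Y" for x y y'
    unfolding pure_tensor_def linear_maps_add[OF q e_closed[OF that(1,2)] e_closed[OF that(1,3)], symmetric]
    by (intro eqI relations_inc relsI that) (use that in \<open>simp_all add: e_closed\<close>)
  moreover have "pure_tensor K X Y (c \<odot>\<^bsub>X\<^esub> x) y = c \<odot>\<^bsub>tensor K X Y\<^esub> pure_tensor K X Y x y"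
    if "c \<in> carrier K" "x \<in> carrier X" "y \<in> carrier Y" for c x y
    unfolding pure_tensor_def linear_maps_smult[OF q that(1) e_closed[OF that(2,3)], symmetric]
    by (intro eqI relations_inc relsI that) (use that in \<open>simp_all add: e_closed\<close>)
  moreover have "pure_tensor K X Y x (c \<odot>\<^bsub>Y\<^esub> y) = c \<odot>\<^bsub>tensor K X Y\<^esub> pure_tensor K X Y x y"
    if "c \<in> carrier K" "x \<in> carrier X" "y \<in> carrier Y" for c x y
    unfolding pure_tensor_def linear_maps_smult[OF q that(1) e_closed[OF that(2,3)], symmetric]
    by (intro eqI relations_inc relsI that) (use that in \<open>simp_all add: e_closed\<close>)
  ultimately show ?thesis
    by (intro bilinear_mapI linear_mapsI) (simp_all add: closed)
qed

text \<open>
  The induction principle for tensors: the pure tensors are the classes of the basis vectors of the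
  free module.  All identities between tensors below are checked in this way.
\<close>

lemma tensor_eqI:
  assumes f: "f \<in> linear_maps K (tensor K X Y) W" and g: "g \<in> linear_maps K (tensor K X Y) W"
    and W: "module K W"
    and eq: "\<And>x y. x \<in> carrier X \<Longrightarrow> y \<in> carrier Y \<Longrightarrow> f (pure_tensor K X Y x y) = g (pure_tensor K X Y x y)"
    and t: "t \<in> carrier (tensor K X Y)"
  shows "f t = g t"
proof -
  note q = quotient_map_linear[OF M.module_axioms relations_submodule, folded tensor_def]
  obtain u where u: "u \<in> carrier M" "t = tensor_relations K X Y +>\<^bsub>M\<^esub> u"
    using t quotient_module_carrier[OF M.module_axioms relations_submodule] unfolding tensor_def by auto
  have "f (tensor_relations K X Y +>\<^bsub>M\<^esub> u) = g (tensor_relations K X Y +>\<^bsub>M\<^esub> u)"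
    by (rule free_module_eqI[OF X.R.is_cring linear_maps_comp[OF q f] linear_maps_comp[OF q g] W _ u(1)])
      (use eq in \<open>auto simp: pure_tensor_def\<close>)
  then show ?thesis using u by simp
qed

lemma tensor_lift_ex:
  assumes f: "bilinear_map K X Y W f" and W: "module K W"
  shows "\<exists>g. g \<in> linear_maps K (tensor K X Y) W \<and>
    (\<forall>x\<in>carrier X. \<forall>y\<in>carrier Y. g (pure_tensor K X Y x y) = f x y)"
proof -
  interpret W: module K W by (rule W)
  obtain p where p: "p \<in> linear_maps K M W"
    and pe': "\<forall>s\<in>carrier X \<times> carrier Y. p (free_basis K s) = (\<lambda>(x, y). f x y) s"
    using free_module_lift_ex[OF X.R.is_cring W, where S = "carrier X \<times> carrier Y" and F = "\<lambda>(x, y). f x y"]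
      bilinear_map_closed[OF f] by auto
  have pe: "p (e x y) = f x y" if "x \<in> carrier X" "y \<in> carrier Y" for x y
    using pe' that by auto
  have minus_self: "w \<ominus>\<^bsub>W\<^esub> w = \<zero>\<^bsub>W\<^esub>" if "w \<in> carrier W" for w
    using that by (simp add: a_minus_def W.M.r_neg)
  have "p r = \<zero>\<^bsub>W\<^esub>" if "r \<in> rels" for r
    using that unfolding rels_def
    by (auto simp: linear_maps_minus[OF p M.module_axioms W] linear_maps_rules[OF p] e_closed pe
        bilinear_map_rules[OF f] minus_self)
  then have "p n = \<zero>\<^bsub>W\<^esub>" if "n \<in> tensor_relations K X Y" for n
    using linear_maps_zero_on_span[OF M.module_axioms W p rels_closed] that unfolding relations_eq by blast
  from quotient_lift_ex[OF M.module_axioms relations_submodule p W this]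
  obtain g where "g \<in> linear_maps K (tensor K X Y) W"
    "\<forall>u\<in>carrier M. g (tensor_relations K X Y +>\<^bsub>M\<^esub> u) = p u"
    unfolding tensor_def by blast
  then show ?thesis
    by (intro exI[of _ g]) (auto simp: pure_tensor_def pe e_closed)
qed

lemma tensor_lift_linear:
  assumes "bilinear_map K X Y W f" "module K W"
  shows "tensor_lift K X Y W f \<in> linear_maps K (tensor K X Y) W"
  unfolding tensor_lift_def using someI_ex[OF tensor_lift_ex[OF assms]] by blast

lemma tensor_lift_pure:
  assumes "bilinear_map K X Y W f" "module K W" "x \<in> carrier X" "y \<in> carrier Y"
  shows "tensor_lift K X Y W f (pure_tensor K X Y x y) = f x y"
  unfolding tensor_lift_def using someI_ex[OF tensor_lift_ex[OF assms(1,2)]] assms(3,4) by blast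

lemma tensor_lift_unique:
  assumes "bilinear_map K X Y W f" "module K W" "g \<in> linear_maps K (tensor K X Y) W"
    and "\<And>x y. x \<in> carrier X \<Longrightarrow> y \<in> carrier Y \<Longrightarrow> g (pure_tensor K X Y x y) = f x y"
    and "t \<in> carrier (tensor K X Y)"
  shows "g t = tensor_lift K X Y W f t"
  by (rule tensor_eqI[OF assms(3) tensor_lift_linear[OF assms(1,2)] assms(2) _ assms(5)])
    (simp add: assms(4) tensor_lift_pure[OF assms(1,2)])

lemma tensor_lift_post:
  assumes f: "bilinear_map K X Y W f" and W: "module K W" and W': "module K W'"
    and p: "p \<in> linear_maps K W W'" and t: "t \<in> carrier (tensor K X Y)"
  shows "p (tensor_lift K X Y W f t) = tensor_lift K X Y W' (\<lambda>x y. p (f x y)) t"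
  by (rule tensor_lift_unique[OF bilinear_map_comp[OF f p] W' linear_maps_comp[OF tensor_lift_linear[OF f W] p] _ t])
    (simp add: tensor_lift_pure[OF f W])

text \<open>
  For fixed \<open>t\<close>, the value of the lift is linear in the bilinear map.  This is what makes nested lifts,
  such as iterated Sweedler sums, bilinear in turn.
\<close>

lemma tensor_lift_linear_param:
  assumes f: "\<And>z. z \<in> carrier Z \<Longrightarrow> bilinear_map K X Y W (f z)"
    and lin: "\<And>x y. x \<in> carrier X \<Longrightarrow> y \<in> carrier Y \<Longrightarrow> (\<lambda>z. f z x y) \<in> linear_maps K Z W"
    and W: "module K W" and Z: "module K Z" and t: "t \<in> carrier (tensor K X Y)"
  shows "(\<lambda>z. tensor_lift K X Y W (f z) t) \<in> linear_maps K Z W"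
proof -
  interpret Z: module K Z by (rule Z)
  note L = tensor_lift_linear[OF f W]
  show ?thesis
  proof (rule linear_mapsI)
    fix z assume "z \<in> carrier Z"
    then show "tensor_lift K X Y W (f z) t \<in> carrier W" using linear_maps_closed[OF L t] by simp
  next
    fix z z' assume z: "z \<in> carrier Z" "z' \<in> carrier Z"
    show "tensor_lift K X Y W (f (z \<oplus>\<^bsub>Z\<^esub> z')) t = tensor_lift K X Y W (f z) t \<oplus>\<^bsub>W\<^esub> tensor_lift K X Y W (f z') t"
      by (rule tensor_lift_unique[symmetric, OF f W linear_maps_pointwise_add[OF L L W] _ t])
        (use z in \<open>simp_all add: tensor_lift_pure[OF f W] linear_maps_add[OF lin]\<close>)
  next
    fix c z assume z: "c \<in> carrier K" "z \<in> carrier Z"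
    show "tensor_lift K X Y W (f (c \<odot>\<^bsub>Z\<^esub> z)) t = c \<odot>\<^bsub>W\<^esub> tensor_lift K X Y W (f z) t"
      by (rule tensor_lift_unique[symmetric, OF f W linear_maps_pointwise_smult[OF L _ W] _ t])
        (use z in \<open>simp_all add: tensor_lift_pure[OF f W] linear_maps_smult[OF lin]\<close>)
  qed
qed

end

lemma tensor_lift_cong:
  assumes "\<And>x y. x \<in> carrier X \<Longrightarrow> y \<in> carrier Y \<Longrightarrow> f x y = g x y"
  shows "tensor_lift K X Y W f = tensor_lift K X Y W g"
  using assms by (simp add: tensor_lift_def)


section \<open>Tensor products of algebras\<close>

text \<open>
  Linear maps and tensor products of algebras see only the carrier, the addition and the scalar
  multiplication.  The next lemmas allow passing between an algebra, its twists and the underlying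
  module without changing the tensor products built from it.
\<close>

lemma module_cong_space:
  assumes "module K X" "carrier X' = carrier X" "add X' = add X" "zero X' = zero X" "smult X' = smult X"
  shows "module K X'"
  by (rule module_surj_image[OF assms(1), where q = "\<lambda>x. x"]) (simp_all add: assms(2-))

lemma linear_maps_cong_space:
  assumes "carrier X' = carrier X" "add X' = add X" "smult X' = smult X"
    and "carrier Y' = carrier Y" "add Y' = add Y" "smult Y' = smult Y"
  shows "linear_maps K X' Y' = linear_maps K X Y"
  by (simp add: linear_maps_def assms)

lemma tensor_cong_space:
  assumes "carrier X' = carrier X" "add X' = add X" "smult X' = smult X"
    and "carrier Y' = carrier Y" "add Y' = add Y" "smult Y' = smult Y"
  shows "tensor K X' Y' = tensor K X Y" and "pure_tensor K X' Y' = pure_tensor K X Y"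
proof -
  have "tensor_relations K X' Y' = tensor_relations K X Y"
    by (simp add: tensor_relations_def assms)
  then show "tensor K X' Y' = tensor K X Y" "pure_tensor K X' Y' = pure_tensor K X Y"
    by (simp_all add: tensor_def pure_tensor_def fun_eq_iff assms)
qed

lemma tensor_lift_cong_space:
  assumes "carrier X' = carrier X" "add X' = add X" "smult X' = smult X"
    and "carrier Y' = carrier Y" "add Y' = add Y" "smult Y' = smult Y"
    and "carrier W' = carrier W" "add W' = add W" "smult W' = smult W"
  shows "tensor_lift K X' Y' W' = tensor_lift K X Y W"
proof -
  have "linear_maps K (tensor K X Y) W' = linear_maps K (tensor K X Y) W"
    by (simp add: linear_maps_def assms)
  then show ?thesis
    by (simp add: fun_eq_iff tensor_lift_def tensor_cong_space[OF assms(1-6)] assms)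
qed

lemma tensor_algebra_space [simp]:
  "carrier (tensor_algebra K X Y) = carrier (tensor K X Y)"
  "add (tensor_algebra K X Y) = add (tensor K X Y)"
  "zero (tensor_algebra K X Y) = zero (tensor K X Y)"
  "smult (tensor_algebra K X Y) = smult (tensor K X Y)"
  by (simp_all add: tensor_algebra_def)

lemma tensor_of_tensor_algebra [simp]:
  "tensor K (tensor_algebra K X Y) Z = tensor K (tensor K X Y) Z"
  "tensor K Z (tensor_algebra K X Y) = tensor K Z (tensor K X Y)"
  "pure_tensor K (tensor_algebra K X Y) Z = pure_tensor K (tensor K X Y) Z"
  "pure_tensor K Z (tensor_algebra K X Y) = pure_tensor K Z (tensor K X Y)"
  by (rule tensor_cong_space; simp)+

lemma linear_maps_tensor_algebra [simp]:
  "linear_maps K (tensor_algebra K X Y) Z = linear_maps K (tensor K X Y) Z"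
  "linear_maps K Z (tensor_algebra K X Y) = linear_maps K Z (tensor K X Y)"
  by (rule linear_maps_cong_space; simp)+

lemma assoc_algebraD:
  assumes "assoc_algebra K A"
  shows "field K" "module K A" "ring A" "cring K" "monoid A"
proof -
  from assms show "field K" "module K A" "ring A" by (simp_all add: assoc_algebra_def)
  then show "cring K" "monoid A" by (simp_all add: field_def domain_def ring_def)
qed

lemma assoc_algebra_mult_bilinear:
  assumes "assoc_algebra K A"
  shows "bilinear_map K A A A (mult A)"
proof -
  interpret A: ring A by (rule assoc_algebraD[OF assms])
  show ?thesis
    by (intro bilinear_mapI linear_mapsI)
      (simp_all add: A.l_distr A.r_distr assoc_algebra.smult_mult_left[OF assms]
        assoc_algebra.smult_mult_right[OF assms])
qed

lemma assoc_algebraI: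
  assumes K: "field K" and A: "module K A" and mult: "bilinear_map K A A A (mult A)"
    and one: "\<one>\<^bsub>A\<^esub> \<in> carrier A"
    and l_one: "\<And>x. x \<in> carrier A \<Longrightarrow> \<one>\<^bsub>A\<^esub> \<otimes>\<^bsub>A\<^esub> x = x"
    and r_one: "\<And>x. x \<in> carrier A \<Longrightarrow> x \<otimes>\<^bsub>A\<^esub> \<one>\<^bsub>A\<^esub> = x"
    and assoc: "\<And>x y z. x \<in> carrier A \<Longrightarrow> y \<in> carrier A \<Longrightarrow> z \<in> carrier A \<Longrightarrow>
      x \<otimes>\<^bsub>A\<^esub> y \<otimes>\<^bsub>A\<^esub> z = x \<otimes>\<^bsub>A\<^esub> (y \<otimes>\<^bsub>A\<^esub> z)"
  shows "assoc_algebra K A"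
proof -
  interpret A: module K A by (rule A)
  have "monoid A"
    by (rule monoidI) (simp_all add: bilinear_map_closed[OF mult] one l_one r_one assoc)
  then have "ring A"
    by (intro ringI A.M.abelian_group_axioms)
      (simp_all add: bilinear_map_add_left[OF mult] bilinear_map_add_right[OF mult])
  then show ?thesis
    by (intro assoc_algebra.intro assoc_algebra_axioms.intro K A)
      (simp_all add: bilinear_map_smult_left[OF mult] bilinear_map_smult_right[OF mult])
qed

context
  fixes K :: "'k ring" and X :: "('k, 'a) module" and Y :: "('k, 'b) module"
    and X' :: "('k, 'c) module" and Y' :: "('k, 'd) module" and f g
  assumes X: "module K X" and Y: "module K Y" and X': "module K X'" and Y': "module K Y'"
    and f: "f \<in> linear_maps K X X'" and g: "g \<in> linear_maps K Y Y'"
begin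

private lemma bil: "bilinear_map K X Y (tensor K X' Y') (\<lambda>x y. pure_tensor K X' Y' (f x) (g y))"
  by (rule bilinear_map_precomp[OF pure_tensor_bilinear[OF X' Y'] f g])

lemma tensor_map_linear: "tensor_map K X Y X' Y' f g \<in> linear_maps K (tensor K X Y) (tensor K X' Y')"
  unfolding tensor_map_def by (rule tensor_lift_linear[OF X Y bil tensor_is_module[OF X' Y']])

lemma tensor_map_pure:
  "x \<in> carrier X \<Longrightarrow> y \<in> carrier Y \<Longrightarrow>
    tensor_map K X Y X' Y' f g (pure_tensor K X Y x y) = pure_tensor K X' Y' (f x) (g y)"
  unfolding tensor_map_def by (rule tensor_lift_pure[OF X Y bil tensor_is_module[OF X' Y']])

end

context
  fixes K :: "'k ring" and X :: "('k, 'a) module" and Y :: "('k, 'b) module"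
  assumes X: "assoc_algebra K X" and Y: "assoc_algebra K Y"
begin

interpretation X: ring X by (rule assoc_algebraD[OF X])
interpretation Y: ring Y by (rule assoc_algebraD[OF Y])

private lemmas X_module = assoc_algebraD(2)[OF X]
private lemmas Y_module = assoc_algebraD(2)[OF Y]
private lemmas T_module = tensor_is_module[OF X_module Y_module]
private lemmas X_mult = assoc_algebra_mult_bilinear[OF X]
private lemmas Y_mult = assoc_algebra_mult_bilinear[OF Y]
private lemmas T_pure = pure_tensor_bilinear[OF X_module Y_module]
private abbreviation (input) "T \<equiv> tensor K X Y"

text \<open>
  The product on \<open>X \<otimes> Y\<close> is a lift whose argument is itself given by a lift; it is well behaved because
  that argument is bilinear.
\<close>

private lemma left_factor_bilinear:
  assumes t: "t \<in> carrier T"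
  shows "bilinear_map K X Y T (\<lambda>x y. tensor_map K X Y X Y (\<lambda>x'. x \<otimes>\<^bsub>X\<^esub> x') (\<lambda>y'. y \<otimes>\<^bsub>Y\<^esub> y') t)"
proof -
  have b: "bilinear_map K X Y T (\<lambda>x' y'. pure_tensor K X Y (x \<otimes>\<^bsub>X\<^esub> x') (y \<otimes>\<^bsub>Y\<^esub> y'))"
    if "x \<in> carrier X" "y \<in> carrier Y" for x y
    by (rule bilinear_map_precomp[OF T_pure bilinear_map_linear_right[OF X_mult that(1)] bilinear_map_linear_right[OF Y_mult that(2)]])
  show ?thesis
    unfolding tensor_map_def
  proof (rule bilinear_mapI)
    fix x assume x: "x \<in> carrier X"
    show "(\<lambda>y. tensor_lift K X Y T (\<lambda>x' y'. pure_tensor K X Y (x \<otimes>\<^bsub>X\<^esub> x') (y \<otimes>\<^bsub>Y\<^esub> y')) t) \<in> linear_maps K Y T"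
    proof (rule tensor_lift_linear_param[OF X_module Y_module b[OF x] _ T_module Y_module t])
      fix x' y' assume *: "x' \<in> carrier X" "y' \<in> carrier Y"
      show "(\<lambda>y. pure_tensor K X Y (x \<otimes>\<^bsub>X\<^esub> x') (y \<otimes>\<^bsub>Y\<^esub> y')) \<in> linear_maps K Y T"
        by (rule linear_maps_comp[OF bilinear_map_linear_left[OF Y_mult] bilinear_map_linear_right[OF T_pure]])
          (use x * in auto)
    qed
  next
    fix y assume y: "y \<in> carrier Y"
    show "(\<lambda>x. tensor_lift K X Y T (\<lambda>x' y'. pure_tensor K X Y (x \<otimes>\<^bsub>X\<^esub> x') (y \<otimes>\<^bsub>Y\<^esub> y')) t) \<in> linear_maps K X T"
    proof (rule tensor_lift_linear_param[OF X_module Y_module b[OF _ y] _ T_module X_module t])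
      fix x' y' assume *: "x' \<in> carrier X" "y' \<in> carrier Y"
      show "(\<lambda>x. pure_tensor K X Y (x \<otimes>\<^bsub>X\<^esub> x') (y \<otimes>\<^bsub>Y\<^esub> y')) \<in> linear_maps K X T"
        by (rule linear_maps_comp[OF bilinear_map_linear_left[OF X_mult] bilinear_map_linear_left[OF T_pure]])
          (use y * in auto)
    qed
  qed
qed

private lemma tensor_algebra_mult:
  "s \<otimes>\<^bsub>tensor_algebra K X Y\<^esub> t = tensor_lift K X Y T
     (\<lambda>x y. tensor_map K X Y X Y (\<lambda>x'. x \<otimes>\<^bsub>X\<^esub> x') (\<lambda>y'. y \<otimes>\<^bsub>Y\<^esub> y') t) s"
  by (simp add: tensor_algebra_def)

private lemma map_linear: "x \<in> carrier X \<Longrightarrow> y \<in> carrier Y \<Longrightarrow>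
    tensor_map K X Y X Y (\<lambda>x'. x \<otimes>\<^bsub>X\<^esub> x') (\<lambda>y'. y \<otimes>\<^bsub>Y\<^esub> y') \<in> linear_maps K T T"
  by (rule tensor_map_linear[OF X_module Y_module X_module Y_module bilinear_map_linear_right[OF X_mult] bilinear_map_linear_right[OF Y_mult]])

lemma tensor_algebra_mult_bilinear: "bilinear_map K T T T (mult (tensor_algebra K X Y))"
proof (rule bilinear_mapI)
  fix t assume t: "t \<in> carrier T"
  then show "(\<lambda>s. s \<otimes>\<^bsub>tensor_algebra K X Y\<^esub> t) \<in> linear_maps K T T"
    unfolding tensor_algebra_mult by (rule tensor_lift_linear[OF X_module Y_module left_factor_bilinear T_module])
next
  fix s assume s: "s \<in> carrier T"
  have "(\<lambda>t. s \<otimes>\<^bsub>tensor_algebra K X Y\<^esub> t) \<in> linear_maps K T T"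
    unfolding tensor_algebra_mult
    by (rule tensor_lift_linear_param[OF X_module Y_module left_factor_bilinear map_linear T_module T_module s])
  then show "mult (tensor_algebra K X Y) s \<in> linear_maps K T T" .
qed

lemma tensor_algebra_mult_pure:
  assumes "x \<in> carrier X" "y \<in> carrier Y" "x' \<in> carrier X" "y' \<in> carrier Y"
  shows "pure_tensor K X Y x y \<otimes>\<^bsub>tensor_algebra K X Y\<^esub> pure_tensor K X Y x' y' =
    pure_tensor K X Y (x \<otimes>\<^bsub>X\<^esub> x') (y \<otimes>\<^bsub>Y\<^esub> y')"
  using assms bilinear_map_closed[OF T_pure]
  by (simp add: tensor_algebra_mult tensor_lift_pure[OF X_module Y_module left_factor_bilinear T_module]
      tensor_map_pure[OF X_module Y_module X_module Y_module bilinear_map_linear_right[OF X_mult] bilinear_map_linear_right[OF Y_mult]])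

private lemmas mult_left = bilinear_map_linear_left[OF tensor_algebra_mult_bilinear]
private lemmas mult_right = bilinear_map_linear_right[OF tensor_algebra_mult_bilinear]
private lemmas mult_closed = bilinear_map_closed[OF tensor_algebra_mult_bilinear]
private lemmas T_pure_closed = bilinear_map_closed[OF T_pure]

text \<open>
  Both sides of each ring axiom are linear in every argument, so the axiom need only be verified on
  pure tensors, where it holds in each factor separately.
\<close>

lemma tensor_algebra_is_algebra: "assoc_algebra K (tensor_algebra K X Y)"
proof (rule assoc_algebraI)
  let ?T = "tensor_algebra K X Y"
  show "field K" by (rule assoc_algebraD[OF X])
  show "module K ?T" by (rule module_cong_space[OF T_module]) simp_all
  show "bilinear_map K ?T ?T ?T (mult ?T)"
    using tensor_algebra_mult_bilinear by (simp add: bilinear_map_def)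
  have one: "\<one>\<^bsub>?T\<^esub> = pure_tensor K X Y \<one>\<^bsub>X\<^esub> \<one>\<^bsub>Y\<^esub>" by (simp add: tensor_algebra_def)
  show one_closed: "\<one>\<^bsub>?T\<^esub> \<in> carrier ?T" by (simp add: one T_pure_closed)
  show "\<one>\<^bsub>?T\<^esub> \<otimes>\<^bsub>?T\<^esub> t = t" if "t \<in> carrier ?T" for t
    by (rule tensor_eqI[OF X_module Y_module mult_right linear_maps_id T_module])
      (use that one_closed in \<open>simp_all add: one tensor_algebra_mult_pure\<close>)
  show "t \<otimes>\<^bsub>?T\<^esub> \<one>\<^bsub>?T\<^esub> = t" if "t \<in> carrier ?T" for t
    by (rule tensor_eqI[OF X_module Y_module mult_left linear_maps_id T_module])
      (use that one_closed in \<open>simp_all add: one tensor_algebra_mult_pure\<close>)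
  fix s t u assume stu: "s \<in> carrier ?T" "t \<in> carrier ?T" "u \<in> carrier ?T"
  show "s \<otimes>\<^bsub>?T\<^esub> t \<otimes>\<^bsub>?T\<^esub> u = s \<otimes>\<^bsub>?T\<^esub> (t \<otimes>\<^bsub>?T\<^esub> u)"
  proof (rule tensor_eqI[OF X_module Y_module _ _ T_module, of "\<lambda>s. s \<otimes>\<^bsub>?T\<^esub> t \<otimes>\<^bsub>?T\<^esub> u" "\<lambda>s. s \<otimes>\<^bsub>?T\<^esub> (t \<otimes>\<^bsub>?T\<^esub> u)"])
    fix x y assume xy: "x \<in> carrier X" "y \<in> carrier Y"
    let ?s = "pure_tensor K X Y x y"
    have s: "?s \<in> carrier T" by (rule T_pure_closed[OF xy])
    show "?s \<otimes>\<^bsub>?T\<^esub> t \<otimes>\<^bsub>?T\<^esub> u = ?s \<otimes>\<^bsub>?T\<^esub> (t \<otimes>\<^bsub>?T\<^esub> u)"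
    proof (rule tensor_eqI[OF X_module Y_module _ _ T_module, of "\<lambda>t. ?s \<otimes>\<^bsub>?T\<^esub> t \<otimes>\<^bsub>?T\<^esub> u" "\<lambda>t. ?s \<otimes>\<^bsub>?T\<^esub> (t \<otimes>\<^bsub>?T\<^esub> u)"])
      fix x' y' assume xy': "x' \<in> carrier X" "y' \<in> carrier Y"
      let ?t = "pure_tensor K X Y x' y'"
      have t: "?t \<in> carrier T" by (rule T_pure_closed[OF xy'])
      show "?s \<otimes>\<^bsub>?T\<^esub> ?t \<otimes>\<^bsub>?T\<^esub> u = ?s \<otimes>\<^bsub>?T\<^esub> (?t \<otimes>\<^bsub>?T\<^esub> u)"
        by (rule tensor_eqI[OF X_module Y_module mult_right linear_maps_comp[OF mult_right mult_right] T_module])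
          (use s t stu xy xy' in \<open>simp_all add: mult_closed T_pure_closed tensor_algebra_mult_pure X.m_assoc Y.m_assoc\<close>)
    qed (use s stu in \<open>simp_all add: linear_maps_comp[OF mult_right mult_left] linear_maps_comp[OF mult_left mult_right]\<close>)
  qed (use stu mult_closed in \<open>simp_all add: linear_maps_comp[OF mult_left mult_left] mult_left\<close>)
qed

lemma tensor_algebra_one: "\<one>\<^bsub>tensor_algebra K X Y\<^esub> = pure_tensor K X Y \<one>\<^bsub>X\<^esub> \<one>\<^bsub>Y\<^esub>"
  by (simp add: tensor_algebra_def)

text \<open>Multiplicativity of a linear map out of \<open>X \<otimes> Y\<close> is a bilinear condition, hence can be checked
  on pure tensors.\<close>

lemma tensor_algebra_hom_mult:
  assumes Q: "assoc_algebra K Q" and \<phi>: "\<phi> \<in> linear_maps K T Q"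
    and pure_mult: "\<And>x y x' y'. \<lbrakk>x \<in> carrier X; y \<in> carrier Y; x' \<in> carrier X; y' \<in> carrier Y\<rbrakk> \<Longrightarrow>
      \<phi> (pure_tensor K X Y (x \<otimes>\<^bsub>X\<^esub> x') (y \<otimes>\<^bsub>Y\<^esub> y')) =
      \<phi> (pure_tensor K X Y x y) \<otimes>\<^bsub>Q\<^esub> \<phi> (pure_tensor K X Y x' y')"
    and s: "s \<in> carrier T" and t: "t \<in> carrier T"
  shows "\<phi> (s \<otimes>\<^bsub>tensor_algebra K X Y\<^esub> t) = \<phi> s \<otimes>\<^bsub>Q\<^esub> \<phi> t"
proof -
  let ?T = "tensor_algebra K X Y"
  note bQ = assoc_algebra_mult_bilinear[OF Q] and mQ = assoc_algebraD(2)[OF Q]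
  note Q_left = bilinear_map_linear_left[OF bQ] and Q_right = bilinear_map_linear_right[OF bQ]
  note closed = linear_maps_closed[OF \<phi>]
  show ?thesis
  proof (rule tensor_eqI[OF X_module Y_module linear_maps_comp[OF mult_left \<phi>] linear_maps_comp[OF \<phi> Q_left] mQ _ s])
    fix x y assume xy: "x \<in> carrier X" "y \<in> carrier Y"
    note sc = T_pure_closed[OF xy]
    show "\<phi> (pure_tensor K X Y x y \<otimes>\<^bsub>?T\<^esub> t) = \<phi> (pure_tensor K X Y x y) \<otimes>\<^bsub>Q\<^esub> \<phi> t"
      by (rule tensor_eqI[OF X_module Y_module linear_maps_comp[OF mult_right[OF sc] \<phi>] linear_maps_comp[OF \<phi> Q_right[OF closed[OF sc]]] mQ _ t])
        (use xy in \<open>simp_all add: tensor_algebra_mult_pure pure_mult\<close>)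
  qed (simp_all add: t closed)
qed

end

definition algebra_hom :: "'k ring \<Rightarrow> ('k, 'a) module \<Rightarrow> ('k, 'b) module \<Rightarrow> ('a \<Rightarrow> 'b) \<Rightarrow> bool" where
  "algebra_hom K R Q \<phi> \<longleftrightarrow> \<phi> \<in> linear_maps K R Q \<and> \<phi> \<in> ring_hom R Q"

lemma algebra_hom_tensor_map:
  assumes X: "assoc_algebra K X" and Y: "assoc_algebra K Y"
    and X': "assoc_algebra K X'" and Y': "assoc_algebra K Y'"
    and f: "algebra_hom K X X' f" and g: "algebra_hom K Y Y' g"
  shows "algebra_hom K (tensor_algebra K X Y) (tensor_algebra K X' Y') (tensor_map K X Y X' Y' f g)"
proof -
  interpret X: ring X by (rule assoc_algebraD[OF X])
  interpret Y: ring Y by (rule assoc_algebraD[OF Y])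
  note m = assoc_algebraD(2)
  have fl: "f \<in> linear_maps K X X'" and gl: "g \<in> linear_maps K Y Y'"
    using f g by (auto simp: algebra_hom_def)
  have fr: "f \<in> ring_hom X X'" and gr: "g \<in> ring_hom Y Y'"
    using f g by (auto simp: algebra_hom_def)
  note mp = tensor_map_pure[OF m[OF X] m[OF Y] m[OF X'] m[OF Y'] fl gl]
  note ml = tensor_map_linear[OF m[OF X] m[OF Y] m[OF X'] m[OF Y'] fl gl]
  note T' = tensor_algebra_is_algebra[OF X' Y']
  have mult: "tensor_map K X Y X' Y' f g (s \<otimes>\<^bsub>tensor_algebra K X Y\<^esub> t) =
      tensor_map K X Y X' Y' f g s \<otimes>\<^bsub>tensor_algebra K X' Y'\<^esub> tensor_map K X Y X' Y' f g t"
    if "s \<in> carrier (tensor K X Y)" "t \<in> carrier (tensor K X Y)" for s t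
    by (rule tensor_algebra_hom_mult[OF X Y T'])
      (use ml that in \<open>simp_all add: mp tensor_algebra_mult_pure[OF X' Y'] ring_hom_mult[OF fr] ring_hom_mult[OF gr]
        ring_hom_closed[OF fr] ring_hom_closed[OF gr]\<close>)
  show ?thesis
    using ml linear_maps_closed[OF ml] linear_maps_add[OF ml] mult
    by (auto simp: algebra_hom_def ring_hom_def tensor_algebra_one[OF X Y] tensor_algebra_one[OF X' Y'] mp
        ring_hom_one[OF fr] ring_hom_one[OF gr])
qed


section \<open>The associator\<close>

context
  fixes K :: "'k ring" and X :: "('k, 'a) module" and Y :: "('k, 'b) module" and Z :: "('k, 'c) module"
  assumes X: "module K X" and Y: "module K Y" and Z: "module K Z"
begin

private lemmas XY = tensor_is_module[OF X Y] and YZ = tensor_is_module[OF Y Z]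
private lemmas W = tensor_is_module[OF tensor_is_module[OF X Y] Z]
private lemmas pXY = pure_tensor_bilinear[OF X Y]
private lemmas pXY_Z = pure_tensor_bilinear[OF tensor_is_module[OF X Y] Z]

private lemma inner_bilinear:
  "x \<in> carrier X \<Longrightarrow> bilinear_map K Y Z (tensor K (tensor K X Y) Z)
    (\<lambda>y z. pure_tensor K (tensor K X Y) Z (pure_tensor K X Y x y) z)"
  by (rule bilinear_map_precomp[OF pXY_Z bilinear_map_linear_right[OF pXY] linear_maps_id])

private lemma outer_bilinear:
  "bilinear_map K X (tensor K Y Z) (tensor K (tensor K X Y) Z)
    (\<lambda>x. tensor_lift K Y Z (tensor K (tensor K X Y) Z)
      (\<lambda>y z. pure_tensor K (tensor K X Y) Z (pure_tensor K X Y x y) z))"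
proof (rule bilinear_mapI)
  fix x assume "x \<in> carrier X"
  then show "tensor_lift K Y Z (tensor K (tensor K X Y) Z)
      (\<lambda>y z. pure_tensor K (tensor K X Y) Z (pure_tensor K X Y x y) z)
      \<in> linear_maps K (tensor K Y Z) (tensor K (tensor K X Y) Z)"
    by (intro tensor_lift_linear[OF Y Z] inner_bilinear W)
next
  fix t assume t: "t \<in> carrier (tensor K Y Z)"
  show "(\<lambda>x. tensor_lift K Y Z (tensor K (tensor K X Y) Z)
      (\<lambda>y z. pure_tensor K (tensor K X Y) Z (pure_tensor K X Y x y) z) t)
      \<in> linear_maps K X (tensor K (tensor K X Y) Z)"
  proof (rule tensor_lift_linear_param[OF Y Z inner_bilinear _ W X t])
    fix y z assume yz: "y \<in> carrier Y" "z \<in> carrier Z"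
    show "(\<lambda>x. pure_tensor K (tensor K X Y) Z (pure_tensor K X Y x y) z)
      \<in> linear_maps K X (tensor K (tensor K X Y) Z)"
      by (rule linear_maps_comp[OF bilinear_map_linear_left[OF pXY yz(1)] bilinear_map_linear_left[OF pXY_Z yz(2)]])
  qed
qed

lemma tensor_assoc_linear:
  "tensor_assoc K X Y Z \<in> linear_maps K (tensor K X (tensor K Y Z)) (tensor K (tensor K X Y) Z)"
  unfolding tensor_assoc_def Let_def by (rule tensor_lift_linear[OF X YZ outer_bilinear W])

lemma tensor_assoc_pure:
  assumes "x \<in> carrier X" "y \<in> carrier Y" "z \<in> carrier Z"
  shows "tensor_assoc K X Y Z (pure_tensor K X (tensor K Y Z) x (pure_tensor K Y Z y z)) =
    pure_tensor K (tensor K X Y) Z (pure_tensor K X Y x y) z"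
  using assms bilinear_map_closed[OF pure_tensor_bilinear[OF Y Z]]
  by (simp add: tensor_assoc_def Let_def tensor_lift_pure[OF X YZ outer_bilinear W]
      tensor_lift_pure[OF Y Z inner_bilinear W])

end

text \<open>
  By trilinearity the claim reduces to products of tensors of the form \<open>x \<otimes> (y \<otimes> z)\<close>; the criterion for
  homomorphisms handles the outer tensor product, two further reductions the inner one.
\<close>

lemma algebra_hom_tensor_assoc:
  assumes X: "assoc_algebra K X" and Y: "assoc_algebra K Y" and Z: "assoc_algebra K Z"
  shows "algebra_hom K (tensor_algebra K X (tensor_algebra K Y Z)) (tensor_algebra K (tensor_algebra K X Y) Z)
    (tensor_assoc K X Y Z)"
proof -
  interpret X: ring X by (rule assoc_algebraD[OF X])
  interpret Y: ring Y by (rule assoc_algebraD[OF Y])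
  interpret Z: ring Z by (rule assoc_algebraD[OF Z])
  note mX = assoc_algebraD(2)[OF X] and mY = assoc_algebraD(2)[OF Y] and mZ = assoc_algebraD(2)[OF Z]
  note mYZ = tensor_is_module[OF mY mZ]
  note YZ = tensor_algebra_is_algebra[OF Y Z] and XY = tensor_algebra_is_algebra[OF X Y]
  let ?Q = "tensor_algebra K (tensor_algebra K X Y) Z"
  note Q = tensor_algebra_is_algebra[OF XY Z]
  note bQ = assoc_algebra_mult_bilinear[OF Q]
  note mQ = assoc_algebraD(2)[OF Q]
  let ?\<alpha> = "tensor_assoc K X Y Z"
  have \<alpha>: "?\<alpha> \<in> linear_maps K (tensor K X (tensor K Y Z)) ?Q"
    using tensor_assoc_linear[OF mX mY mZ] by simp
  note \<alpha>c = linear_maps_closed[OF \<alpha>]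
  note p = pure_tensor_bilinear[OF mX mYZ]
  note pr = bilinear_map_linear_right[OF p]
  note pYZ = bilinear_map_closed[OF pure_tensor_bilinear[OF mY mZ]]
  note pXY = bilinear_map_closed[OF pure_tensor_bilinear[OF mX mY]]
  note b = tensor_algebra_mult_bilinear[OF Y Z]
  note bl = bilinear_map_linear_left[OF b] and br = bilinear_map_linear_right[OF b]
  have pure_mult: "?\<alpha> (pure_tensor K X (tensor K Y Z) (x \<otimes>\<^bsub>X\<^esub> x') (s \<otimes>\<^bsub>tensor_algebra K Y Z\<^esub> t)) =
      ?\<alpha> (pure_tensor K X (tensor K Y Z) x s) \<otimes>\<^bsub>?Q\<^esub> ?\<alpha> (pure_tensor K X (tensor K Y Z) x' t)"
    if x: "x \<in> carrier X" "x' \<in> carrier X" and s: "s \<in> carrier (tensor K Y Z)" and t: "t \<in> carrier (tensor K Y Z)"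
    for x x' s t
  proof -
    have xx: "x \<otimes>\<^bsub>X\<^esub> x' \<in> carrier X" using x by simp
    note l1 = linear_maps_comp[OF pr[OF x(1)] \<alpha>] and l2 = linear_maps_comp[OF pr[OF x(2)] \<alpha>]
      and l12 = linear_maps_comp[OF pr[OF xx] \<alpha>]
    show ?thesis
    proof (rule tensor_eqI[OF mY mZ linear_maps_comp[OF bl[OF t] l12]
          linear_maps_comp[OF l1 bilinear_map_linear_left[OF bQ]] mQ _ s])
      show "?\<alpha> (pure_tensor K X (tensor K Y Z) x' t) \<in> carrier ?Q" by (rule linear_maps_closed[OF l2 t])
    next
      fix y z assume yz: "y \<in> carrier Y" "z \<in> carrier Z"
      note yzc = pYZ[OF yz]
      show "?\<alpha> (pure_tensor K X (tensor K Y Z) (x \<otimes>\<^bsub>X\<^esub> x') (pure_tensor K Y Z y z \<otimes>\<^bsub>tensor_algebra K Y Z\<^esub> t)) =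
        ?\<alpha> (pure_tensor K X (tensor K Y Z) x (pure_tensor K Y Z y z)) \<otimes>\<^bsub>?Q\<^esub> ?\<alpha> (pure_tensor K X (tensor K Y Z) x' t)"
      proof (rule tensor_eqI[OF mY mZ linear_maps_comp[OF br[OF yzc] l12]
            linear_maps_comp[OF l2 bilinear_map_linear_right[OF bQ]] mQ _ t])
        show "?\<alpha> (pure_tensor K X (tensor K Y Z) x (pure_tensor K Y Z y z)) \<in> carrier ?Q"
          by (rule linear_maps_closed[OF l1 yzc])
      next
        fix y' z' assume yz': "y' \<in> carrier Y" "z' \<in> carrier Z"
        show "?\<alpha> (pure_tensor K X (tensor K Y Z) (x \<otimes>\<^bsub>X\<^esub> x') (pure_tensor K Y Z y z \<otimes>\<^bsub>tensor_algebra K Y Z\<^esub> pure_tensor K Y Z y' z')) =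
          ?\<alpha> (pure_tensor K X (tensor K Y Z) x (pure_tensor K Y Z y z)) \<otimes>\<^bsub>?Q\<^esub>
          ?\<alpha> (pure_tensor K X (tensor K Y Z) x' (pure_tensor K Y Z y' z'))"
          using x yz yz' pXY tensor_algebra_mult_pure[OF XY Z]
          by (simp add: tensor_algebra_mult_pure[OF Y Z] tensor_algebra_mult_pure[OF X Y] tensor_assoc_pure[OF mX mY mZ])
      qed
    qed
  qed
  have mult: "?\<alpha> (s \<otimes>\<^bsub>tensor_algebra K X (tensor_algebra K Y Z)\<^esub> t) = ?\<alpha> s \<otimes>\<^bsub>?Q\<^esub> ?\<alpha> t"
    if "s \<in> carrier (tensor K X (tensor K Y Z))" "t \<in> carrier (tensor K X (tensor K Y Z))" for s t
    by (rule tensor_algebra_hom_mult[OF X YZ Q]) (use \<alpha> that pure_mult in \<open>simp_all\<close>)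
  show ?thesis
    using \<alpha> \<alpha>c linear_maps_add[OF \<alpha>] mult
    by (auto simp: algebra_hom_def ring_hom_def tensor_algebra_one[OF X Y] tensor_algebra_one[OF Y Z]
        tensor_algebra_one[OF XY Z] tensor_algebra_one[OF X YZ] tensor_assoc_pure[OF mX mY mZ])
qed


section \<open>Acting on a bilinear map by a tensor\<close>

lemma left_moduleD:
  assumes "left_module K R X a"
  shows "assoc_algebra K R" "module K X" "bilinear_map K R X X a"
    and "\<And>x. x \<in> carrier X \<Longrightarrow> a \<one>\<^bsub>R\<^esub> x = x"
    and "\<And>r s x. r \<in> carrier R \<Longrightarrow> s \<in> carrier R \<Longrightarrow> x \<in> carrier X \<Longrightarrow> a (r \<otimes>\<^bsub>R\<^esub> s) x = a r (a s x)"
  using assms by (simp_all add: left_module_def left_module_axioms_def)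

lemma left_moduleI:
  assumes "assoc_algebra K R" "module K X" "bilinear_map K R X X a"
    and "\<And>x. x \<in> carrier X \<Longrightarrow> a \<one>\<^bsub>R\<^esub> x = x"
    and "\<And>r s x. r \<in> carrier R \<Longrightarrow> s \<in> carrier R \<Longrightarrow> x \<in> carrier X \<Longrightarrow> a (r \<otimes>\<^bsub>R\<^esub> s) x = a r (a s x)"
  shows "left_module K R X a"
  using assms by (simp add: left_module_def left_module_axioms_def)

definition twist_map ::
    "'k ring \<Rightarrow> ('k, 'h) module \<Rightarrow> ('k, 'w) module \<Rightarrow> ('h \<Rightarrow> 'x \<Rightarrow> 'x) \<Rightarrow> ('h \<Rightarrow> 'y \<Rightarrow> 'y)
      \<Rightarrow> ('h \<times> 'h \<Rightarrow> 'k) set \<Rightarrow> ('x \<Rightarrow> 'y \<Rightarrow> 'w) \<Rightarrow> 'x \<Rightarrow> 'y \<Rightarrow> 'w" where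
  "twist_map K H W aX aY t m x y = tensor_lift K H H W (\<lambda>h h'. m (aX h x) (aY h' y)) t"

text \<open>
  Twisting depends only on the values of the map on the carriers, although \<open>m\<close> is a function on the
  whole type.
\<close>

lemma twist_map_cong:
  assumes "left_module K H X aX" "left_module K H Y aY" "x \<in> carrier X" "y \<in> carrier Y"
    and "\<And>x y. x \<in> carrier X \<Longrightarrow> y \<in> carrier Y \<Longrightarrow> m x y = m' x y"
  shows "twist_map K H W aX aY t m x y = twist_map K H W aX aY t m' x y"
  unfolding twist_map_def
  by (rule arg_cong[where f = "\<lambda>f. f t"], rule tensor_lift_cong)
    (simp add: assms(3-) bilinear_map_closed[OF left_moduleD(3)[OF assms(1)]]
      bilinear_map_closed[OF left_moduleD(3)[OF assms(2)]])

context
  fixes K :: "'k ring" and H :: "('k, 'h) module"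
    and X :: "('k, 'x) module" and aX and Y :: "('k, 'y) module" and aY and W :: "('k, 'w) module"
  assumes X: "left_module K H X aX" and Y: "left_module K H Y aY" and W: "module K W"
begin

private lemmas H = left_moduleD(1)[OF X]
private lemmas mH = assoc_algebraD(2)[OF left_moduleD(1)[OF X]]
private lemmas mX = left_moduleD(2)[OF X] and mY = left_moduleD(2)[OF Y]
private lemmas bX = left_moduleD(3)[OF X] and bY = left_moduleD(3)[OF Y]
private abbreviation (input) "HH \<equiv> tensor K H H"
private abbreviation (input) "tw \<equiv> twist_map K H W aX aY"

interpretation H: ring H by (rule assoc_algebraD[OF H])

private lemma arg_bilinear:
  assumes m: "bilinear_map K X Y W m" and "x \<in> carrier X" "y \<in> carrier Y"
  shows "bilinear_map K H H W (\<lambda>h h'. m (aX h x) (aY h' y))"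
  by (rule bilinear_map_precomp[OF m bilinear_map_linear_left[OF bX] bilinear_map_linear_left[OF bY]]) fact+

lemma twist_map_pure:
  assumes "bilinear_map K X Y W m" "x \<in> carrier X" "y \<in> carrier Y" "h \<in> carrier H" "h' \<in> carrier H"
  shows "tw (pure_tensor K H H h h') m x y = m (aX h x) (aY h' y)"
  unfolding twist_map_def by (rule tensor_lift_pure[OF mH mH arg_bilinear[OF assms(1-3)] W assms(4,5)])

lemma twist_map_linear_tensor:
  assumes "bilinear_map K X Y W m" "x \<in> carrier X" "y \<in> carrier Y"
  shows "(\<lambda>t. tw t m x y) \<in> linear_maps K HH W"
  unfolding twist_map_def by (rule tensor_lift_linear[OF mH mH arg_bilinear[OF assms] W])

lemma twist_map_bilinear:
  assumes m: "bilinear_map K X Y W m" and t: "t \<in> carrier HH"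
  shows "bilinear_map K X Y W (tw t m)"
proof (rule bilinear_mapI)
  fix x assume x: "x \<in> carrier X"
  have "(\<lambda>y. tensor_lift K H H W (\<lambda>h h'. m (aX h x) (aY h' y)) t) \<in> linear_maps K Y W"
  proof (rule tensor_lift_linear_param[OF mH mH arg_bilinear[OF m x] _ W mY t])
    fix h h' assume h: "h \<in> carrier H" "h' \<in> carrier H"
    show "(\<lambda>y. m (aX h x) (aY h' y)) \<in> linear_maps K Y W"
      by (rule linear_maps_comp[OF bilinear_map_linear_right[OF bY h(2)]
            bilinear_map_linear_right[OF m bilinear_map_closed[OF bX h(1) x]]])
  qed
  then show "tw t m x \<in> linear_maps K Y W" by (simp add: twist_map_def[abs_def])
next
  fix y assume y: "y \<in> carrier Y"
  have "(\<lambda>x. tensor_lift K H H W (\<lambda>h h'. m (aX h x) (aY h' y)) t) \<in> linear_maps K X W"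
  proof (rule tensor_lift_linear_param[OF mH mH arg_bilinear[OF m _ y] _ W mX t])
    fix h h' assume h: "h \<in> carrier H" "h' \<in> carrier H"
    show "(\<lambda>x. m (aX h x) (aY h' y)) \<in> linear_maps K X W"
      by (rule linear_maps_comp[OF bilinear_map_linear_right[OF bX h(1)]
            bilinear_map_linear_left[OF m bilinear_map_closed[OF bY h(2) y]]])
  qed
  then show "(\<lambda>x. tw t m x y) \<in> linear_maps K X W" by (simp add: twist_map_def)
qed

lemma twist_map_one:
  assumes "bilinear_map K X Y W m" "x \<in> carrier X" "y \<in> carrier Y"
  shows "tw \<one>\<^bsub>tensor_algebra K H H\<^esub> m x y = m x y"
  using assms by (simp add: tensor_algebra_one[OF H H] twist_map_pure left_moduleD(4)[OF X] left_moduleD(4)[OF Y])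

text \<open>Since \<open>t\<close> acts on the arguments, the action on maps is from the right.\<close>

lemma twist_map_twist_map:
  assumes m: "bilinear_map K X Y W m" and s: "s \<in> carrier HH" and t: "t \<in> carrier HH"
    and x: "x \<in> carrier X" and y: "y \<in> carrier Y"
  shows "tw s (tw t m) x y = tw (t \<otimes>\<^bsub>tensor_algebra K H H\<^esub> s) m x y"
proof -
  note mult = tensor_algebra_mult_bilinear[OF H H]
  note lin = twist_map_linear_tensor[OF m]
  note cX = bilinear_map_closed[OF bX] and cY = bilinear_map_closed[OF bY]
  show ?thesis
  proof (rule tensor_eqI[OF mH mH twist_map_linear_tensor[OF twist_map_bilinear[OF m t] x y]
        linear_maps_comp[OF bilinear_map_linear_right[OF mult t] lin[OF x y]] W _ s])
    fix h h' assume h: "h \<in> carrier H" "h' \<in> carrier H"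
    note p = bilinear_map_closed[OF pure_tensor_bilinear[OF mH mH] h]
    have "tw t m (aX h x) (aY h' y) = tw (t \<otimes>\<^bsub>tensor_algebra K H H\<^esub> pure_tensor K H H h h') m x y"
      by (rule tensor_eqI[OF mH mH lin[OF cX[OF h(1) x] cY[OF h(2) y]]
            linear_maps_comp[OF bilinear_map_linear_left[OF mult p] lin[OF x y]] W _ t])
        (use h x y m in \<open>simp_all add: twist_map_pure tensor_algebra_mult_pure[OF H H] cX cY
          left_moduleD(5)[OF X] left_moduleD(5)[OF Y]\<close>)
    then show "tw (pure_tensor K H H h h') (tw t m) x y =
        tw (t \<otimes>\<^bsub>tensor_algebra K H H\<^esub> pure_tensor K H H h h') m x y"
      using twist_map_pure[OF twist_map_bilinear[OF m t] x y h] by simp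
  qed
qed

lemma twist_map_post:
  assumes m: "bilinear_map K X Y W m" and W': "module K W'" and p: "p \<in> linear_maps K W W'"
    and "t \<in> carrier HH" "x \<in> carrier X" "y \<in> carrier Y"
  shows "p (tw t m x y) = twist_map K H W' aX aY t (\<lambda>x y. p (m x y)) x y"
  unfolding twist_map_def
  by (rule tensor_lift_post[OF mH mH arg_bilinear[OF m] W W' p]) fact+

end

lemma tensor_act_eq:
  "tensor_act K H X aX Y aY t =
    tensor_lift K X Y (tensor K X Y) (twist_map K H (tensor K X Y) aX aY t (pure_tensor K X Y))"
  by (simp add: tensor_act_def twist_map_def[abs_def])

context
  fixes K :: "'k ring" and H :: "('k, 'h) module"
    and X :: "('k, 'x) module" and aX and Y :: "('k, 'y) module" and aY
  assumes X: "left_module K H X aX" and Y: "left_module K H Y aY"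
begin

private lemmas alg_H = left_moduleD(1)[OF X]
private lemmas mH' = assoc_algebraD(2)[OF left_moduleD(1)[OF X]]
private lemmas mX' = left_moduleD(2)[OF X] and mY' = left_moduleD(2)[OF Y]
private lemmas T' = tensor_is_module[OF left_moduleD(2)[OF X] left_moduleD(2)[OF Y]]
private lemmas pure' = pure_tensor_bilinear[OF left_moduleD(2)[OF X] left_moduleD(2)[OF Y]]
private abbreviation (input) "HH' \<equiv> tensor K H H"

interpretation HH: monoid "tensor_algebra K H H"
  by (rule assoc_algebraD[OF tensor_algebra_is_algebra[OF alg_H alg_H]])

lemma tensor_act_pure:
  assumes "t \<in> carrier HH'" "x \<in> carrier X" "y \<in> carrier Y"
  shows "tensor_act K H X aX Y aY t (pure_tensor K X Y x y) =
    twist_map K H (tensor K X Y) aX aY t (pure_tensor K X Y) x y"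
  unfolding tensor_act_eq by (rule tensor_lift_pure[OF mX' mY' twist_map_bilinear[OF X Y T' pure'] T']) fact+

lemma tensor_act_bilinear: "bilinear_map K HH' (tensor K X Y) (tensor K X Y) (tensor_act K H X aX Y aY)"
proof (rule bilinear_mapI)
  fix t assume "t \<in> carrier HH'"
  then show "tensor_act K H X aX Y aY t \<in> linear_maps K (tensor K X Y) (tensor K X Y)"
    unfolding tensor_act_eq by (intro tensor_lift_linear[OF mX' mY'] twist_map_bilinear[OF X Y T' pure'] T')
next
  fix v assume v: "v \<in> carrier (tensor K X Y)"
  have mHH: "module K HH'" by (rule tensor_is_module[OF mH' mH'])
  show "(\<lambda>t. tensor_act K H X aX Y aY t v) \<in> linear_maps K HH' (tensor K X Y)"
    unfolding tensor_act_eq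
    by (rule tensor_lift_linear_param[OF mX' mY' twist_map_bilinear[OF X Y T' pure']
          twist_map_linear_tensor[OF X Y T' pure'] T' mHH v])
qed

lemma tensor_act_one:
  assumes "v \<in> carrier (tensor K X Y)"
  shows "tensor_act K H X aX Y aY \<one>\<^bsub>tensor_algebra K H H\<^esub> v = v"
proof -
  have one: "\<one>\<^bsub>tensor_algebra K H H\<^esub> \<in> carrier HH'" using HH.one_closed by simp
  show ?thesis
    by (rule tensor_eqI[OF mX' mY' bilinear_map_linear_right[OF tensor_act_bilinear one] linear_maps_id T' _ assms])
      (simp add: tensor_act_pure[OF one] twist_map_one[OF X Y T' pure'])
qed

text \<open>
  Acting on the tensor and then evaluating a bilinear map amounts to twisting that map.  The definitions
  of both kinds of twist have the form of the left-hand side.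
\<close>

lemma tensor_lift_tensor_act:
  assumes m: "bilinear_map K X Y W m" and W: "module K W"
    and "t \<in> carrier HH'" "x \<in> carrier X" "y \<in> carrier Y"
  shows "tensor_lift K X Y W m (tensor_act K H X aX Y aY t (pure_tensor K X Y x y)) =
    twist_map K H W aX aY t m x y"
proof -
  have "tensor_lift K X Y W m (tensor_act K H X aX Y aY t (pure_tensor K X Y x y)) =
      twist_map K H W aX aY t (\<lambda>x y. tensor_lift K X Y W m (pure_tensor K X Y x y)) x y"
    using assms by (simp add: tensor_act_pure
        twist_map_post[OF X Y T' pure' W tensor_lift_linear[OF mX' mY' m W]])
  also have "\<dots> = twist_map K H W aX aY t m x y"
    by (rule twist_map_cong[OF X Y assms(4,5)]) (simp add: tensor_lift_pure[OF mX' mY' m W])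
  finally show ?thesis .
qed

lemma tensor_act_mult:
  assumes s: "s \<in> carrier HH'" and t: "t \<in> carrier HH'" and v: "v \<in> carrier (tensor K X Y)"
  shows "tensor_act K H X aX Y aY (s \<otimes>\<^bsub>tensor_algebra K H H\<^esub> t) v =
    tensor_act K H X aX Y aY s (tensor_act K H X aX Y aY t v)"
proof -
  let ?a = "tensor_act K H X aX Y aY"
  have st: "s \<otimes>\<^bsub>tensor_algebra K H H\<^esub> t \<in> carrier HH'" using HH.m_closed s t by simp
  note lin = bilinear_map_linear_right[OF tensor_act_bilinear]
  show ?thesis
  proof (rule tensor_eqI[OF mX' mY' lin[OF st] linear_maps_comp[OF lin[OF t] lin[OF s]] T' _ v])
    fix x y assume xy: "x \<in> carrier X" "y \<in> carrier Y"
    have "?a s (?a t (pure_tensor K X Y x y)) =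
        twist_map K H (tensor K X Y) aX aY t (twist_map K H (tensor K X Y) aX aY s (pure_tensor K X Y)) x y"
      using tensor_lift_tensor_act[OF twist_map_bilinear[OF X Y T' pure' s] T' t xy] by (simp add: tensor_act_eq)
    then show "?a (s \<otimes>\<^bsub>tensor_algebra K H H\<^esub> t) (pure_tensor K X Y x y) = ?a s (?a t (pure_tensor K X Y x y))"
      using s t st xy by (simp add: tensor_act_pure twist_map_twist_map[OF X Y T' pure'])
  qed
qed

end

lemma giaquinto_zhang_twist_eq:
  assumes "left_module K H A hA" "left_module K H V hV" "bilinear_map K A V V aV"
    and "G \<in> carrier (tensor K H H)" "a \<in> carrier A" "v \<in> carrier V"
  shows "giaquinto_zhang_twist K H G A hA V hV aV a v = twist_map K H V hA hV G aV a v"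
  unfolding giaquinto_zhang_twist_def
  by (rule tensor_lift_tensor_act[OF assms(1,2,3) left_moduleD(2)[OF assms(2)] assms(4-)])

lemma drinfeld_twist_space [simp]:
  "carrier (drinfeld_twist K H G A hA) = carrier A" "add (drinfeld_twist K H G A hA) = add A"
  "zero (drinfeld_twist K H G A hA) = zero A" "smult (drinfeld_twist K H G A hA) = smult A"
  "one (drinfeld_twist K H G A hA) = one A"
  by (simp_all add: drinfeld_twist_def)

lemma drinfeld_twist_mult_eq:
  assumes "left_module K H A hA" "assoc_algebra K A"
    and "G \<in> carrier (tensor K H H)" "a \<in> carrier A" "b \<in> carrier A"
  shows "a \<otimes>\<^bsub>drinfeld_twist K H G A hA\<^esub> b = twist_map K H A hA hA G (mult A) a b"
  unfolding drinfeld_twist_def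
  using tensor_lift_tensor_act[OF assms(1,1) assoc_algebra_mult_bilinear[OF assms(2)] left_moduleD(2)[OF assms(1)] assms(3-)]
  by simp


section \<open>Cocycles\<close>

lemma tensor_map_tensor_algebra [simp]:
  "tensor_map K X Y (tensor_algebra K P Q) Z f g = tensor_map K X Y (tensor K P Q) Z f g"
  "tensor_map K X Y Z (tensor_algebra K P Q) f' g' = tensor_map K X Y Z (tensor K P Q) f' g'"
  by (simp_all add: tensor_map_def)

context hopf_algebra
begin

lemma H_algebra: "assoc_algebra K H" by unfold_locales

lemmas mH = assoc_algebraD(2)[OF H_algebra]
lemmas HH_algebra = tensor_algebra_is_algebra[OF H_algebra H_algebra]
lemmas HHH_algebra = tensor_algebra_is_algebra[OF tensor_algebra_is_algebra[OF H_algebra H_algebra] H_algebra]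
lemmas H_HH_algebra = tensor_algebra_is_algebra[OF H_algebra tensor_algebra_is_algebra[OF H_algebra H_algebra]]
abbreviation (input) "HH \<equiv> tensor K H H"
abbreviation (input) "HHH \<equiv> tensor_algebra K (tensor_algebra K H H) H"
abbreviation (input) "\<Delta>_id \<equiv> tensor_map K H H (tensor K H H) H \<Delta> (\<lambda>x. x)"
abbreviation (input) "id_\<Delta> \<equiv> tensor_map K H H H (tensor K H H) (\<lambda>x. x) \<Delta>"
abbreviation (input) "\<alpha> \<equiv> tensor_assoc K H H H"

lemma one_in_H: "\<one>\<^bsub>H\<^esub> \<in> carrier H"
  by (rule monoid.one_closed[OF assoc_algebraD(5)[OF H_algebra]])

lemma comult_closed: "h \<in> carrier H \<Longrightarrow> \<Delta> h \<in> carrier HH"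
  by (rule linear_maps_closed[OF comult_linear])

lemma comult_algebra_hom: "algebra_hom K H (tensor_algebra K H H) \<Delta>"
  using comult_linear comult_hom by (simp add: algebra_hom_def)

lemma id_algebra_hom: "algebra_hom K H H (\<lambda>x. x)"
  by (simp add: algebra_hom_def linear_maps_id ring_hom_def)

lemma comult_id_hom: "algebra_hom K (tensor_algebra K H H) HHH \<Delta>_id"
  using algebra_hom_tensor_map[OF H_algebra H_algebra HH_algebra H_algebra comult_algebra_hom id_algebra_hom]
  by simp

lemma id_comult_hom:
  "algebra_hom K (tensor_algebra K H H) (tensor_algebra K H (tensor_algebra K H H)) id_\<Delta>"
  using algebra_hom_tensor_map[OF H_algebra H_algebra H_algebra HH_algebra id_algebra_hom comult_algebra_hom]
  by simp

lemma assoc_hom: "algebra_hom K (tensor_algebra K H (tensor_algebra K H H)) HHH \<alpha>"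
  by (rule algebra_hom_tensor_assoc[OF H_algebra H_algebra H_algebra])

text \<open>The identity that a pair of tensors must satisfy for the two ways of bracketing a twisted
  triple product to agree.\<close>

definition coassociative_pair :: "('h \<times> 'h \<Rightarrow> 'k) set \<Rightarrow> ('h \<times> 'h \<Rightarrow> 'k) set \<Rightarrow> bool" where
  "coassociative_pair s t \<longleftrightarrow> s \<in> carrier HH \<and> t \<in> carrier HH \<and>
    \<Delta>_id s \<otimes>\<^bsub>HHH\<^esub> pure_tensor K HH H t \<one>\<^bsub>H\<^esub> =
    \<alpha> (id_\<Delta> s \<otimes>\<^bsub>tensor_algebra K H (tensor_algebra K H H)\<^esub> pure_tensor K H HH \<one>\<^bsub>H\<^esub> t)"

text \<open>
  For \<open>t = 1\<close> the second factors are units and coassociativity remains.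
\<close>

lemma coassociative_pair_comult:
  assumes h: "h \<in> carrier H"
  shows "coassociative_pair (\<Delta> h) \<one>\<^bsub>tensor_algebra K H H\<^esub>"
proof -
  interpret HH: monoid "tensor_algebra K H H" by (rule assoc_algebraD[OF HH_algebra])
  interpret HHH: monoid HHH by (rule assoc_algebraD[OF HHH_algebra])
  interpret H_HH: monoid "tensor_algebra K H (tensor_algebra K H H)" by (rule assoc_algebraD[OF H_HH_algebra])
  have 1: "pure_tensor K HH H \<one>\<^bsub>tensor_algebra K H H\<^esub> \<one>\<^bsub>H\<^esub> = \<one>\<^bsub>HHH\<^esub>"
    "pure_tensor K H HH \<one>\<^bsub>H\<^esub> \<one>\<^bsub>tensor_algebra K H H\<^esub> = \<one>\<^bsub>tensor_algebra K H (tensor_algebra K H H)\<^esub>"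
    by (simp_all add: tensor_algebra_one[OF HH_algebra H_algebra] tensor_algebra_one[OF H_algebra HH_algebra])
  have "\<Delta>_id (\<Delta> h) \<in> carrier HHH" "id_\<Delta> (\<Delta> h) \<in> carrier (tensor_algebra K H (tensor_algebra K H H))"
    using comult_id_hom id_comult_hom comult_closed[OF h] by (auto simp: algebra_hom_def intro: linear_maps_closed)
  then show ?thesis
    using HHH.r_one H_HH.r_one HH.one_closed comult_closed[OF h] coassoc[OF h]
    by (simp add: coassociative_pair_def 1)
qed

lemma two_cocycleD:
  assumes F: "two_cocycle K H \<Delta> \<epsilon> F"
  defines "G \<equiv> inv\<^bsub>tensor_algebra K H H\<^esub> F"
  shows "F \<in> carrier HH" "G \<in> carrier HH"
    "F \<otimes>\<^bsub>tensor_algebra K H H\<^esub> G = \<one>\<^bsub>tensor_algebra K H H\<^esub>"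
    "G \<otimes>\<^bsub>tensor_algebra K H H\<^esub> F = \<one>\<^bsub>tensor_algebra K H H\<^esub>"
    "pure_tensor K HH H F \<one>\<^bsub>H\<^esub> \<otimes>\<^bsub>HHH\<^esub> \<Delta>_id F = \<alpha> (pure_tensor K H HH \<one>\<^bsub>H\<^esub> F) \<otimes>\<^bsub>HHH\<^esub> \<alpha> (id_\<Delta> F)"
    "tensor_lift K H H H (\<lambda>x y. \<epsilon> x \<odot>\<^bsub>H\<^esub> y) F = \<one>\<^bsub>H\<^esub>"
    "tensor_lift K H H H (\<lambda>x y. \<epsilon> y \<odot>\<^bsub>H\<^esub> x) F = \<one>\<^bsub>H\<^esub>"
proof -
  interpret HH: monoid "tensor_algebra K H H" by (rule assoc_algebraD[OF HH_algebra])
  have u: "F \<in> Units (tensor_algebra K H H)" using F by (simp add: two_cocycle_def Let_def)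
  show "F \<in> carrier HH" "G \<in> carrier HH"
    using HH.Units_closed[OF u] HH.Units_inv_closed[OF u] by (simp_all add: G_def)
  show "F \<otimes>\<^bsub>tensor_algebra K H H\<^esub> G = \<one>\<^bsub>tensor_algebra K H H\<^esub>"
    "G \<otimes>\<^bsub>tensor_algebra K H H\<^esub> F = \<one>\<^bsub>tensor_algebra K H H\<^esub>"
    using HH.Units_r_inv[OF u] HH.Units_l_inv[OF u] by (simp_all add: G_def)
qed (use F in \<open>simp_all add: two_cocycle_def Let_def\<close>)

text \<open>
  The cocycle identity reads \<open>a F \<cdot> b F = c F \<cdot> d F\<close>, where \<open>a\<close>, \<open>b\<close>, \<open>c\<close>, \<open>d\<close> are unital and
  multiplicative.  So \<open>b G \<cdot> a G\<close> is a left inverse and \<open>d G \<cdot> c G\<close> a right inverse of the same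
  element, whence they are equal.
\<close>

lemma coassociative_pair_inverse_cocycle:
  assumes F: "two_cocycle K H \<Delta> \<epsilon> F"
  defines "G \<equiv> inv\<^bsub>tensor_algebra K H H\<^esub> F"
  shows "coassociative_pair G G"
proof -
  interpret HHH: monoid HHH by (rule assoc_algebraD[OF HHH_algebra])
  note FD = two_cocycleD[OF F, folded G_def]
  let ?HH = "tensor_algebra K H H" and ?H_HH = "tensor_algebra K H (tensor_algebra K H H)"
  have D: "\<Delta>_id \<in> linear_maps K HH HHH" "\<Delta>_id \<in> ring_hom ?HH HHH"
    and D': "id_\<Delta> \<in> linear_maps K HH ?H_HH" "id_\<Delta> \<in> ring_hom ?HH ?H_HH"
    and A: "\<alpha> \<in> linear_maps K ?H_HH HHH" "\<alpha> \<in> ring_hom ?H_HH HHH"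
    using comult_id_hom id_comult_hom assoc_hom by (simp_all add: algebra_hom_def)
  define a b c d where "a = (\<lambda>s. pure_tensor K HH H s \<one>\<^bsub>H\<^esub>)" and "b = \<Delta>_id"
    and "c = (\<lambda>s. \<alpha> (pure_tensor K H HH \<one>\<^bsub>H\<^esub> s))" and "d = (\<lambda>s. \<alpha> (id_\<Delta> s))"
  have p1: "pure_tensor K H HH \<one>\<^bsub>H\<^esub> s \<in> carrier ?H_HH" if "s \<in> carrier HH" for s
    using bilinear_map_closed[OF pure_tensor_bilinear[OF mH tensor_is_module[OF mH mH]] one_in_H that] by simp
  have d1: "id_\<Delta> s \<in> carrier ?H_HH" if "s \<in> carrier HH" for s
    using linear_maps_closed[OF D'(1) that] .
  have closed: "a s \<in> carrier HHH" "b s \<in> carrier HHH" "c s \<in> carrier HHH" "d s \<in> carrier HHH"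
    if "s \<in> carrier HH" for s
    using bilinear_map_closed[OF pure_tensor_bilinear[OF tensor_is_module[OF mH mH] mH] that one_in_H]
      linear_maps_closed[OF D(1) that] linear_maps_closed[OF A(1) p1[OF that]] linear_maps_closed[OF A(1) d1[OF that]]
    by (simp_all add: a_def b_def c_def d_def)
  have H1: "\<one>\<^bsub>H\<^esub> \<otimes>\<^bsub>H\<^esub> \<one>\<^bsub>H\<^esub> = \<one>\<^bsub>H\<^esub>"
    by (rule monoid.l_one[OF assoc_algebraD(5)[OF H_algebra] one_in_H])
  have inverse: "a s \<otimes>\<^bsub>HHH\<^esub> a t = \<one>\<^bsub>HHH\<^esub>" "b s \<otimes>\<^bsub>HHH\<^esub> b t = \<one>\<^bsub>HHH\<^esub>"
      "c s \<otimes>\<^bsub>HHH\<^esub> c t = \<one>\<^bsub>HHH\<^esub>" "d s \<otimes>\<^bsub>HHH\<^esub> d t = \<one>\<^bsub>HHH\<^esub>"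
    if s: "s \<in> carrier HH" and t: "t \<in> carrier HH" and st: "s \<otimes>\<^bsub>?HH\<^esub> t = \<one>\<^bsub>?HH\<^esub>" for s t
  proof -
    show "a s \<otimes>\<^bsub>HHH\<^esub> a t = \<one>\<^bsub>HHH\<^esub>"
      using tensor_algebra_mult_pure[OF HH_algebra H_algebra, of s "\<one>\<^bsub>H\<^esub>" t "\<one>\<^bsub>H\<^esub>"] s t one_in_H
      by (simp add: a_def st H1 tensor_algebra_one[OF HH_algebra H_algebra])
    show "b s \<otimes>\<^bsub>HHH\<^esub> b t = \<one>\<^bsub>HHH\<^esub>"
      using ring_hom_mult[OF D(2), of s t] s t by (simp add: b_def st ring_hom_one[OF D(2)])
    have "pure_tensor K H HH \<one>\<^bsub>H\<^esub> s \<otimes>\<^bsub>?H_HH\<^esub> pure_tensor K H HH \<one>\<^bsub>H\<^esub> t = \<one>\<^bsub>?H_HH\<^esub>"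
      using tensor_algebra_mult_pure[OF H_algebra HH_algebra, of "\<one>\<^bsub>H\<^esub>" s "\<one>\<^bsub>H\<^esub>" t] s t one_in_H
      by (simp add: st H1 tensor_algebra_one[OF H_algebra HH_algebra])
    then show "c s \<otimes>\<^bsub>HHH\<^esub> c t = \<one>\<^bsub>HHH\<^esub>"
      using ring_hom_mult[OF A(2) p1[OF s] p1[OF t]] by (simp add: c_def ring_hom_one[OF A(2)])
    have "id_\<Delta> s \<otimes>\<^bsub>?H_HH\<^esub> id_\<Delta> t = \<one>\<^bsub>?H_HH\<^esub>"
      using ring_hom_mult[OF D'(2), of s t] s t by (simp add: st ring_hom_one[OF D'(2)])
    then show "d s \<otimes>\<^bsub>HHH\<^esub> d t = \<one>\<^bsub>HHH\<^esub>"
      using ring_hom_mult[OF A(2) d1[OF s] d1[OF t]] by (simp add: d_def ring_hom_one[OF A(2)])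
  qed
  note FG = inverse[OF FD(1,2,3)] and GF = inverse[OF FD(2,1,4)]
  note cF = closed[OF FD(1)] and cG = closed[OF FD(2)]
  have cocycle: "a F \<otimes>\<^bsub>HHH\<^esub> b F = c F \<otimes>\<^bsub>HHH\<^esub> d F"
    using FD(5) by (simp add: a_def b_def c_def d_def)
  have "(b G \<otimes>\<^bsub>HHH\<^esub> a G) \<otimes>\<^bsub>HHH\<^esub> (a F \<otimes>\<^bsub>HHH\<^esub> b F) = b G \<otimes>\<^bsub>HHH\<^esub> (a G \<otimes>\<^bsub>HHH\<^esub> a F) \<otimes>\<^bsub>HHH\<^esub> b F"
    using cF cG by (simp add: HHH.m_assoc del: tensor_algebra_space)
  also have "\<dots> = \<one>\<^bsub>HHH\<^esub>" using GF cG by (simp del: tensor_algebra_space)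
  finally have left: "(b G \<otimes>\<^bsub>HHH\<^esub> a G) \<otimes>\<^bsub>HHH\<^esub> (a F \<otimes>\<^bsub>HHH\<^esub> b F) = \<one>\<^bsub>HHH\<^esub>" .
  have "(c F \<otimes>\<^bsub>HHH\<^esub> d F) \<otimes>\<^bsub>HHH\<^esub> (d G \<otimes>\<^bsub>HHH\<^esub> c G) = c F \<otimes>\<^bsub>HHH\<^esub> (d F \<otimes>\<^bsub>HHH\<^esub> d G) \<otimes>\<^bsub>HHH\<^esub> c G"
    using cF cG by (simp add: HHH.m_assoc del: tensor_algebra_space)
  also have "\<dots> = \<one>\<^bsub>HHH\<^esub>" using FG cF by (simp del: tensor_algebra_space)
  finally have right: "(a F \<otimes>\<^bsub>HHH\<^esub> b F) \<otimes>\<^bsub>HHH\<^esub> (d G \<otimes>\<^bsub>HHH\<^esub> c G) = \<one>\<^bsub>HHH\<^esub>"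
    by (simp add: cocycle)
  have "b G \<otimes>\<^bsub>HHH\<^esub> a G = d G \<otimes>\<^bsub>HHH\<^esub> c G"
    by (rule HHH.inv_unique[OF left right]) (use cF cG in \<open>auto simp del: tensor_algebra_space\<close>)
  also have "\<dots> = \<alpha> (id_\<Delta> G \<otimes>\<^bsub>?H_HH\<^esub> pure_tensor K H HH \<one>\<^bsub>H\<^esub> G)"
    using ring_hom_mult[OF A(2) d1[OF FD(2)] p1[OF FD(2)]] by (simp add: d_def c_def)
  finally show ?thesis
    using FD(2) by (simp add: coassociative_pair_def a_def b_def)
qed

end


section \<open>Associativity of twisted products\<close>

context hopf_algebra
begin

text \<open>
  The compatibility condition for module algebras and for equivariant modules alike, with \<open>m\<close> the
  product or the action; \<open>K\<close>, \<open>H\<close> and \<open>\<Delta>\<close> are those of the surrounding Hopf algebra.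
\<close>

definition equivariant_map where
  "equivariant_map X aX Y aY P aP m \<longleftrightarrow> (\<forall>h\<in>carrier H. \<forall>x\<in>carrier X. \<forall>y\<in>carrier Y.
     aP h (m x y) = twist_map K H P aX aY (\<Delta> h) m x y)"

lemma equivariant_mapD:
  "equivariant_map X aX Y aY P aP m \<Longrightarrow> h \<in> carrier H \<Longrightarrow> x \<in> carrier X \<Longrightarrow> y \<in> carrier Y \<Longrightarrow>
    aP h (m x y) = twist_map K H P aX aY (\<Delta> h) m x y"
  by (simp add: equivariant_map_def)

text \<open>
  A twisted equivariant map need not be equivariant for \<open>\<Delta>\<close>: acting by \<open>h\<close> contributes the factor \<open>\<Delta> h\<close>
  on the left of \<open>t\<close>, since the original map is applied last.
\<close>

lemma equivariant_twist_map:
  assumes X: "left_module K H X aX" and Y: "left_module K H Y aY" and P: "left_module K H P aP"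
    and m: "bilinear_map K X Y P m" and eqv: "equivariant_map X aX Y aY P aP m"
    and t: "t \<in> carrier HH" and h: "h \<in> carrier H" and x: "x \<in> carrier X" and y: "y \<in> carrier Y"
  shows "aP h (twist_map K H P aX aY t m x y) =
    twist_map K H P aX aY (\<Delta> h \<otimes>\<^bsub>tensor_algebra K H H\<^esub> t) m x y"
proof -
  note mP = left_moduleD(2)[OF P]
  have "aP h (twist_map K H P aX aY t m x y) = twist_map K H P aX aY t (\<lambda>x y. aP h (m x y)) x y"
    by (rule twist_map_post[OF X Y mP m mP bilinear_map_linear_right[OF left_moduleD(3)[OF P] h] t x y])
  also have "\<dots> = twist_map K H P aX aY t (twist_map K H P aX aY (\<Delta> h) m) x y"
    by (rule twist_map_cong[OF X Y x y equivariant_mapD[OF eqv h]])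
  also have "\<dots> = twist_map K H P aX aY (\<Delta> h \<otimes>\<^bsub>tensor_algebra K H H\<^esub> t) m x y"
    by (rule twist_map_twist_map[OF X Y mP m t comult_closed[OF h] x y])
  finally show ?thesis .
qed

text \<open>
  Both sides are linear in \<open>s\<close>.  For \<open>s = h \<otimes> h'\<close> the left-hand side is
  \<open>m2 (h \<cdot> m1\<^sub>t x y) (h' z)\<close>, where \<open>m1\<^sub>t\<close> is twisted by \<open>t\<close>.  By equivariance \<open>h\<close> turns \<open>t\<close> into
  \<open>\<Delta> h \<cdot> t\<close>, so the whole is the value at \<open>(\<Delta> h \<cdot> t) \<otimes> h'\<close> of the linear map on \<open>H \<otimes> H \<otimes> H\<close> with
  \<open>a \<otimes> b \<otimes> c \<mapsto> m2 (m1 (a x) (b y)) (c z)\<close>.  The right-hand side is treated in the same way, and the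
  untwisted identity says that the two linear maps on the triple tensor product are the same.
\<close>

lemma twisted_associativity:
  assumes X: "left_module K H X aX" and Y: "left_module K H Y aY" and Z: "left_module K H Z aZ"
    and P: "left_module K H P aP" and Q: "left_module K H Q aQ" and W: "module K W"
    and m1: "bilinear_map K X Y P m1" and m2: "bilinear_map K P Z W m2"
    and m3: "bilinear_map K Y Z Q m3" and m4: "bilinear_map K X Q W m4"
    and e1: "equivariant_map X aX Y aY P aP m1" and e3: "equivariant_map Y aY Z aZ Q aQ m3"
    and assoc: "\<And>x y z. x \<in> carrier X \<Longrightarrow> y \<in> carrier Y \<Longrightarrow> z \<in> carrier Z \<Longrightarrow>
      m2 (m1 x y) z = m4 x (m3 y z)"
    and st: "coassociative_pair s t"
    and x: "x \<in> carrier X" and y: "y \<in> carrier Y" and z: "z \<in> carrier Z"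
  shows "twist_map K H W aP aZ s m2 (twist_map K H P aX aY t m1 x y) z =
    twist_map K H W aX aQ s m4 x (twist_map K H Q aY aZ t m3 y z)"
proof -
  have s: "s \<in> carrier HH" and t: "t \<in> carrier HH" using st by (simp_all add: coassociative_pair_def)
  let ?H_HH = "tensor_algebra K H (tensor_algebra K H H)"
  note mHH = tensor_is_module[OF mH mH]
  note mP = left_moduleD(2)[OF P] and mQ = left_moduleD(2)[OF Q]
  note bX = left_moduleD(3)[OF X] and bY = left_moduleD(3)[OF Y] and bZ = left_moduleD(3)[OF Z]
  \<comment> \<open>The two trilinear evaluations, curried to fit the two bracketings of \<open>H \<otimes> H \<otimes> H\<close>.\<close>
  define l where "l u c = m2 (twist_map K H P aX aY u m1 x y) (aZ c z)" for u c
  define r where "r c u = m4 (aX c x) (twist_map K H Q aY aZ u m3 y z)" for c u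
  have l: "bilinear_map K HH H W l" unfolding l_def
    by (rule bilinear_map_precomp[OF m2 twist_map_linear_tensor[OF X Y mP m1 x y] bilinear_map_linear_left[OF bZ z]])
  have r: "bilinear_map K H HH W r" unfolding r_def
    by (rule bilinear_map_precomp[OF m4 bilinear_map_linear_left[OF bX x] twist_map_linear_tensor[OF Y Z mQ m3 y z]])
  let ?L = "tensor_lift K HH H W l" and ?R = "tensor_lift K H HH W r"
  note L = tensor_lift_linear[OF mHH mH l W] and Lp = tensor_lift_pure[OF mHH mH l W]
  note R = tensor_lift_linear[OF mH mHH r W] and Rp = tensor_lift_pure[OF mH mHH r W]
  note HHH_mult = tensor_algebra_mult_bilinear[OF HH_algebra H_algebra, simplified]
  note H_HH_mult = tensor_algebra_mult_bilinear[OF H_algebra HH_algebra, simplified]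
  have D: "\<Delta>_id \<in> linear_maps K HH (tensor K HH H)" and D': "id_\<Delta> \<in> linear_maps K HH (tensor K H HH)"
    using comult_id_hom id_comult_hom by (simp_all add: algebra_hom_def)
  note Dp = tensor_map_pure[OF mH mH mHH mH comult_linear linear_maps_id]
  note D'p = tensor_map_pure[OF mH mH mH mHH linear_maps_id comult_linear]
  have t1: "pure_tensor K HH H t \<one>\<^bsub>H\<^esub> \<in> carrier (tensor K HH H)"
    by (rule bilinear_map_closed[OF pure_tensor_bilinear[OF mHH mH] t one_in_H])
  have t2: "pure_tensor K H HH \<one>\<^bsub>H\<^esub> t \<in> carrier (tensor K H HH)"
    by (rule bilinear_map_closed[OF pure_tensor_bilinear[OF mH mHH] one_in_H t])
  have H_one: "h \<otimes>\<^bsub>H\<^esub> \<one>\<^bsub>H\<^esub> = h" if "h \<in> carrier H" for h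
    by (rule monoid.r_one[OF assoc_algebraD(5)[OF H_algebra] that])
  note HHc = bilinear_map_closed[OF tensor_algebra_mult_bilinear[OF H_algebra H_algebra]]
  let ?p = "twist_map K H P aX aY t m1 x y" and ?q = "twist_map K H Q aY aZ t m3 y z"
  have p: "?p \<in> carrier P" by (rule bilinear_map_closed[OF twist_map_bilinear[OF X Y mP m1 t] x y])
  have q: "?q \<in> carrier Q" by (rule bilinear_map_closed[OF twist_map_bilinear[OF Y Z mQ m3 t] y z])
  have left: "twist_map K H W aP aZ s m2 ?p z = ?L (\<Delta>_id s \<otimes>\<^bsub>HHH\<^esub> pure_tensor K HH H t \<one>\<^bsub>H\<^esub>)"
  proof (rule tensor_eqI[OF mH mH twist_map_linear_tensor[OF P Z W m2 p z]
        linear_maps_comp[OF linear_maps_comp[OF D bilinear_map_linear_left[OF HHH_mult t1]] L] W _ s])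
    fix h h' assume h: "h \<in> carrier H" "h' \<in> carrier H"
    show "twist_map K H W aP aZ (pure_tensor K H H h h') m2 ?p z =
        ?L (\<Delta>_id (pure_tensor K H H h h') \<otimes>\<^bsub>HHH\<^esub> pure_tensor K HH H t \<one>\<^bsub>H\<^esub>)"
      using h t one_in_H tensor_algebra_mult_pure[OF HH_algebra H_algebra, of "\<Delta> h" h' t "\<one>\<^bsub>H\<^esub>"]
      by (simp add: twist_map_pure[OF P Z W m2 p z] Dp comult_closed H_one Lp HHc l_def
          equivariant_twist_map[OF X Y P m1 e1 t _ x y])
  qed
  have right: "twist_map K H W aX aQ s m4 x ?q = ?R (id_\<Delta> s \<otimes>\<^bsub>?H_HH\<^esub> pure_tensor K H HH \<one>\<^bsub>H\<^esub> t)"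
  proof (rule tensor_eqI[OF mH mH twist_map_linear_tensor[OF X Q W m4 x q]
        linear_maps_comp[OF linear_maps_comp[OF D' bilinear_map_linear_left[OF H_HH_mult t2]] R] W _ s])
    fix h h' assume h: "h \<in> carrier H" "h' \<in> carrier H"
    show "twist_map K H W aX aQ (pure_tensor K H H h h') m4 x ?q =
        ?R (id_\<Delta> (pure_tensor K H H h h') \<otimes>\<^bsub>?H_HH\<^esub> pure_tensor K H HH \<one>\<^bsub>H\<^esub> t)"
      using h t one_in_H tensor_algebra_mult_pure[OF H_algebra HH_algebra, of h "\<Delta> h'" "\<one>\<^bsub>H\<^esub>" t]
      by (simp add: twist_map_pure[OF X Q W m4 x q] D'p comult_closed H_one Rp HHc r_def
          equivariant_twist_map[OF Y Z Q m3 e3 t _ y z])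
  qed
  note A = tensor_assoc_linear[OF mH mH mH] and Ap = tensor_assoc_pure[OF mH mH mH]
  have middle: "?L (\<alpha> u) = ?R u" if u: "u \<in> carrier (tensor K H HH)" for u
  proof (rule tensor_eqI[OF mH mHH linear_maps_comp[OF A L] R W _ u])
    fix c v assume c: "c \<in> carrier H" and v: "v \<in> carrier HH"
    note pc = bilinear_map_linear_right[OF pure_tensor_bilinear[OF mH mHH] c]
    show "?L (\<alpha> (pure_tensor K H HH c v)) = ?R (pure_tensor K H HH c v)"
    proof (rule tensor_eqI[OF mH mH linear_maps_comp[OF pc linear_maps_comp[OF A L]]
          linear_maps_comp[OF pc R] W _ v])
      fix a b assume ab: "a \<in> carrier H" "b \<in> carrier H"
      note pcl = bilinear_map_closed[OF pure_tensor_bilinear[OF mH mH]]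
      show "?L (\<alpha> (pure_tensor K H HH c (pure_tensor K H H a b))) = ?R (pure_tensor K H HH c (pure_tensor K H H a b))"
        using ab c x y z bilinear_map_closed[OF bX] bilinear_map_closed[OF bY] bilinear_map_closed[OF bZ]
        by (simp add: Ap Lp Rp pcl l_def r_def twist_map_pure[OF X Y mP m1] twist_map_pure[OF Y Z mQ m3] assoc)
    qed
  qed
  have "id_\<Delta> s \<otimes>\<^bsub>?H_HH\<^esub> pure_tensor K H HH \<one>\<^bsub>H\<^esub> t \<in> carrier (tensor K H HH)"
    by (rule bilinear_map_closed[OF H_HH_mult linear_maps_closed[OF D' s] t2])
  then show ?thesis
    using st middle by (simp add: left right coassociative_pair_def)
qed

lemma counit_closed: "h \<in> carrier H \<Longrightarrow> \<epsilon> h \<in> carrier K"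
  by (rule ring_hom_closed[OF counit_hom])

lemma counit_add: "h \<in> carrier H \<Longrightarrow> h' \<in> carrier H \<Longrightarrow> \<epsilon> (h \<oplus>\<^bsub>H\<^esub> h') = \<epsilon> h \<oplus>\<^bsub>K\<^esub> \<epsilon> h'"
  by (rule ring_hom_add[OF counit_hom])

lemma counit_smult_bilinear:
  "bilinear_map K H H H (\<lambda>x y. \<epsilon> x \<odot>\<^bsub>H\<^esub> y)" "bilinear_map K H H H (\<lambda>x y. \<epsilon> y \<odot>\<^bsub>H\<^esub> x)"
proof -
  show "bilinear_map K H H H (\<lambda>x y. \<epsilon> x \<odot>\<^bsub>H\<^esub> y)" "bilinear_map K H H H (\<lambda>x y. \<epsilon> y \<odot>\<^bsub>H\<^esub> x)"
    by (intro bilinear_mapI linear_mapsI;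
      simp add: counit_closed counit_add counit_linear smult_l_distr smult_r_distr
        smult_assoc1[symmetric] m_comm)+
qed

context
  fixes X :: "('k, 'x) module" and aX and Y :: "('k, 'y) module" and aY and W :: "('k, 'w) module" and m F
  assumes X: "left_module K H X aX" and Y: "left_module K H Y aY" and W: "module K W"
    and m: "bilinear_map K X Y W m" and F: "two_cocycle K H \<Delta> \<epsilon> F"
begin

text \<open>
  On an invariant element \<open>e\<close> the action of \<open>F\<close> reduces to that of \<open>(\<epsilon> \<otimes> id)(F) = 1\<close>, so twisting by
  \<open>F\<close> changes no value \<open>n e y\<close>.  Taking for \<open>n\<close> the map \<open>m\<close> twisted by \<open>G\<close>, whose twist by \<open>F\<close> is
  \<open>m\<close>, gives the same for \<open>G\<close>.  Hence units of module algebras stay units.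
\<close>

lemma twist_map_inverse_cocycle_left_invariant:
  assumes e: "e \<in> carrier X" "\<And>h. h \<in> carrier H \<Longrightarrow> aX h e = \<epsilon> h \<odot>\<^bsub>X\<^esub> e" and y: "y \<in> carrier Y"
  shows "twist_map K H W aX aY (inv\<^bsub>tensor_algebra K H H\<^esub> F) m e y = m e y"
proof -
  let ?G = "inv\<^bsub>tensor_algebra K H H\<^esub> F"
  note FD = two_cocycleD[OF F]
  note bY = left_moduleD(3)[OF Y]
  let ?n = "twist_map K H W aX aY ?G m"
  have n: "bilinear_map K X Y W ?n" by (rule twist_map_bilinear[OF X Y W m FD(2)])
  have p: "(\<lambda>u. ?n e (aY u y)) \<in> linear_maps K H W"
    by (rule linear_maps_comp[OF bilinear_map_linear_left[OF bY y] bilinear_map_linear_right[OF n e(1)]])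
  have "m e y = twist_map K H W aX aY F ?n e y"
    by (simp add: twist_map_twist_map[OF X Y W m FD(1,2) e(1) y] FD(4) twist_map_one[OF X Y W m e(1) y])
  also have "\<dots> = tensor_lift K H H W (\<lambda>h h'. ?n e (aY (\<epsilon> h \<odot>\<^bsub>H\<^esub> h') y)) F"
    unfolding twist_map_def[of K H W aX aY F]
    by (rule arg_cong[where f = "\<lambda>f. f F"], rule tensor_lift_cong)
      (use e y in \<open>simp add: counit_closed bilinear_map_rules[OF bY] bilinear_map_rules[OF n]\<close>)
  also have "\<dots> = ?n e (aY (tensor_lift K H H H (\<lambda>x y. \<epsilon> x \<odot>\<^bsub>H\<^esub> y) F) y)"
    by (rule tensor_lift_post[OF mH mH counit_smult_bilinear(1) mH W p FD(1), symmetric])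
  also have "\<dots> = ?n e y" by (simp add: FD(6) left_moduleD(4)[OF Y y])
  finally show ?thesis by simp
qed

lemma twist_map_inverse_cocycle_right_invariant:
  assumes e: "e \<in> carrier Y" "\<And>h. h \<in> carrier H \<Longrightarrow> aY h e = \<epsilon> h \<odot>\<^bsub>Y\<^esub> e" and x: "x \<in> carrier X"
  shows "twist_map K H W aX aY (inv\<^bsub>tensor_algebra K H H\<^esub> F) m x e = m x e"
proof -
  let ?G = "inv\<^bsub>tensor_algebra K H H\<^esub> F"
  note FD = two_cocycleD[OF F]
  note bX = left_moduleD(3)[OF X]
  let ?n = "twist_map K H W aX aY ?G m"
  have n: "bilinear_map K X Y W ?n" by (rule twist_map_bilinear[OF X Y W m FD(2)])
  have p: "(\<lambda>u. ?n (aX u x) e) \<in> linear_maps K H W"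
    by (rule linear_maps_comp[OF bilinear_map_linear_left[OF bX x] bilinear_map_linear_left[OF n e(1)]])
  have "m x e = twist_map K H W aX aY F ?n x e"
    by (simp add: twist_map_twist_map[OF X Y W m FD(1,2) x e(1)] FD(4) twist_map_one[OF X Y W m x e(1)])
  also have "\<dots> = tensor_lift K H H W (\<lambda>h h'. ?n (aX (\<epsilon> h' \<odot>\<^bsub>H\<^esub> h) x) e) F"
    unfolding twist_map_def[of K H W aX aY F]
    by (rule arg_cong[where f = "\<lambda>f. f F"], rule tensor_lift_cong)
      (use e x in \<open>simp add: counit_closed bilinear_map_rules[OF bX] bilinear_map_rules[OF n]\<close>)
  also have "\<dots> = ?n (aX (tensor_lift K H H H (\<lambda>x y. \<epsilon> y \<odot>\<^bsub>H\<^esub> x) F) x) e"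
    by (rule tensor_lift_post[OF mH mH counit_smult_bilinear(2) mH W p FD(1), symmetric])
  also have "\<dots> = ?n x e" by (simp add: FD(7) left_moduleD(4)[OF X x])
  finally show ?thesis by simp
qed

end

text \<open>
  The action of \<open>H \<otimes> H\<close> on \<open>X \<otimes> Y\<close>, pulled back along the algebra homomorphism \<open>\<Delta>\<close>.
\<close>

lemma diagonal_left_module:
  assumes X: "left_module K H X aX" and Y: "left_module K H Y aY"
  shows "left_module K H (tensor K X Y) (diagonal_act K H \<Delta> X aX Y aY)"
proof (rule left_moduleI[OF H_algebra tensor_is_module[OF left_moduleD(2)[OF X] left_moduleD(2)[OF Y]]])
  show "bilinear_map K H (tensor K X Y) (tensor K X Y) (diagonal_act K H \<Delta> X aX Y aY)"
    unfolding diagonal_act_def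
    by (rule bilinear_map_precomp[OF tensor_act_bilinear[OF X Y] comult_linear linear_maps_id])
  show "diagonal_act K H \<Delta> X aX Y aY \<one>\<^bsub>H\<^esub> v = v" if "v \<in> carrier (tensor K X Y)" for v
    using ring_hom_one[OF comult_hom] tensor_act_one[OF X Y that] by (simp add: diagonal_act_def)
  show "diagonal_act K H \<Delta> X aX Y aY (r \<otimes>\<^bsub>H\<^esub> s) v =
      diagonal_act K H \<Delta> X aX Y aY r (diagonal_act K H \<Delta> X aX Y aY s v)"
    if "r \<in> carrier H" "s \<in> carrier H" "v \<in> carrier (tensor K X Y)" for r s v
    using that ring_hom_mult[OF comult_hom] tensor_act_mult[OF X Y comult_closed comult_closed]
    by (simp add: diagonal_act_def)
qed

end


section \<open>Induced modules\<close>

text \<open>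
  The induced module is identified with \<open>A \<otimes> V\<close> by a bijection, along which actions are transported in
  both directions.
\<close>

lemma left_module_transport:
  assumes W: "left_module K R W aW" and V: "module K V"
    and f: "f \<in> linear_maps K V W" and bij: "bij_betw f (carrier V) (carrier W)"
    and act: "\<And>r v. r \<in> carrier R \<Longrightarrow> v \<in> carrier V \<Longrightarrow> aV r v = inv_into (carrier V) f (aW r (f v))"
  shows "left_module K R V aV"
proof -
  let ?g = "inv_into (carrier V) f"
  note bW = left_moduleD(3)[OF W]
  have g: "?g \<in> linear_maps K W V" by (rule linear_maps_inv_into[OF f bij V])
  have gf: "?g (f v) = v" if "v \<in> carrier V" for v
    using bij that by (simp add: bij_betw_inv_into_left)
  have fg: "f (?g w) = w" if "w \<in> carrier W" for w
    using bij that by (simp add: bij_betw_inv_into_right)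
  note closed = linear_maps_closed[OF f] linear_maps_closed[OF g] bilinear_map_closed[OF bW]
  note mR = assoc_algebraD(2)[OF left_moduleD(1)[OF W]]
  interpret R: ring R by (rule assoc_algebraD[OF left_moduleD(1)[OF W]])
  show ?thesis
  proof (rule left_moduleI[OF left_moduleD(1)[OF W] V])
    have "bilinear_map K R V V (\<lambda>r v. ?g (aW r (f v)))"
      by (rule bilinear_map_comp[OF bilinear_map_precomp[OF bW linear_maps_id f] g])
    then show "bilinear_map K R V V aV"
      by (rule bilinear_map_cong[OF _ mR V]) (simp add: act)
  qed (simp_all add: act gf fg closed left_moduleD(4,5)[OF W])
qed

context
  fixes K :: "'k ring" and C B :: "('k, 'c) module" and V :: "('k, 'v) module" and bV :: "'c \<Rightarrow> 'v \<Rightarrow> 'v"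
  assumes C: "assoc_algebra K C" and V: "module K V" and B: "carrier B \<subseteq> carrier C"
    and bV_Ball: "\<forall>b\<in>carrier B. \<forall>v\<in>carrier V. bV b v \<in> carrier V"
begin

private lemma bV: "b \<in> carrier B \<Longrightarrow> v \<in> carrier V \<Longrightarrow> bV b v \<in> carrier V"
  using bV_Ball by blast

interpretation C: ring C by (rule assoc_algebraD[OF C])

private lemmas mC = assoc_algebraD(2)[OF C]
private lemmas T = tensor_is_module[OF assoc_algebraD(2)[OF C] V]
private lemmas CV_pure = pure_tensor_bilinear[OF assoc_algebraD(2)[OF C] V]
private lemmas CV_pure_closed = bilinear_map_closed[OF pure_tensor_bilinear[OF assoc_algebraD(2)[OF C] V]]
private abbreviation (input) "CV \<equiv> tensor K C V"
private abbreviation (input) "gens \<equiv> {pure_tensor K C V (c \<otimes>\<^bsub>C\<^esub> b) v \<ominus>\<^bsub>CV\<^esub> pure_tensor K C V c (bV b v) | c b v.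
        c \<in> carrier C \<and> b \<in> carrier B \<and> v \<in> carrier V}"

interpretation T: module K CV by (rule T)

private lemma gens_closed: "gens \<subseteq> carrier CV"
proof -
  have "pure_tensor K C V (c \<otimes>\<^bsub>C\<^esub> b) v \<ominus>\<^bsub>CV\<^esub> pure_tensor K C V c (bV b v) \<in> carrier CV"
    if "c \<in> carrier C" "b \<in> carrier B" "v \<in> carrier V" for c b v
    using that B bV by (intro T.M.minus_closed CV_pure_closed C.m_closed) auto
  then show ?thesis by auto
qed

private lemma balancing_submodule: "submodule (balancing_relations K C B V bV) K CV"
  unfolding balancing_relations_def by (rule submodule_span[OF T gens_closed])

lemma Ind_is_module: "module K (Ind K C B V bV)"
  unfolding Ind_def by (rule quotient_module_is_module[OF T balancing_submodule])

private lemmas quotient = quotient_map_linear[OF T balancing_submodule, folded Ind_def]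

lemma Ind_tensor_bilinear: "bilinear_map K C V (Ind K C B V bV) (Ind_tensor K C B V bV)"
  using bilinear_map_comp[OF CV_pure quotient] by (simp add: Ind_tensor_def[abs_def])

lemma Ind_tensor_balanced:
  assumes "c \<in> carrier C" "b \<in> carrier B" "v \<in> carrier V"
  shows "Ind_tensor K C B V bV (c \<otimes>\<^bsub>C\<^esub> b) v = Ind_tensor K C B V bV c (bV b v)"
  unfolding Ind_tensor_def
proof (rule coset_eq_iff[OF T balancing_submodule, THEN iffD2])
  show "pure_tensor K C V (c \<otimes>\<^bsub>C\<^esub> b) v \<ominus>\<^bsub>CV\<^esub> pure_tensor K C V c (bV b v) \<in> balancing_relations K C B V bV"
    unfolding balancing_relations_def by (rule submodule_span_inc) (use assms in blast)
qed (use assms B bV in \<open>auto intro!: CV_pure_closed\<close>)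

text \<open>
  \<open>C \<otimes>\<^sub>B V\<close> is a quotient of \<open>C \<otimes> V\<close>, so its elements are sums of the \<open>c \<otimes>\<^sub>B v\<close>.
\<close>

lemma Ind_eqI:
  assumes f: "f \<in> linear_maps K (Ind K C B V bV) W" and g: "g \<in> linear_maps K (Ind K C B V bV) W"
    and W: "module K W"
    and eq: "\<And>c v. c \<in> carrier C \<Longrightarrow> v \<in> carrier V \<Longrightarrow>
      f (Ind_tensor K C B V bV c v) = g (Ind_tensor K C B V bV c v)"
    and z: "z \<in> carrier (Ind K C B V bV)"
  shows "f z = g z"
proof -
  obtain t where t: "t \<in> carrier CV" "z = balancing_relations K C B V bV +>\<^bsub>CV\<^esub> t"
    using z quotient_module_carrier[OF T balancing_submodule] unfolding Ind_def by auto
  have "f (balancing_relations K C B V bV +>\<^bsub>CV\<^esub> t) = g (balancing_relations K C B V bV +>\<^bsub>CV\<^esub> t)"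
    by (rule tensor_eqI[OF mC V linear_maps_comp[OF quotient f] linear_maps_comp[OF quotient g] W _ t(1)])
      (use eq in \<open>simp add: Ind_tensor_def\<close>)
  then show ?thesis using t by simp
qed

lemma Ind_lift_ex:
  assumes f: "bilinear_map K C V W f" and W: "module K W"
    and balanced: "\<And>c b v. c \<in> carrier C \<Longrightarrow> b \<in> carrier B \<Longrightarrow> v \<in> carrier V \<Longrightarrow>
      f (c \<otimes>\<^bsub>C\<^esub> b) v = f c (bV b v)"
  shows "\<exists>g. g \<in> linear_maps K (Ind K C B V bV) W \<and>
    (\<forall>c\<in>carrier C. \<forall>v\<in>carrier V. g (Ind_tensor K C B V bV c v) = f c v)"
proof -
  interpret W: module K W by (rule W)
  note l = tensor_lift_linear[OF mC V f W] and lp = tensor_lift_pure[OF mC V f W]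
  have "tensor_lift K C V W f n = \<zero>\<^bsub>W\<^esub>" if "n \<in> balancing_relations K C B V bV" for n
  proof (rule linear_maps_zero_on_span[OF T W l gens_closed _ that[unfolded balancing_relations_def]])
    fix r assume "r \<in> gens"
    then obtain c b v where r: "r = pure_tensor K C V (c \<otimes>\<^bsub>C\<^esub> b) v \<ominus>\<^bsub>CV\<^esub> pure_tensor K C V c (bV b v)"
      and cbv: "c \<in> carrier C" "b \<in> carrier B" "v \<in> carrier V" by auto
    have "b \<in> carrier C" using cbv B by auto
    then have "tensor_lift K C V W f r = f (c \<otimes>\<^bsub>C\<^esub> b) v \<ominus>\<^bsub>W\<^esub> f c (bV b v)"
      unfolding r using cbv bV by (simp add: linear_maps_minus[OF l T W] CV_pure_closed lp)
    then show "tensor_lift K C V W f r = \<zero>\<^bsub>W\<^esub>"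
      using cbv bV balanced bilinear_map_closed[OF f] by (simp add: a_minus_def W.M.r_neg)
  qed
  from quotient_lift_ex[OF T balancing_submodule l W this]
  obtain g where "g \<in> linear_maps K (Ind K C B V bV) W"
    "\<forall>t\<in>carrier CV. g (balancing_relations K C B V bV +>\<^bsub>CV\<^esub> t) = tensor_lift K C V W f t"
    unfolding Ind_def by blast
  then show ?thesis
    by (intro exI[of _ g]) (simp add: Ind_tensor_def CV_pure_closed lp)
qed

private lemma act_ex:
  assumes c: "c \<in> carrier C"
  shows "\<exists>g. g \<in> linear_maps K (Ind K C B V bV) (Ind K C B V bV) \<and>
        (\<forall>c'\<in>carrier C. \<forall>v\<in>carrier V.
           g (Ind_tensor K C B V bV c' v) = Ind_tensor K C B V bV (c \<otimes>\<^bsub>C\<^esub> c') v)"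
proof (rule Ind_lift_ex[OF _ Ind_is_module])
  show "bilinear_map K C V (Ind K C B V bV) (\<lambda>c' v. Ind_tensor K C B V bV (c \<otimes>\<^bsub>C\<^esub> c') v)"
    by (rule bilinear_map_precomp[OF Ind_tensor_bilinear
          bilinear_map_linear_right[OF assoc_algebra_mult_bilinear[OF C] c] linear_maps_id])
  fix c' b v assume "c' \<in> carrier C" "b \<in> carrier B" "v \<in> carrier V"
  moreover from this B have "b \<in> carrier C" by auto
  ultimately show "Ind_tensor K C B V bV (c \<otimes>\<^bsub>C\<^esub> (c' \<otimes>\<^bsub>C\<^esub> b)) v = Ind_tensor K C B V bV (c \<otimes>\<^bsub>C\<^esub> c') (bV b v)"
    using c by (simp add: C.m_assoc[symmetric] Ind_tensor_balanced)
qed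

lemma Ind_act_linear:
  "c \<in> carrier C \<Longrightarrow> Ind_act K C B V bV c \<in> linear_maps K (Ind K C B V bV) (Ind K C B V bV)"
  unfolding Ind_act_def using someI_ex[OF act_ex] by blast

lemma Ind_act_tensor:
  "c \<in> carrier C \<Longrightarrow> c' \<in> carrier C \<Longrightarrow> v \<in> carrier V \<Longrightarrow>
    Ind_act K C B V bV c (Ind_tensor K C B V bV c' v) = Ind_tensor K C B V bV (c \<otimes>\<^bsub>C\<^esub> c') v"
  unfolding Ind_act_def using someI_ex[OF act_ex] by blast

lemma Ind_left_module: "left_module K C (Ind K C B V bV) (Ind_act K C B V bV)"
proof (rule left_moduleI[OF C Ind_is_module])
  let ?I = "Ind K C B V bV" and ?a = "Ind_act K C B V bV" and ?t = "Ind_tensor K C B V bV"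
  note a = Ind_act_linear and at = Ind_act_tensor and t = Ind_tensor_bilinear
  note ac = linear_maps_closed[OF a]
  show "bilinear_map K C ?I ?I ?a"
  proof (rule bilinear_mapI[OF a], assumption, rule linear_mapsI)
    fix z assume z: "z \<in> carrier ?I"
    show "?a x z \<in> carrier ?I" if "x \<in> carrier C" for x by (rule ac[OF that z])
    show "?a (x \<oplus>\<^bsub>C\<^esub> y) z = ?a x z \<oplus>\<^bsub>?I\<^esub> ?a y z" if "x \<in> carrier C" "y \<in> carrier C" for x y
      by (rule Ind_eqI[OF a linear_maps_pointwise_add[OF a a Ind_is_module] Ind_is_module _ z])
        (use that in \<open>simp_all add: at C.l_distr bilinear_map_rules[OF t]\<close>)
    show "?a (k \<odot>\<^bsub>C\<^esub> x) z = k \<odot>\<^bsub>?I\<^esub> ?a x z" if "k \<in> carrier K" "x \<in> carrier C" for k x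
      by (rule Ind_eqI[OF a linear_maps_pointwise_smult[OF a _ Ind_is_module] Ind_is_module _ z])
        (use that module.smult_closed[OF mC] in \<open>simp_all add: at assoc_algebra.smult_mult_left[OF C] bilinear_map_rules[OF t]\<close>)
  qed
  show "?a \<one>\<^bsub>C\<^esub> z = z" if "z \<in> carrier ?I" for z
    by (rule Ind_eqI[OF a linear_maps_id Ind_is_module _ that]) (simp_all add: at)
  show "?a (r \<otimes>\<^bsub>C\<^esub> s) z = ?a r (?a s z)" if "r \<in> carrier C" "s \<in> carrier C" "z \<in> carrier ?I" for r s z
    by (rule Ind_eqI[OF a linear_maps_comp[OF a a] Ind_is_module _ that(3)])
      (use that in \<open>simp_all add: at C.m_assoc\<close>)
qed

end


section \<open>Induction along a factorisation\<close>

lemma submodule_inclusion_linear: "submodule A K C \<Longrightarrow> module K C \<Longrightarrow> (\<lambda>x. x) \<in> linear_maps K (C\<lparr>carrier := A\<rparr>) C"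
  using module.submoduleE(1)[of K C A] by (intro linear_mapsI) auto

context
  fixes K :: "'k ring" and C :: "('k, 'c) module" and A B :: "'c set"
    and V :: "('k, 'v) module" and bV :: "'c \<Rightarrow> 'v \<Rightarrow> 'v"
  assumes fac: "algebra_factorisation K C A B"
    and bV: "left_module K (C\<lparr>carrier := B\<rparr>) V bV"
begin

private abbreviation (input) "A' \<equiv> C\<lparr>carrier := A\<rparr>"
private abbreviation (input) "B' \<equiv> C\<lparr>carrier := B\<rparr>"
private abbreviation (input) "\<mu> \<equiv> tensor_lift K A' B' C (mult C)"

private lemma C: "assoc_algebra K C" using fac by (simp add: algebra_factorisation_def)

interpretation C: ring C by (rule assoc_algebraD[OF C])

private lemmas mC' = assoc_algebraD(2)[OF C]
private lemmas V = left_moduleD(2)[OF bV]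

private lemma subs: "submodule A K C" "submodule B K C" "subring A C" "subring B C"
  using fac by (simp_all add: algebra_factorisation_def subalgebra_of_def)

private lemma mA: "module K A'" and mB: "module K B'"
  by (rule submodule.submodule_is_module[OF subs(1) mC'], rule submodule.submodule_is_module[OF subs(2) mC'])

private lemmas incl = submodule_inclusion_linear[OF subs(1) mC'] submodule_inclusion_linear[OF subs(2) mC']

private lemma AB: "a \<in> A \<Longrightarrow> a \<in> carrier C" "b \<in> B \<Longrightarrow> b \<in> carrier C"
  using linear_maps_closed[OF incl(1)] linear_maps_closed[OF incl(2)] by auto

private lemma mult_bilinear: "bilinear_map K A' B' C (mult C)"
  by (rule bilinear_map_precomp[OF assoc_algebra_mult_bilinear[OF C] incl])

private lemmas \<mu>_linear = tensor_lift_linear[OF mA mB mult_bilinear mC']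
private lemmas \<mu>_pure = tensor_lift_pure[OF mA mB mult_bilinear mC', simplified]

private lemma \<mu>_bij: "bij_betw \<mu> (carrier (tensor K A' B')) (carrier C)"
  using fac by (simp add: algebra_factorisation_def Let_def)

text \<open>
  The products \<open>ab\<close> span \<open>C\<close>, by surjectivity of the multiplication map.
\<close>

lemma factorisation_eqI:
  assumes f: "f \<in> linear_maps K C W" and g: "g \<in> linear_maps K C W" and W: "module K W"
    and eq: "\<And>a b. a \<in> A \<Longrightarrow> b \<in> B \<Longrightarrow> f (a \<otimes>\<^bsub>C\<^esub> b) = g (a \<otimes>\<^bsub>C\<^esub> b)" and c: "c \<in> carrier C"
  shows "f c = g c"
proof -
  obtain t where t: "t \<in> carrier (tensor K A' B')" "c = \<mu> t"
    using \<mu>_bij c by (auto simp: bij_betw_def)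
  have "f (\<mu> t) = g (\<mu> t)"
    by (rule tensor_eqI[OF mA mB linear_maps_comp[OF \<mu>_linear f] linear_maps_comp[OF \<mu>_linear g] W _ t(1)])
      (simp add: \<mu>_pure eq)
  then show ?thesis using t by simp
qed

private lemma B_sub: "carrier B' \<subseteq> carrier C"
  using AB by auto

private lemma bV_closed: "b \<in> carrier B' \<Longrightarrow> v \<in> carrier V \<Longrightarrow> bV b v \<in> carrier V"
  by (rule bilinear_map_closed[OF left_moduleD(3)[OF bV]])

private lemma bV_closed_all: "\<forall>b\<in>carrier B'. \<forall>v\<in>carrier V. bV b v \<in> carrier V"
  using bV_closed by blast

private abbreviation (input) "I \<equiv> Ind K C B' V bV"
private abbreviation (input) "AV \<equiv> tensor K A' V"
private abbreviation (input) "ident \<equiv> Ind_ident K C A' B' V bV"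

private lemmas I = Ind_is_module[OF C V B_sub bV_closed_all]
private lemmas I_tensor = Ind_tensor_bilinear[OF C V B_sub bV_closed_all]
private lemmas AV = tensor_is_module[OF mA V]

private lemma I_tensor_A: "bilinear_map K A' V I (Ind_tensor K C B' V bV)"
  by (rule bilinear_map_precomp[OF I_tensor incl(1) linear_maps_id])

lemma Ind_ident_linear: "ident \<in> linear_maps K AV I"
  unfolding Ind_ident_def by (rule tensor_lift_linear[OF mA V I_tensor_A I])

lemma Ind_ident_pure:
  "a \<in> A \<Longrightarrow> v \<in> carrier V \<Longrightarrow> ident (pure_tensor K A' V a v) = Ind_tensor K C B' V bV a v"
  unfolding Ind_ident_def by (rule tensor_lift_pure[OF mA V I_tensor_A I, simplified])

text \<open>
  The inverse sends \<open>ab \<otimes>\<^sub>B v\<close> to \<open>a \<otimes> bv\<close>.  It exists because the multiplication map can be inverted,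
  and it is balanced because \<open>(ab)b' = a(bb')\<close>.
\<close>

lemma Ind_ident_bij: "bij_betw ident (carrier AV) (carrier I)"
proof -
  define \<nu> where "\<nu> = inv_into (carrier (tensor K A' B')) \<mu>"
  have \<nu>: "\<nu> \<in> linear_maps K C (tensor K A' B')"
    unfolding \<nu>_def by (rule linear_maps_inv_into[OF \<mu>_linear \<mu>_bij tensor_is_module[OF mA mB]])
  note pAB = bilinear_map_closed[OF pure_tensor_bilinear[OF mA mB], simplified]
  have \<nu>_mult: "\<nu> (a \<otimes>\<^bsub>C\<^esub> b) = pure_tensor K A' B' a b" if "a \<in> A" "b \<in> B" for a b
    using bij_betw_inv_into_left[OF \<mu>_bij pAB[OF that]] that by (simp add: \<nu>_def \<mu>_pure)
  note pAV = pure_tensor_bilinear[OF mA V]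
  note bbV = left_moduleD(3)[OF bV]
  \<comment> \<open>The inverse map on \<open>C \<times> V\<close>: decompose \<open>c\<close> as \<open>\<Sum> ab\<close> and return \<open>\<Sum> a \<otimes> bv\<close>.\<close>
  define j where "j c v = tensor_lift K A' B' AV (\<lambda>a b. pure_tensor K A' V a (bV b v)) (\<nu> c)" for c v
  have arg: "bilinear_map K A' B' AV (\<lambda>a b. pure_tensor K A' V a (bV b v))" if "v \<in> carrier V" for v
    by (rule bilinear_map_precomp[OF pAV linear_maps_id bilinear_map_linear_left[OF bbV that]])
  have j_bilinear: "bilinear_map K C V AV j"
  proof (rule bilinear_mapI)
    fix c assume c: "c \<in> carrier C"
    have "(\<lambda>v. j c v) \<in> linear_maps K V AV" unfolding j_def
    proof (rule tensor_lift_linear_param[OF mA mB arg _ AV V linear_maps_closed[OF \<nu> c]])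
      fix a b assume ab: "a \<in> carrier A'" "b \<in> carrier B'"
      show "(\<lambda>v. pure_tensor K A' V a (bV b v)) \<in> linear_maps K V AV"
        by (rule linear_maps_comp[OF bilinear_map_linear_right[OF bbV ab(2)] bilinear_map_linear_right[OF pAV ab(1)]])
    qed
    then show "j c \<in> linear_maps K V AV" by simp
  next
    fix v assume v: "v \<in> carrier V"
    show "(\<lambda>c. j c v) \<in> linear_maps K C AV" unfolding j_def
      by (rule linear_maps_comp[OF \<nu> tensor_lift_linear[OF mA mB arg[OF v] AV]])
  qed
  have j_mult: "j (a \<otimes>\<^bsub>C\<^esub> b) v = pure_tensor K A' V a (bV b v)" if "a \<in> A" "b \<in> B" "v \<in> carrier V" for a b v
    using that tensor_lift_pure[OF mA mB arg AV] by (simp add: j_def \<nu>_mult)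
  have BB: "b \<otimes>\<^bsub>C\<^esub> b' \<in> B" if "b \<in> B" "b' \<in> B" for b b'
    using subringE(6)[OF subs(4)] that by blast
  have j_balanced: "j (c \<otimes>\<^bsub>C\<^esub> b') v = j c (bV b' v)"
    if c: "c \<in> carrier C" and b': "b' \<in> carrier B'" and v: "v \<in> carrier V" for c b' v
  proof (rule factorisation_eqI[OF linear_maps_comp[OF bilinear_map_linear_left[OF assoc_algebra_mult_bilinear[OF C]]
        bilinear_map_linear_left[OF j_bilinear v]] bilinear_map_linear_left[OF j_bilinear bV_closed[OF b' v]] AV _ c])
    show "b' \<in> carrier C" using b' AB by simp
    fix a b assume ab: "a \<in> A" "b \<in> B"
    then show "j (a \<otimes>\<^bsub>C\<^esub> b \<otimes>\<^bsub>C\<^esub> b') v = j (a \<otimes>\<^bsub>C\<^esub> b) (bV b' v)"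
      using b' v AB left_moduleD(5)[OF bV, of b b' v] bV_closed[OF b' v] by (simp add: C.m_assoc j_mult BB)
  qed
  obtain g where g: "g \<in> linear_maps K I AV"
    and gt: "\<And>c v. c \<in> carrier C \<Longrightarrow> v \<in> carrier V \<Longrightarrow> g (Ind_tensor K C B' V bV c v) = j c v"
    using Ind_lift_ex[OF C V B_sub bV_closed_all j_bilinear AV j_balanced] by blast
  have one_B: "\<one>\<^bsub>C\<^esub> \<in> B" by (rule subringE(3)[OF subs(4)])
  have g_ident: "g (ident t) = t" if t: "t \<in> carrier AV" for t
  proof (rule tensor_eqI[OF mA V linear_maps_comp[OF Ind_ident_linear g] linear_maps_id AV _ t])
    fix a v assume av: "a \<in> carrier A'" "v \<in> carrier V"
    \<comment> \<open>An element of \<open>A\<close> decomposes as \<open>a \<cdot> 1\<close>.\<close>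
    have "j (a \<otimes>\<^bsub>C\<^esub> \<one>\<^bsub>C\<^esub>) v = pure_tensor K A' V a (bV \<one>\<^bsub>B'\<^esub> v)"
      using av one_B by (simp add: j_mult)
    then show "g (ident (pure_tensor K A' V a v)) = pure_tensor K A' V a v"
      using av AB left_moduleD(4)[OF bV] by (simp add: Ind_ident_pure gt)
  qed
  have ident_g: "ident (g z) = z" if z: "z \<in> carrier I" for z
  proof (rule Ind_eqI[OF C V B_sub bV_closed_all linear_maps_comp[OF g Ind_ident_linear] linear_maps_id I _ z])
    fix c v assume c: "c \<in> carrier C" and v: "v \<in> carrier V"
    have "ident (j c v) = Ind_tensor K C B' V bV c v"
    proof (rule factorisation_eqI[OF linear_maps_comp[OF bilinear_map_linear_left[OF j_bilinear v] Ind_ident_linear]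
          bilinear_map_linear_left[OF I_tensor v] I _ c])
      fix a b assume "a \<in> A" "b \<in> B"
      then show "ident (j (a \<otimes>\<^bsub>C\<^esub> b) v) = Ind_tensor K C B' V bV (a \<otimes>\<^bsub>C\<^esub> b) v"
        using v AB bV_closed Ind_tensor_balanced[OF C V B_sub bV_closed_all, of a b v]
        by (simp add: j_mult Ind_ident_pure)
    qed
    then show "ident (g (Ind_tensor K C B' V bV c v)) = Ind_tensor K C B' V bV c v"
      using c v by (simp add: gt)
  qed
  show ?thesis
    by (rule bij_betw_byWitness[where f' = g])
      (use g_ident ident_g linear_maps_closed[OF g] linear_maps_closed[OF Ind_ident_linear] in auto)
qed

lemma Ind_act_factored_left_module: "left_module K C AV (Ind_act_factored K C A' B' V bV)"
  by (rule left_module_transport[OF Ind_left_module[OF C V B_sub bV_closed_all] AV Ind_ident_linear Ind_ident_bij])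
    (simp add: Ind_act_factored_def)

lemma Ind_ident_act_factored:
  assumes "c \<in> carrier C" "t \<in> carrier AV"
  shows "ident (Ind_act_factored K C A' B' V bV c t) = Ind_act K C B' V bV c (ident t)"
  unfolding Ind_act_factored_def
  by (rule bij_betw_inv_into_right[OF Ind_ident_bij
        linear_maps_closed[OF Ind_act_linear[OF C V B_sub bV_closed_all assms(1)] linear_maps_closed[OF Ind_ident_linear assms(2)]]])

end


section \<open>Twisting algebras and modules\<close>

lemma subalgebra_is_algebra:
  assumes C: "assoc_algebra K C" and A: "subalgebra_of K C A"
  shows "assoc_algebra K (C\<lparr>carrier := A\<rparr>)"
proof -
  interpret C: ring C by (rule assoc_algebraD[OF C])
  have sub: "subring A C" "submodule A K C" using A by (simp_all add: subalgebra_of_def)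
  have "a \<in> carrier C" if "a \<in> A" for a using subringE(1)[OF sub(1)] that by blast
  then show ?thesis
    by (intro assoc_algebra.intro assoc_algebra_axioms.intro assoc_algebraD(1)[OF C] C.subring_is_ring[OF sub(1)]
        submodule.submodule_is_module[OF sub(2) assoc_algebraD(2)[OF C]])
      (simp_all add: assoc_algebra.smult_mult_left[OF C] assoc_algebra.smult_mult_right[OF C])
qed

lemma left_module_cong_algebra:
  assumes "left_module K R V a" "assoc_algebra K R'"
    and "carrier R' = carrier R" "add R' = add R" "smult R' = smult R" "\<one>\<^bsub>R'\<^esub> = \<one>\<^bsub>R\<^esub>"
    and "\<And>r s. r \<in> carrier R \<Longrightarrow> s \<in> carrier R \<Longrightarrow> r \<otimes>\<^bsub>R'\<^esub> s = r \<otimes>\<^bsub>R\<^esub> s"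
  shows "left_module K R' V a"
proof (rule left_moduleI[OF assms(2) left_moduleD(2)[OF assms(1)]])
  show "bilinear_map K R' V V a"
    using left_moduleD(3)[OF assms(1)]
    by (simp add: bilinear_map_def assms(3) linear_maps_cong_space[OF assms(3-5) refl refl refl])
qed (simp_all add: assms(3,6,7) left_moduleD(4,5)[OF assms(1)])

lemma submodule_left_module:
  assumes C: "left_module K H C hC" and A: "submodule A K C"
    and stable: "\<forall>h\<in>carrier H. hC h ` A \<subseteq> A"
  shows "left_module K H (C\<lparr>carrier := A\<rparr>) hC"
proof -
  note mC = left_moduleD(2)[OF C] and bC = left_moduleD(3)[OF C]
  have AC: "a \<in> carrier C" if "a \<in> A" for a using module.submoduleE(1)[OF mC A] that by blast
  have closed: "hC h a \<in> A" if "h \<in> carrier H" "a \<in> A" for h a using stable that by blast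
  have "bilinear_map K H (C\<lparr>carrier := A\<rparr>) (C\<lparr>carrier := A\<rparr>) hC"
    by (intro bilinear_mapI linear_mapsI) (simp_all add: AC closed bilinear_map_rules[OF bC])
  then show ?thesis
    by (intro left_moduleI[OF left_moduleD(1)[OF C] submodule.submodule_is_module[OF A mC]])
      (simp_all add: AC left_moduleD(4,5)[OF C])
qed

text \<open>
  A twist of a map with values in a submodule takes values there, and it does not matter in which of
  the two modules the Sweedler sum is formed.
\<close>

lemma twist_map_submodule:
  assumes "left_module K H X aX" "left_module K H Y aY" "submodule A K C" "module K C"
    and "bilinear_map K X Y (C\<lparr>carrier := A\<rparr>) m" "t \<in> carrier (tensor K H H)" "x \<in> carrier X" "y \<in> carrier Y"
  shows "twist_map K H (C\<lparr>carrier := A\<rparr>) aX aY t m x y = twist_map K H C aX aY t m x y"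
  by (rule twist_map_post[OF assms(1,2) submodule.submodule_is_module[OF assms(3,4)] assms(5,4)
        submodule_inclusion_linear[OF assms(3,4)] assms(6-)])

context hopf_algebra
begin

lemma module_algebraD:
  assumes "module_algebra K H \<Delta> \<epsilon> C hC"
  shows "left_module K H C hC" "assoc_algebra K C" "equivariant_map C hC C hC C hC (mult C)"
    "\<And>h. h \<in> carrier H \<Longrightarrow> hC h \<one>\<^bsub>C\<^esub> = \<epsilon> h \<odot>\<^bsub>C\<^esub> \<one>\<^bsub>C\<^esub>"
  using assms
  by (simp_all add: module_algebra_def module_algebra_axioms_def equivariant_map_def twist_map_def)

lemma equivariant_moduleD:
  assumes "equivariant_module K H \<Delta> \<epsilon> C hC V hV aV"
  shows "module_algebra K H \<Delta> \<epsilon> C hC" "left_module K H V hV" "left_module K C V aV"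
    "equivariant_map C hC V hV V hV aV"
  using assms
  by (simp_all add: equivariant_module_def equivariant_module_axioms_def equivariant_map_def twist_map_def)

lemma equivariant_moduleI:
  assumes "module_algebra K H \<Delta> \<epsilon> C hC" "left_module K H V hV" "left_module K C V aV"
    "equivariant_map C hC V hV V hV aV"
  shows "equivariant_module K H \<Delta> \<epsilon> C hC V hV aV"
  using assms
  by (simp add: equivariant_module_def equivariant_module_axioms_def equivariant_map_def twist_map_def)

end

locale hopf_algebra_cocycle = hopf_algebra K H \<Delta> \<epsilon> S
  for K :: "'k ring" and H :: "('k, 'h) module"
    and \<Delta> :: "'h \<Rightarrow> ('h \<times> 'h \<Rightarrow> 'k) set" and \<epsilon> :: "'h \<Rightarrow> 'k" and S :: "'h \<Rightarrow> 'h" +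
  fixes F :: "('h \<times> 'h \<Rightarrow> 'k) set"
  assumes cocycle: "two_cocycle K H \<Delta> \<epsilon> F"
begin

abbreviation (input) G where "G \<equiv> inv\<^bsub>tensor_algebra K H H\<^esub> F"

lemmas F_closed = two_cocycleD(1)[OF cocycle]
lemmas G_closed = two_cocycleD(2)[OF cocycle]
lemmas GG = coassociative_pair_inverse_cocycle[OF cocycle]

lemma tensor_act_inverse_cocycle_bij:
  assumes X: "left_module K H X aX" and Y: "left_module K H Y aY"
  shows "bij_betw (tensor_act K H X aX Y aY G) (carrier (tensor K X Y)) (carrier (tensor K X Y))"
proof (rule bij_betw_byWitness[where f' = "tensor_act K H X aX Y aY F"])
  note closed = bilinear_map_closed[OF tensor_act_bilinear[OF X Y]]
  show "tensor_act K H X aX Y aY G ` carrier (tensor K X Y) \<subseteq> carrier (tensor K X Y)"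
    "tensor_act K H X aX Y aY F ` carrier (tensor K X Y) \<subseteq> carrier (tensor K X Y)"
    using closed G_closed F_closed by auto
  show "\<forall>t\<in>carrier (tensor K X Y). tensor_act K H X aX Y aY F (tensor_act K H X aX Y aY G t) = t"
    "\<forall>t\<in>carrier (tensor K X Y). tensor_act K H X aX Y aY G (tensor_act K H X aX Y aY F t) = t"
    by (simp_all add: tensor_act_mult[OF X Y, symmetric] G_closed F_closed
        two_cocycleD(3,4)[OF cocycle] tensor_act_one[OF X Y])
qed

lemma drinfeld_twist_mult:
  assumes "module_algebra K H \<Delta> \<epsilon> C hC" "a \<in> carrier C" "b \<in> carrier C"
  shows "a \<otimes>\<^bsub>drinfeld_twist K H G C hC\<^esub> b = twist_map K H C hC hC G (mult C) a b"
  by (rule drinfeld_twist_mult_eq[OF module_algebraD(1,2)[OF assms(1)] G_closed assms(2,3)])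

lemma drinfeld_twist_algebra:
  assumes C: "module_algebra K H \<Delta> \<epsilon> C hC"
  shows "assoc_algebra K (drinfeld_twist K H G C hC)"
proof -
  note hC = module_algebraD(1)[OF C] and C_alg = module_algebraD(2)[OF C]
  note mC = assoc_algebraD(2)[OF C_alg] and mult = assoc_algebra_mult_bilinear[OF C_alg]
  interpret C: ring C by (rule assoc_algebraD[OF C_alg])
  let ?C = "drinfeld_twist K H G C hC"
  have tw: "bilinear_map K C C C (twist_map K H C hC hC G (mult C))"
    by (rule twist_map_bilinear[OF hC hC mC mult G_closed])
  note tw_closed = bilinear_map_closed[OF tw]
  show ?thesis
  proof (rule assoc_algebraI)
    show "field K" by (rule assoc_algebraD[OF C_alg])
    show "module K ?C" by (rule module_cong_space[OF mC]) simp_all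
    have "bilinear_map K C C C (mult ?C)"
      by (rule bilinear_map_cong[OF tw mC mC]) (simp add: drinfeld_twist_mult[OF C])
    then show "bilinear_map K ?C ?C ?C (mult ?C)"
      by (simp add: bilinear_map_def linear_maps_cong_space[of ?C C])
    show "\<one>\<^bsub>?C\<^esub> \<in> carrier ?C" by simp
    show "\<one>\<^bsub>?C\<^esub> \<otimes>\<^bsub>?C\<^esub> x = x" if "x \<in> carrier ?C" for x
      using that twist_map_inverse_cocycle_left_invariant[OF hC hC mC mult cocycle _ module_algebraD(4)[OF C]]
      by (simp add: drinfeld_twist_mult[OF C])
    show "x \<otimes>\<^bsub>?C\<^esub> \<one>\<^bsub>?C\<^esub> = x" if "x \<in> carrier ?C" for x
      using that twist_map_inverse_cocycle_right_invariant[OF hC hC mC mult cocycle _ module_algebraD(4)[OF C]]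
      by (simp add: drinfeld_twist_mult[OF C])
    show "x \<otimes>\<^bsub>?C\<^esub> y \<otimes>\<^bsub>?C\<^esub> z = x \<otimes>\<^bsub>?C\<^esub> (y \<otimes>\<^bsub>?C\<^esub> z)"
      if "x \<in> carrier ?C" "y \<in> carrier ?C" "z \<in> carrier ?C" for x y z
      using that twisted_associativity[OF hC hC hC hC hC mC mult mult mult mult
          module_algebraD(3)[OF C] module_algebraD(3)[OF C] C.m_assoc GG]
      by (simp add: drinfeld_twist_mult[OF C] tw_closed)
  qed
qed

lemma giaquinto_zhang_twist_left_module:
  assumes V: "equivariant_module K H \<Delta> \<epsilon> C hC V hV aV"
  shows "left_module K (drinfeld_twist K H G C hC) V (giaquinto_zhang_twist K H G C hC V hV aV)"
proof -
  note C = equivariant_moduleD(1)[OF V] and hV = equivariant_moduleD(2)[OF V]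
    and aV = equivariant_moduleD(3)[OF V]
  note hC = module_algebraD(1)[OF C] and C_alg = module_algebraD(2)[OF C]
  note mC = assoc_algebraD(2)[OF C_alg] and mult = assoc_algebra_mult_bilinear[OF C_alg]
  note mV = left_moduleD(2)[OF aV] and bV = left_moduleD(3)[OF aV]
  interpret C: ring C by (rule assoc_algebraD[OF C_alg])
  let ?C = "drinfeld_twist K H G C hC" and ?a = "giaquinto_zhang_twist K H G C hC V hV aV"
  have a: "?a c v = twist_map K H V hC hV G aV c v" if "c \<in> carrier C" "v \<in> carrier V" for c v
    by (rule giaquinto_zhang_twist_eq[OF hC hV bV G_closed that])
  have tw: "bilinear_map K C V V (twist_map K H V hC hV G aV)"
    by (rule twist_map_bilinear[OF hC hV mV bV G_closed])
  note tw_closed = bilinear_map_closed[OF tw]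
    bilinear_map_closed[OF twist_map_bilinear[OF hC hC mC mult G_closed]]
  show ?thesis
  proof (rule left_moduleI[OF drinfeld_twist_algebra[OF C] mV])
    have "bilinear_map K C V V ?a"
      by (rule bilinear_map_cong[OF tw mC mV]) (simp add: a)
    then show "bilinear_map K ?C V V ?a"
      by (simp add: bilinear_map_def linear_maps_cong_space[of ?C C])
    show "?a \<one>\<^bsub>?C\<^esub> v = v" if "v \<in> carrier V" for v
      using that twist_map_inverse_cocycle_left_invariant[OF hC hV mV bV cocycle _ module_algebraD(4)[OF C]]
      by (simp add: a left_moduleD(4)[OF aV])
    show "?a (r \<otimes>\<^bsub>?C\<^esub> s) v = ?a r (?a s v)"
      if "r \<in> carrier ?C" "s \<in> carrier ?C" "v \<in> carrier V" for r s v
      using that twisted_associativity[OF hC hC hV hC hV mV mult bV bV bV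
          module_algebraD(3)[OF C] equivariant_moduleD(4)[OF V] left_moduleD(5)[OF aV] GG]
      by (simp add: a drinfeld_twist_mult[OF C] tw_closed)
  qed
qed

text \<open>
  Twisting a subalgebra and restricting the twisted product give records with different \<open>mult\<close> fields;
  these agree on the subalgebra, which is all that is needed to compare modules over them.
\<close>

lemma drinfeld_twist_subalgebra:
  assumes C: "module_algebra K H \<Delta> \<epsilon> C hC" and A: "subalgebra_of K C A"
    and stable: "\<forall>h\<in>carrier H. hC h ` A \<subseteq> A"
  shows "subalgebra_of K (drinfeld_twist K H G C hC) A"
    and "\<And>a b. a \<in> A \<Longrightarrow> b \<in> A \<Longrightarrow>
      a \<otimes>\<^bsub>drinfeld_twist K H G C hC\<^esub> b = a \<otimes>\<^bsub>drinfeld_twist K H G (C\<lparr>carrier := A\<rparr>) hC\<^esub> b"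
proof -
  let ?A = "C\<lparr>carrier := A\<rparr>" and ?C = "drinfeld_twist K H G C hC"
  note hC = module_algebraD(1)[OF C] and C_alg = module_algebraD(2)[OF C]
  note mC = assoc_algebraD(2)[OF C_alg]
  have sub: "subring A C" "submodule A K C" using A by (simp_all add: subalgebra_of_def)
  note hA = submodule_left_module[OF hC sub(2) stable]
  note A_alg = subalgebra_is_algebra[OF C_alg A]
  note mult_A = assoc_algebra_mult_bilinear[OF A_alg]
  have AC: "a \<in> carrier C" if "a \<in> A" for a using subringE(1)[OF sub(1)] that by blast
  have tw: "a \<otimes>\<^bsub>?C\<^esub> b = twist_map K H ?A hC hC G (mult ?A) a b" if "a \<in> A" "b \<in> A" for a b
    using that twist_map_submodule[OF hA hA sub(2) mC mult_A G_closed]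
    by (simp add: drinfeld_twist_mult[OF C] AC)
  then show "a \<otimes>\<^bsub>?C\<^esub> b = a \<otimes>\<^bsub>drinfeld_twist K H G ?A hC\<^esub> b" if "a \<in> A" "b \<in> A" for a b
    using that drinfeld_twist_mult_eq[OF hA A_alg G_closed] by simp
  interpret CF: ring ?C by (rule assoc_algebraD[OF drinfeld_twist_algebra[OF C]])
  have minus: "\<ominus>\<^bsub>?C\<^esub> a = \<ominus>\<^bsub>C\<^esub> a" for a by (simp add: a_inv_def m_inv_def)
  have "subring A ?C"
  proof (rule CF.subringI)
    show "a \<otimes>\<^bsub>?C\<^esub> b \<in> A" if "a \<in> A" "b \<in> A" for a b
      using that bilinear_map_closed[OF twist_map_bilinear[OF hA hA left_moduleD(2)[OF hA] mult_A G_closed], of a b]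
      by (simp add: tw)
  qed (use subringE[OF sub(1)] in \<open>auto simp: minus\<close>)
  moreover have "submodule A K ?C"
    by (rule module.submoduleI[OF assoc_algebraD(2)[OF drinfeld_twist_algebra[OF C]]])
      (use module.submoduleE[OF mC sub(2)] subringE(2)[OF sub(1)] in \<open>auto simp: minus\<close>)
  ultimately show "subalgebra_of K ?C A" by (simp add: subalgebra_of_def)
qed

text \<open>
  On \<open>A \<otimes> B\<close> the twisted multiplication map is the composite of the bijective action of \<open>G\<close> and the
  bijective original multiplication map.
\<close>

lemma drinfeld_twist_factorisation:
  assumes fac: "equivariant_algebra_factorisation K H \<Delta> \<epsilon> C hC A B"
  shows "algebra_factorisation K (drinfeld_twist K H G C hC) A B"
proof -
  have C: "module_algebra K H \<Delta> \<epsilon> C hC" and A: "subalgebra_of K C A" and B: "subalgebra_of K C B"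
    and stable: "\<forall>h\<in>carrier H. hC h ` A \<subseteq> A" "\<forall>h\<in>carrier H. hC h ` B \<subseteq> B"
    using fac by (simp_all add: equivariant_algebra_factorisation_def algebra_factorisation_def)
  let ?A = "C\<lparr>carrier := A\<rparr>" and ?B = "C\<lparr>carrier := B\<rparr>" and ?C = "drinfeld_twist K H G C hC"
  note hC = module_algebraD(1)[OF C] and C_alg = module_algebraD(2)[OF C]
  note mC = assoc_algebraD(2)[OF C_alg]
  have sub: "submodule A K C" "submodule B K C" using A B by (simp_all add: subalgebra_of_def)
  note hA = submodule_left_module[OF hC sub(1) stable(1)] and hB = submodule_left_module[OF hC sub(2) stable(2)]
  note mA = left_moduleD(2)[OF hA] and mB = left_moduleD(2)[OF hB]
  note incl = submodule_inclusion_linear[OF sub(1) mC] submodule_inclusion_linear[OF sub(2) mC]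
  have AC: "a \<in> A \<Longrightarrow> a \<in> carrier C" "b \<in> B \<Longrightarrow> b \<in> carrier C" for a b
    using linear_maps_closed[OF incl(1)] linear_maps_closed[OF incl(2)] by auto
  have mult: "bilinear_map K ?A ?B C (mult C)"
    by (rule bilinear_map_precomp[OF assoc_algebra_mult_bilinear[OF C_alg] incl])
  have mult_F: "bilinear_map K ?A ?B C (mult ?C)"
  proof -
    have "linear_maps K ?A ?C = linear_maps K ?A C" "linear_maps K ?B ?C = linear_maps K ?B C"
      by (rule linear_maps_cong_space; simp)+
    then show ?thesis
      using bilinear_map_precomp[OF assoc_algebra_mult_bilinear[OF drinfeld_twist_algebra[OF C]],
          of "\<lambda>x. x" ?A "\<lambda>x. x" ?B] incl
      by (simp add: bilinear_map_def)
  qed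
  let ?\<mu> = "tensor_lift K ?A ?B C (mult C)" and ?\<mu>F = "tensor_lift K ?A ?B C (mult ?C)"
  let ?act = "tensor_act K H ?A hC ?B hC G"
  have comp: "?\<mu>F t = (?\<mu> \<circ> ?act) t" if t: "t \<in> carrier (tensor K ?A ?B)" for t
  proof -
    have lin: "(\<lambda>t. ?\<mu> (?act t)) \<in> linear_maps K (tensor K ?A ?B) C"
      by (rule linear_maps_comp[OF bilinear_map_linear_right[OF tensor_act_bilinear[OF hA hB] G_closed]
            tensor_lift_linear[OF mA mB mult mC]])
    have "?\<mu> (?act t) = ?\<mu>F t"
    proof (rule tensor_lift_unique[OF mA mB mult_F mC lin _ t])
      fix a b assume ab: "a \<in> carrier ?A" "b \<in> carrier ?B"
      show "?\<mu> (?act (pure_tensor K ?A ?B a b)) = a \<otimes>\<^bsub>?C\<^esub> b"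
        using tensor_lift_tensor_act[OF hA hB mult mC G_closed ab] ab by (simp add: drinfeld_twist_mult[OF C] AC)
    qed
    then show ?thesis by simp
  qed
  have "bij_betw ?\<mu> (carrier (tensor K ?A ?B)) (carrier C)"
    using fac by (simp add: equivariant_algebra_factorisation_def algebra_factorisation_def Let_def)
  from bij_betw_trans[OF tensor_act_inverse_cocycle_bij[OF hA hB] this]
  have "bij_betw ?\<mu>F (carrier (tensor K ?A ?B)) (carrier C)"
    using bij_betw_cong[of "carrier (tensor K ?A ?B)" ?\<mu>F "?\<mu> \<circ> ?act", OF comp] by blast
  moreover have "tensor_lift K (?C\<lparr>carrier := A\<rparr>) (?C\<lparr>carrier := B\<rparr>) ?C = tensor_lift K ?A ?B C"
    by (rule tensor_lift_cong_space) simp_all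
  moreover have "tensor K (?C\<lparr>carrier := A\<rparr>) (?C\<lparr>carrier := B\<rparr>) = tensor K ?A ?B"
    by (rule tensor_cong_space) simp_all
  ultimately show ?thesis
    using drinfeld_twist_algebra[OF C] drinfeld_twist_subalgebra(1)[OF C A stable(1)]
      drinfeld_twist_subalgebra(1)[OF C B stable(2)]
    by (simp add: algebra_factorisation_def Let_def)
qed

end


section \<open>The twisted induced module\<close>

text \<open>
  The data of the theorem.  Names ending in \<open>F\<close> denote twisted objects; \<open>BF\<close> is the subset \<open>B\<close> of the
  twisted algebra, not the twist of the subalgebra \<open>B\<close>.
\<close>

locale equivariant_induction = hopf_algebra_cocycle K H \<Delta> \<epsilon> S F
  for K :: "'k ring" and H :: "('k, 'h) module"
    and \<Delta> :: "'h \<Rightarrow> ('h \<times> 'h \<Rightarrow> 'k) set" and \<epsilon> :: "'h \<Rightarrow> 'k" and S :: "'h \<Rightarrow> 'h"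
    and F :: "('h \<times> 'h \<Rightarrow> 'k) set" +
  fixes C :: "('k, 'c) module" and hC :: "'h \<Rightarrow> 'c \<Rightarrow> 'c" and A B :: "'c set"
    and V :: "('k, 'v) module" and hV :: "'h \<Rightarrow> 'v \<Rightarrow> 'v" and bV :: "'c \<Rightarrow> 'v \<Rightarrow> 'v"
  assumes factorisation: "equivariant_algebra_factorisation K H \<Delta> \<epsilon> C hC A B"
    and V_equivariant: "equivariant_module K H \<Delta> \<epsilon> (C\<lparr>carrier := B\<rparr>) hC V hV bV"
begin

abbreviation (input) "A' \<equiv> C\<lparr>carrier := A\<rparr>"
abbreviation (input) "B' \<equiv> C\<lparr>carrier := B\<rparr>"
abbreviation (input) "AV \<equiv> tensor K A' V"
abbreviation (input) "I \<equiv> Ind K C B' V bV"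
abbreviation (input) "ind \<equiv> Ind_tensor K C B' V bV"
abbreviation (input) "act \<equiv> Ind_act K C B' V bV"
abbreviation (input) "ident \<equiv> Ind_ident K C A' B' V bV"
abbreviation (input) "diag \<equiv> diagonal_act K H \<Delta> A' hC V hV"
abbreviation (input) "hI \<equiv> Ind_hopf_act K H \<Delta> C hC A' B' V hV bV"

lemma C: "module_algebra K H \<Delta> \<epsilon> C hC"
  and fac: "algebra_factorisation K C A B"
  and A_sub: "subalgebra_of K C A" and B_sub: "subalgebra_of K C B"
  and stable: "\<forall>h\<in>carrier H. hC h ` A \<subseteq> A" "\<forall>h\<in>carrier H. hC h ` B \<subseteq> B"
  using factorisation by (simp_all add: equivariant_algebra_factorisation_def algebra_factorisation_def)

lemmas hC = module_algebraD(1)[OF C] and C_algebra = module_algebraD(2)[OF C]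
  and C_equivariant = module_algebraD(3)[OF C]
lemmas mC = assoc_algebraD(2)[OF module_algebraD(2)[OF C]]
lemmas mult_C = assoc_algebra_mult_bilinear[OF module_algebraD(2)[OF C]]
lemmas hV = equivariant_moduleD(2)[OF V_equivariant]
  and bV = equivariant_moduleD(3)[OF V_equivariant] and bV_equivariant = equivariant_moduleD(4)[OF V_equivariant]
lemmas hB = module_algebraD(1)[OF equivariant_moduleD(1)[OF V_equivariant]]
lemmas mV = left_moduleD(2)[OF equivariant_moduleD(2)[OF V_equivariant]]
lemmas bV_bilinear = left_moduleD(3)[OF equivariant_moduleD(3)[OF V_equivariant]]

lemma subs: "submodule A K C" "submodule B K C"
  using A_sub B_sub by (simp_all add: subalgebra_of_def)

lemmas incl = submodule_inclusion_linear[OF subs(1) mC] submodule_inclusion_linear[OF subs(2) mC]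

lemma A_C: "a \<in> A \<Longrightarrow> a \<in> carrier C" and B_C: "b \<in> B \<Longrightarrow> b \<in> carrier C"
  using linear_maps_closed[OF incl(1)] linear_maps_closed[OF incl(2)] by auto

lemmas hA = submodule_left_module[OF hC subs(1) stable(1)]
lemmas mA = left_moduleD(2)[OF submodule_left_module[OF hC subs(1) stable(1)]]

lemma B'_subset: "carrier B' \<subseteq> carrier C" using B_C by auto

lemma bV_closed: "\<forall>b\<in>carrier B'. \<forall>v\<in>carrier V. bV b v \<in> carrier V"
  using bilinear_map_closed[OF bV_bilinear] by blast

lemmas I = Ind_is_module[OF C_algebra mV B'_subset bV_closed]
  and ind = Ind_tensor_bilinear[OF C_algebra mV B'_subset bV_closed]
  and ind_balanced = Ind_tensor_balanced[OF C_algebra mV B'_subset bV_closed]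
  and I_eqI = Ind_eqI[OF C_algebra mV B'_subset bV_closed]
  and act_tensor = Ind_act_tensor[OF C_algebra mV B'_subset bV_closed]
  and act_module = Ind_left_module[OF C_algebra mV B'_subset bV_closed]

lemmas act_bilinear = left_moduleD(3)[OF act_module]

lemmas ident_linear = Ind_ident_linear[OF fac bV]
  and ident_pure = Ind_ident_pure[OF fac bV]
  and ident_bij = Ind_ident_bij[OF fac bV]

lemmas AV = tensor_is_module[OF mA mV]
lemmas diag = diagonal_left_module[OF hA hV]

lemma ind_A: "bilinear_map K A' V I ind"
  by (rule bilinear_map_precomp[OF ind incl(1) linear_maps_id])

lemma ind_mult: "a \<in> carrier C \<Longrightarrow> b \<in> B \<Longrightarrow> v \<in> carrier V \<Longrightarrow> ind (a \<otimes>\<^bsub>C\<^esub> b) v = ind a (bV b v)"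
  using ind_balanced by simp

text \<open>The identification turns the action of a tensor on \<open>A \<otimes> V\<close> into the twisted \<open>\<otimes>\<^sub>B\<close>.\<close>

lemma ident_tensor_act:
  assumes "t \<in> carrier HH" "a \<in> A" "v \<in> carrier V"
  shows "ident (tensor_act K H A' hC V hV t (pure_tensor K A' V a v)) = twist_map K H I hC hV t ind a v"
  unfolding Ind_ident_def
  by (rule tensor_lift_tensor_act[OF hA hV ind_A I assms(1)]) (use assms in simp_all)

lemma hI_left_module: "left_module K H I hI"
proof (rule left_module_transport[OF diag I linear_maps_inv_into[OF ident_linear ident_bij AV] bij_betw_inv_into[OF ident_bij]])
  fix h z assume h: "h \<in> carrier H" and z: "z \<in> carrier I"
  let ?t = "diag h (inv_into (carrier AV) ident z)"
  have "inv_into (carrier AV) ident z \<in> carrier AV"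
    by (rule linear_maps_closed[OF linear_maps_inv_into[OF ident_linear ident_bij AV] z])
  then have "?t \<in> carrier AV" by (rule bilinear_map_closed[OF left_moduleD(3)[OF diag] h])
  then show "hI h z = inv_into (carrier I) (inv_into (carrier AV) ident) ?t"
    by (simp add: Ind_hopf_act_def inv_into_inv_into_eq[OF ident_bij])
qed

lemmas hI_bilinear = left_moduleD(3)[OF hI_left_module]

text \<open>
  The identification of \<open>A \<otimes> V\<close> with the induced module is \<open>H\<close>-equivariant, by construction.
\<close>

lemma hI_ident: "h \<in> carrier H \<Longrightarrow> t \<in> carrier AV \<Longrightarrow> hI h (ident t) = ident (diag h t)"
  by (simp add: Ind_hopf_act_def bij_betw_inv_into_left[OF ident_bij])

text \<open>
  For \<open>c \<in> A\<close> this is the definition of the action.  In general \<open>c\<close> is a sum of products \<open>ab\<close>, and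
  \<open>ab \<otimes>\<^sub>B v = a \<otimes>\<^sub>B bv\<close> reduces the claim to that case; the two Sweedler sums are matched by
  coassociativity.
\<close>

lemma ind_equivariant: "equivariant_map C hC V hV I hI ind"
  unfolding equivariant_map_def
proof (intro ballI)
  fix h c v assume h: "h \<in> carrier H" and c: "c \<in> carrier C" and v: "v \<in> carrier V"
  note \<Delta>h = comult_closed[OF h]
  have on_A: "hI h (ind a w) = twist_map K H I hC hV (\<Delta> h) ind a w" if "a \<in> A" "w \<in> carrier V" for a w
    using hI_ident[OF h, of "pure_tensor K A' V a w"] bilinear_map_closed[OF pure_tensor_bilinear[OF mA mV], of a w] that
    by (simp add: ident_pure diagonal_act_def ident_tensor_act[OF \<Delta>h])
  show "hI h (ind c v) = twist_map K H I hC hV (\<Delta> h) ind c v"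
  proof (rule factorisation_eqI[OF fac bV linear_maps_comp[OF bilinear_map_linear_left[OF ind v] bilinear_map_linear_right[OF hI_bilinear h]]
        bilinear_map_linear_left[OF twist_map_bilinear[OF hC hV I ind \<Delta>h] v] I _ c])
    fix a b assume a: "a \<in> A" and b: "b \<in> B"
    have a': "a \<in> carrier A'" and b': "b \<in> carrier B'" using a b by simp_all
    have bv: "bV b v \<in> carrier V" using bV_closed b v by simp
    have mult: "bilinear_map K A' B' C (mult C)"
      by (rule bilinear_map_precomp[OF mult_C incl])
    have mult_equivariant: "equivariant_map A' hC B' hC C hC (mult C)"
      using C_equivariant by (simp add: equivariant_map_def A_C B_C)
    have "twist_map K H I hC hV (\<Delta> h) ind (a \<otimes>\<^bsub>C\<^esub> b) v =
        twist_map K H I hC hV (\<Delta> h) ind (twist_map K H C hC hC \<one>\<^bsub>tensor_algebra K H H\<^esub> (mult C) a b) v"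
      using twist_map_one[OF hA hB mC mult a' b'] by simp
    also have "\<dots> = twist_map K H I hC hV (\<Delta> h) ind a (twist_map K H V hC hV \<one>\<^bsub>tensor_algebra K H H\<^esub> bV b v)"
      by (rule twisted_associativity[OF hA hB hV hC hV I mult ind bV_bilinear ind_A mult_equivariant bV_equivariant
            _ coassociative_pair_comult[OF h] a' b' v])
        (simp add: ind_mult A_C)
    also have "\<dots> = hI h (ind a (bV b v))"
      using twist_map_one[OF hB hV mV bV_bilinear b' v] a bv by (simp add: on_A)
    finally show "hI h (ind (a \<otimes>\<^bsub>C\<^esub> b) v) = twist_map K H I hC hV (\<Delta> h) ind (a \<otimes>\<^bsub>C\<^esub> b) v"
      using a b v by (simp add: ind_mult A_C)
  qed
qed

text \<open>
  It suffices to consider \<open>z = c' \<otimes>\<^sub>B v\<close>, where the equivariance of \<open>\<otimes>\<^sub>B\<close> and of the product apply.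
\<close>

lemma act_equivariant: "equivariant_map C hC I hI I hI act"
  unfolding equivariant_map_def
proof (intro ballI)
  fix h c z assume h: "h \<in> carrier H" and c: "c \<in> carrier C" and z: "z \<in> carrier I"
  note \<Delta>h = comult_closed[OF h]
  show "hI h (act c z) = twist_map K H I hC hI (\<Delta> h) act c z"
  proof (rule I_eqI[OF linear_maps_comp[OF bilinear_map_linear_right[OF act_bilinear c] bilinear_map_linear_right[OF hI_bilinear h]]
        bilinear_map_linear_right[OF twist_map_bilinear[OF hC hI_left_module I act_bilinear \<Delta>h] c] I _ z])
    fix c' v assume c': "c' \<in> carrier C" and v: "v \<in> carrier V"
    have "twist_map K H I hC hV (\<Delta> h) ind (twist_map K H C hC hC \<one>\<^bsub>tensor_algebra K H H\<^esub> (mult C) c c') v =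
        twist_map K H I hC hI (\<Delta> h) act c (twist_map K H I hC hV \<one>\<^bsub>tensor_algebra K H H\<^esub> ind c' v)"
      by (rule twisted_associativity[OF hC hC hV hC hI_left_module I mult_C ind ind act_bilinear C_equivariant ind_equivariant
            _ coassociative_pair_comult[OF h] c c' v])
        (simp add: act_tensor)
    then show "hI h (act c (ind c' v)) = twist_map K H I hC hI (\<Delta> h) act c (ind c' v)"
      using c c' v equivariant_mapD[OF ind_equivariant h] bilinear_map_closed[OF mult_C]
      by (simp add: act_tensor twist_map_one[OF hC hC mC mult_C] twist_map_one[OF hC hV I ind])
  qed
qed

lemma I_equivariant: "equivariant_module K H \<Delta> \<epsilon> C hC I hI act"
  by (rule equivariant_moduleI[OF C hI_left_module act_module act_equivariant])

abbreviation (input) "CF \<equiv> drinfeld_twist K H G C hC"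
abbreviation (input) "BF \<equiv> CF\<lparr>carrier := B\<rparr>"
abbreviation (input) "AF \<equiv> CF\<lparr>carrier := A\<rparr>"
abbreviation (input) "bVF \<equiv> giaquinto_zhang_twist K H G B' hC V hV bV"
abbreviation (input) "IF \<equiv> Ind K CF BF V bVF"
abbreviation (input) "indF \<equiv> Ind_tensor K CF BF V bVF"
abbreviation (input) "actF \<equiv> Ind_act K CF BF V bVF"
abbreviation (input) "identF \<equiv> Ind_ident K CF AF BF V bVF"
abbreviation (input) "gzI \<equiv> giaquinto_zhang_twist K H G C hC I hI act"

lemmas CF_algebra = drinfeld_twist_algebra[OF C]
lemmas CF_factorisation = drinfeld_twist_factorisation[OF factorisation]
lemmas CF_mult = drinfeld_twist_mult[OF C]

lemma bVF: "left_module K BF V bVF"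
proof (rule left_module_cong_algebra[OF giaquinto_zhang_twist_left_module[OF V_equivariant]])
  show "assoc_algebra K BF"
    by (rule subalgebra_is_algebra[OF CF_algebra drinfeld_twist_subalgebra(1)[OF C B_sub stable(2)]])
qed (simp_all add: drinfeld_twist_subalgebra(2)[OF C B_sub stable(2)])

lemma bVF_eq: "b \<in> B \<Longrightarrow> v \<in> carrier V \<Longrightarrow> bVF b v = twist_map K H V hC hV G bV b v"
  by (rule giaquinto_zhang_twist_eq[OF hB hV bV_bilinear G_closed]) simp_all

lemma BF_subset: "carrier BF \<subseteq> carrier CF" using B_C by auto

lemma bVF_closed: "\<forall>b\<in>carrier BF. \<forall>v\<in>carrier V. bVF b v \<in> carrier V"
  using bilinear_map_closed[OF left_moduleD(3)[OF bVF]] by blast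

lemmas IF_eqI = Ind_eqI[OF CF_algebra mV BF_subset bVF_closed]
  and IF_lift_ex = Ind_lift_ex[OF CF_algebra mV BF_subset bVF_closed]
  and actF_tensor = Ind_act_tensor[OF CF_algebra mV BF_subset bVF_closed]
  and actF_linear = Ind_act_linear[OF CF_algebra mV BF_subset bVF_closed]
  and actF_module = Ind_left_module[OF CF_algebra mV BF_subset bVF_closed]

lemmas identF_linear = Ind_ident_linear[OF CF_factorisation bVF]
  and identF_pure = Ind_ident_pure[OF CF_factorisation bVF]
  and identF_bij = Ind_ident_bij[OF CF_factorisation bVF]

lemma AF_tensor: "tensor K AF V = AV" "pure_tensor K AF V = pure_tensor K A' V"
  by (rule tensor_cong_space; simp)+

abbreviation (input) "GAV \<equiv> tensor_act K H A' hC V hV G"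

lemmas GAV_linear = bilinear_map_linear_right[OF tensor_act_bilinear[OF hA hV] G_closed]
lemmas GAV_bij = tensor_act_inverse_cocycle_bij[OF hA hV]
lemmas gzI_module = giaquinto_zhang_twist_left_module[OF I_equivariant]

lemma gzI_eq: "c \<in> carrier C \<Longrightarrow> z \<in> carrier I \<Longrightarrow> gzI c z = twist_map K H I hC hI G act c z"
  by (rule giaquinto_zhang_twist_eq[OF hC hI_left_module act_bilinear G_closed])

text \<open>
  The isomorphism is induced by \<open>\<otimes>\<^sub>B\<close> twisted by \<open>G\<close>.  It is bijective because, by its formula on
  \<open>A \<otimes> V\<close>, its composite with one identification is the composite of the action of \<open>G\<close> and the other.
\<close>

lemma twisted_Ind_iso_ex:
  "\<exists>\<phi>. left_module_iso K CF IF actF I gzI \<phi> \<and> (\<forall>t\<in>carrier AV. \<phi> (identF t) = ident (GAV t))"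
proof -
  let ?f = "twist_map K H I hC hV G ind"
  have f: "bilinear_map K C V I ?f" by (rule twist_map_bilinear[OF hC hV I ind G_closed])
  have fF: "bilinear_map K CF V I ?f"
    using f by (simp add: bilinear_map_def linear_maps_cong_space[of CF C])
  have balanced: "?f (c \<otimes>\<^bsub>CF\<^esub> b) v = ?f c (bVF b v)"
    if "c \<in> carrier CF" "b \<in> carrier BF" "v \<in> carrier V" for c b v
  proof -
    have c: "c \<in> carrier C" and b: "b \<in> carrier B'" and v: "v \<in> carrier V" using that by simp_all
    have mult: "bilinear_map K C B' C (mult C)"
      by (rule bilinear_map_precomp[OF mult_C linear_maps_id incl(2)])
    have mult_equivariant: "equivariant_map C hC B' hC C hC (mult C)"
      using C_equivariant by (simp add: equivariant_map_def B_C)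
    have "?f (twist_map K H C hC hC G (mult C) c b) v = ?f c (twist_map K H V hC hV G bV b v)"
      by (rule twisted_associativity[OF hC hB hV hC hV I mult ind bV_bilinear ind mult_equivariant bV_equivariant
            _ GG c b v]) (simp add: ind_mult)
    then show ?thesis using c b v by (simp add: CF_mult bVF_eq B_C)
  qed
  obtain \<phi> where \<phi>: "\<phi> \<in> linear_maps K IF I"
    and \<phi>_ind: "\<And>c v. c \<in> carrier C \<Longrightarrow> v \<in> carrier V \<Longrightarrow> \<phi> (indF c v) = ?f c v"
    using IF_lift_ex[OF fF I balanced] by auto
  have \<phi>_ident: "\<phi> (identF t) = ident (GAV t)" if t: "t \<in> carrier AV" for t
  proof (rule tensor_eqI[OF mA mV linear_maps_comp[OF identF_linear[unfolded AF_tensor] \<phi>]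
        linear_maps_comp[OF GAV_linear ident_linear] I _ t])
    fix a v assume "a \<in> carrier A'" "v \<in> carrier V"
    then show "\<phi> (identF (pure_tensor K A' V a v)) = ident (GAV (pure_tensor K A' V a v))"
      using identF_pure[of a v] by (simp add: AF_tensor \<phi>_ind ident_tensor_act[OF G_closed] A_C)
  qed
  have "bij_betw (\<phi> \<circ> identF) (carrier AV) (carrier I)"
    using bij_betw_trans[OF GAV_bij ident_bij] bij_betw_cong[of "carrier AV" "\<phi> \<circ> identF" "ident \<circ> GAV"] \<phi>_ident
    by simp
  then have \<phi>_bij: "bij_betw \<phi> (carrier IF) (carrier I)"
    using bij_betw_comp_iff[OF identF_bij[unfolded AF_tensor]] by blast
  have \<phi>_act: "\<phi> (actF c z) = gzI c (\<phi> z)" if "c \<in> carrier CF" and z: "z \<in> carrier IF" for c z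
  proof -
    have c: "c \<in> carrier C" using that by simp
    note gz = bilinear_map_linear_right[OF left_moduleD(3)[OF gzI_module] that(1)]
    show ?thesis
    proof (rule IF_eqI[OF linear_maps_comp[OF actF_linear[OF that(1)] \<phi>] linear_maps_comp[OF \<phi> gz] I _ z])
      fix c' v assume "c' \<in> carrier CF" and v: "v \<in> carrier V"
      then have c': "c' \<in> carrier C" by simp
      note cc' = bilinear_map_closed[OF twist_map_bilinear[OF hC hC mC mult_C G_closed] c c']
      have "?f (twist_map K H C hC hC G (mult C) c c') v = twist_map K H I hC hI G act c (?f c' v)"
        by (rule twisted_associativity[OF hC hC hV hC hI_left_module I mult_C ind ind act_bilinear
              C_equivariant ind_equivariant _ GG c c' v]) (simp add: act_tensor)
      then show "\<phi> (actF c (indF c' v)) = gzI c (\<phi> (indF c' v))"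
        using c c' v cc' bilinear_map_closed[OF f c' v]
        by (simp add: actF_tensor \<phi>_ind CF_mult gzI_eq)
    qed
  qed
  have "left_module_iso K CF IF actF I gzI \<phi>"
    unfolding left_module_iso_def using actF_module gzI_module \<phi> \<phi>_bij \<phi>_act by blast
  with \<phi>_ident show ?thesis by blast
qed

abbreviation (input) "factored \<equiv> Ind_act_factored K C A' B' V bV"
abbreviation (input) "factoredF \<equiv> Ind_act_factored K CF AF BF V bVF"
abbreviation (input) "gzAV \<equiv> giaquinto_zhang_twist K H G C hC AV diag factored"

text \<open>
  The identification respects the actions of \<open>H\<close> and of \<open>C\<close>, hence also every twist formed from them.
\<close>

lemma ident_gzAV:
  assumes c: "c \<in> carrier C" and t: "t \<in> carrier AV"
  shows "ident (gzAV c t) = gzI c (ident t)" and "gzAV c t \<in> carrier AV"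
proof -
  note factored = left_moduleD(3)[OF Ind_act_factored_left_module[OF fac bV]]
  note diag_closed = bilinear_map_closed[OF left_moduleD(3)[OF diag]]
  note ident_closed = linear_maps_closed[OF ident_linear]
  have gz: "gzAV c t = twist_map K H AV hC diag G factored c t"
    by (rule giaquinto_zhang_twist_eq[OF hC diag factored G_closed c t])
  show "gzAV c t \<in> carrier AV"
    unfolding gz by (rule bilinear_map_closed[OF twist_map_bilinear[OF hC diag AV factored G_closed] c t])
  have "ident (gzAV c t) = twist_map K H I hC diag G (\<lambda>c t. ident (factored c t)) c t"
    unfolding gz by (rule twist_map_post[OF hC diag AV factored I ident_linear G_closed c t])
  also have "\<dots> = twist_map K H I hC diag G (\<lambda>c t. act c (ident t)) c t"
    by (rule twist_map_cong[OF hC diag c t Ind_ident_act_factored[OF fac bV]])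
  also have "\<dots> = twist_map K H I hC hI G act c (ident t)"
    unfolding twist_map_def
    by (rule arg_cong[where f = "\<lambda>f. f G"], rule tensor_lift_cong) (simp add: hI_ident t)
  also have "\<dots> = gzI c (ident t)" using c t ident_closed by (simp add: gzI_eq)
  finally show "ident (gzAV c t) = gzI c (ident t)" .
qed

lemma gzAV_module: "left_module K CF AV gzAV"
proof (rule left_module_transport[OF gzI_module AV ident_linear ident_bij])
  fix c t assume "c \<in> carrier CF" "t \<in> carrier AV"
  then show "gzAV c t = inv_into (carrier AV) ident (gzI c (ident t))"
    using bij_betw_inv_into_left[OF ident_bij ident_gzAV(2)[of c t]] by (simp add: ident_gzAV(1))
qed

text \<open>
  The action of \<open>G\<close> on \<open>A \<otimes> V\<close> is the isomorphism of induced modules seen through the identifications.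
\<close>

lemma twisted_factored_iso: "left_module_iso K CF AV factoredF AV gzAV GAV"
proof -
  obtain \<phi> where iso: "left_module_iso K CF IF actF I gzI \<phi>"
    and \<phi>_ident: "\<And>t. t \<in> carrier AV \<Longrightarrow> \<phi> (identF t) = ident (GAV t)"
    using twisted_Ind_iso_ex by blast
  note factoredF = Ind_act_factored_left_module[OF CF_factorisation bVF, unfolded AF_tensor]
  note ident_factoredF = Ind_ident_act_factored[OF CF_factorisation bVF, unfolded AF_tensor]
  note GAV_closed = linear_maps_closed[OF GAV_linear]
  note identF_closed = linear_maps_closed[OF identF_linear[unfolded AF_tensor]]
  have "GAV (factoredF c t) = gzAV c (GAV t)" if "c \<in> carrier CF" and t: "t \<in> carrier AV" for c t
  proof -
    have c: "c \<in> carrier C" using that by simp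
    have ct: "factoredF c t \<in> carrier AV" by (rule bilinear_map_closed[OF left_moduleD(3)[OF factoredF] that])
    have "ident (GAV (factoredF c t)) = \<phi> (identF (factoredF c t))" by (simp add: \<phi>_ident ct)
    also have "\<dots> = \<phi> (actF c (identF t))" by (simp only: ident_factoredF[OF that])
    also have "\<dots> = gzI c (\<phi> (identF t))"
      using iso that(1) identF_closed[OF t] unfolding left_module_iso_def by blast
    also have "\<dots> = ident (gzAV c (GAV t))"
      by (simp add: \<phi>_ident t ident_gzAV(1)[OF c GAV_closed[OF t]])
    finally show ?thesis
      using bij_betw_imp_inj_on[OF ident_bij] GAV_closed[OF ct] ident_gzAV(2)[OF c GAV_closed[OF t]]
      by (auto dest: inj_onD)
  qed
  then show ?thesis
    unfolding left_module_iso_def using factoredF gzAV_module GAV_linear GAV_bij by blast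
qed

end

text \<open>
  The induced module uses \<open>B\<close> only as the set over which the balancing relations range, and the
  identification uses \<open>A\<close> only as a vector space.  So the twisted subalgebra may be replaced by the
  corresponding subset of the twisted algebra.
\<close>

lemma Ind_cong_space:
  assumes "carrier B' = carrier B"
  shows "Ind K C B' V bV = Ind K C B V bV" "Ind_tensor K C B' V bV = Ind_tensor K C B V bV"
    "Ind_act K C B' V bV = Ind_act K C B V bV"
proof -
  have "balancing_relations K C B' V bV = balancing_relations K C B V bV"
    by (simp add: balancing_relations_def assms)
  then show "Ind K C B' V bV = Ind K C B V bV" "Ind_tensor K C B' V bV = Ind_tensor K C B V bV"
    by (simp_all add: Ind_def Ind_tensor_def fun_eq_iff)
  then show "Ind_act K C B' V bV = Ind_act K C B V bV"
    by (simp add: Ind_act_def fun_eq_iff)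
qed

lemma Ind_act_factored_cong_space:
  assumes B: "carrier B' = carrier B"
    and A: "carrier A' = carrier A" "add A' = add A" "smult A' = smult A"
  shows "Ind_act_factored K C A' B' V bV = Ind_act_factored K C A B V bV"
proof -
  have "Ind_ident K C A' B' V bV = Ind_ident K C A B V bV"
    by (simp add: Ind_ident_def Ind_cong_space[OF B] tensor_lift_cong_space[OF A refl refl refl refl refl refl])
  then show ?thesis
    by (intro ext) (simp add: Ind_act_factored_def Ind_cong_space[OF B] tensor_cong_space(1)[OF A refl refl refl])
qed

theorem proposition2p12:
  fixes K :: "'k ring" and H :: "('k, 'h) module"
    and \<Delta> :: "'h \<Rightarrow> ('h \<times> 'h \<Rightarrow> 'k) set" and \<epsilon> :: "'h \<Rightarrow> 'k" and S :: "'h \<Rightarrow> 'h"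
    and F :: "('h \<times> 'h \<Rightarrow> 'k) set"
    and C :: "('k, 'c) module" and hC :: "'h \<Rightarrow> 'c \<Rightarrow> 'c" and A B :: "'c set"
    and V :: "('k, 'v) module" and hV :: "'h \<Rightarrow> 'v \<Rightarrow> 'v" and bV :: "'c \<Rightarrow> 'v \<Rightarrow> 'v"
  assumes "field K"
    and "hopf_algebra K H \<Delta> \<epsilon> S"
    and "two_cocycle K H \<Delta> \<epsilon> F"
    and "equivariant_algebra_factorisation K H \<Delta> \<epsilon> C hC A B"
    and "equivariant_module K H \<Delta> \<epsilon> (C\<lparr>carrier := B\<rparr>) hC V hV bV"
  shows
    "let G = inv\<^bsub>tensor_algebra K H H\<^esub> F;
         A' = C\<lparr>carrier := A\<rparr>;
         B' = C\<lparr>carrier := B\<rparr>;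
         C\<^sub>F = drinfeld_twist K H G C hC;
         A\<^sub>F = drinfeld_twist K H G A' hC;
         B\<^sub>F = drinfeld_twist K H G B' hC;
         bV\<^sub>F = giaquinto_zhang_twist K H G B' hC V hV bV;
         AV = tensor K A' V
     in (\<exists>\<phi>. left_module_iso K C\<^sub>F
              (Ind K C\<^sub>F B\<^sub>F V bV\<^sub>F) (Ind_act K C\<^sub>F B\<^sub>F V bV\<^sub>F)
              (Ind K C B' V bV)
              (giaquinto_zhang_twist K H G C hC (Ind K C B' V bV)
                (Ind_hopf_act K H \<Delta> C hC A' B' V hV bV) (Ind_act K C B' V bV))
              \<phi>) \<and>
        left_module_iso K C\<^sub>F
          AV (Ind_act_factored K C\<^sub>F A\<^sub>F B\<^sub>F V bV\<^sub>F)
          AV (giaquinto_zhang_twist K H G C hC AV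
               (diagonal_act K H \<Delta> A' hC V hV) (Ind_act_factored K C A' B' V bV))
          (tensor_act K H A' hC V hV G)"
proof -
  interpret equivariant_induction K H \<Delta> \<epsilon> S F C hC A B V hV bV
    by (intro equivariant_induction.intro hopf_algebra_cocycle.intro hopf_algebra_cocycle_axioms.intro
        equivariant_induction_axioms.intro assms(2-))
  \<comment> \<open>The statement has the twists of the subalgebras where the locale has subsets of the twist of \<open>C\<close>.\<close>
  have B: "carrier (drinfeld_twist K H G B' hC) = carrier BF" by simp
  have A: "carrier (drinfeld_twist K H G A' hC) = carrier AF" "add (drinfeld_twist K H G A' hC) = add AF"
    "smult (drinfeld_twist K H G A' hC) = smult AF" by simp_all
  show ?thesis
    unfolding Let_def Ind_cong_space[OF B] Ind_act_factored_cong_space[OF B A]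
    using twisted_Ind_iso_ex twisted_factored_iso by blast
qed

end
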